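(* Let $\mu$ be an infinite cardinal. Suppose that $\vec C$ is a $\square^*_\mu$-sequence such that $V(\vec C)$ contains a club in $\mu^+$, and $\omega\in\Theta_1^\mu(\vec C\restriction A(\vec C),\mu^+)$. Then $T(\rho_0^{\vec C})\nrightarrow[\mu^+]^{n,1}_{\mu^+}$ holds for every positive integer $n$.
   Context: Let $\kappa=\mu^+$. A $C$-sequence over $S\subseteq\kappa$ is $\langle C_\delta\mid\delta\in S\rangle$, each $C_\delta$ closed in $\delta$ with $\sup(C_\delta)=\sup(\delta)$. A $\square^*_\mu$-sequence is a $C$-sequence over $\mu^+$ that is $\mu$-bounded ($\mathrm{otp}(C_\delta)\le\mu$) and weakly coherent (for all $\epsilon<\mu^+$, $|\{C_\delta\cap\epsilon\mid\delta<\mu^+\}|\le\mu$). $\mathrm{acc}(\kappa)$: nonzero limit ordinals below $\kappa$; $\mathrm{acc}(A)=\{\alpha\in A\mid\sup(A\cap\alpha)=\alpha>0\}$, $\mathrm{nacc}(A)=A\setminus\mathrm{acc}(A)$. $V(\vec C)=\{\delta\in\mathrm{acc}(\kappa)\mid\forall\alpha\in(\delta,\kappa)\,\forall\epsilon<\delta\,[C_\delta\cap[\epsilon,\delta)\ne C_\alpha\cap[\epsilon,\delta)]\}$; $A(\vec C)=\{\delta\in\mathrm{acc}(\kappa)\mid\forall\alpha\in(\delta,\kappa)\,[\delta\notin\mathrm{acc}(C_\alpha)]\}$, $\vec C\restriction A(\vec C)=\langle C_\delta\mid\delta\in A(\vec C)\rangle$. For $S,T\subseteq\kappa$, a $C$-sequence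 $\langle C_\delta\mid\delta\in S\rangle$ and a cardinal $\mu$, $\Theta_1^\mu(\vec C,T)$ is the set of nonzero cardinals $\theta$ for which there are $g:\kappa\to\mu$, $h:\kappa\to\theta$ such that for every club $D\subseteq\kappa$ and every $\nu<\mu$ there is $\delta\in S$ with, for every $\tau<\theta$, $\sup\{\gamma\in\mathrm{nacc}(C_\delta)\cap D\cap T\mid g(\mathrm{otp}(C_\delta\cap\gamma))=\nu,\ h(\mathrm{otp}(C_\delta\cap\gamma))=\tau\}=\delta$. Walks: $\mathrm{Tr}(\beta,\gamma)(0)=\gamma$, $\mathrm{Tr}(\beta,\gamma)(n)=\min(C_{\mathrm{Tr}(\beta,\gamma)(n-1)}\setminus\beta)$ if $\mathrm{Tr}(\beta,\gamma)(n-1)>\beta$, else $\beta$; $\rho_2(\beta,\gamma)$ least $l$ with $\mathrm{Tr}(\beta,\gamma)(l)=\beta$; $\rho_0(\beta,\gamma)=\langle\mathrm{otp}(C_{\mathrm{Tr}(\beta,\gamma)(n)}\cap\beta)\mid n<\rho_2(\beta,\gamma)\rangle$. $T(\rho_0^{\vec C})=\{\rho_{0\delta}\restriction\gamma\mid\gamma\le\delta<\kappa\}$ with $\rho_{0\delta}(\xi)=\rho_0(\xi,\delta)$, ordered by $\subseteq$, height of $t$ = $\mathrm{dom}(t)$. Lexicographic order: if $f,g$ comparable, $f<_{\mathrm{lex}}g$ iff $f\supsetneq g$; else compare at the least point of difference, with ordinals compared naturally and elements of ${}^{<\omega}\kappa$ compared by $<_{\mathrm{lex}}$. $\Delta(x,y)$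 = least common-domain point where $x,y$ differ, or $\min\{\mathrm{dom}(x),\mathrm{dom}(y)\}$; $x\wedge y=x\restriction\Delta(x,y)$. A set of $n$-sequences of nodes is rapid if for distinct members, all heights in one lie below all heights in the other. $T\nrightarrow[\kappa]^{n,m}_\theta$: there is $c:T\to\theta$ with (1) for every rapid $S\subseteq{}^nT$ of size $\kappa$ and $\tau<\theta$ there are $(x_k)_{k<n}\ne(y_k)_{k<n}$ in $S$ with $c(x_k\wedge y_k)=\tau$ for all $k$, ($x_k<_{\mathrm{lex}}y_k\Rightarrow\mathrm{dom}(x_k)<\mathrm{dom}(y_k)$) for all $k$, and $|\{\mathrm{dom}(x_k\wedge y_k)\mid k<n\}|\le m$; (2) for every $T'\subseteq T$ of size $\kappa$ there is a rapid $S'\subseteq{}^nT'$ of size $\kappa$ such that for every $S\subseteq S'$ of size $\kappa$ and $\tau\in{}^n\theta$ there are $(x_k)\ne(y_k)$ in $S$ with $c(x_k\wedge y_k)=\tau(k)$ for all $k$ plus the last two conditions of (1). *)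

theory Defs
  imports "HOL-Library.Equipollence" "HOL-Library.Sublist"
begin

text \<open>Ordinals below kappa are the elements of a well-ordered type 'k; the type
  itself plays the role of kappa = mu^+ (see is_succ_of).  Ordinals are identified
  with their sets of predecessors {..<a}.\<close>

definition is_lim :: "'k::wellorder \<Rightarrow> bool" where
  "is_lim \<delta> \<longleftrightarrow> (\<exists>\<beta>. \<beta> < \<delta>) \<and> (\<forall>\<beta><\<delta>. \<exists>\<gamma>. \<beta> < \<gamma> \<and> \<gamma> < \<delta>)"

definition reaches :: "'k::wellorder set \<Rightarrow> 'k \<Rightarrow> bool" where
  "reaches X \<alpha> \<longleftrightarrow> (\<exists>\<beta>. \<beta> < \<alpha>) \<and> (\<forall>\<beta><\<alpha>. \<exists>\<gamma>\<in>X. \<beta> < \<gamma> \<and> \<gamma> < \<alpha>)"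

definition acc :: "'k::wellorder set \<Rightarrow> 'k set" where
  "acc X = {\<alpha>\<in>X. reaches X \<alpha>}"

definition nacc :: "'k::wellorder set \<Rightarrow> 'k set" where
  "nacc X = X - acc X"

definition is_sup :: "'k::wellorder set \<Rightarrow> 'k \<Rightarrow> bool" where
  "is_sup X s \<longleftrightarrow> (\<forall>x\<in>X. x \<le> s) \<and> (\<forall>t. (\<forall>x\<in>X. x \<le> t) \<longrightarrow> s \<le> t)"

definition closed_below :: "'k::wellorder set \<Rightarrow> 'k \<Rightarrow> bool" where
  "closed_below X \<delta> \<longleftrightarrow> (\<forall>\<alpha><\<delta>. reaches X \<alpha> \<longrightarrow> \<alpha> \<in> X)"

definition club :: "'k::wellorder set \<Rightarrow> bool" where
  "club D \<longleftrightarrow> (\<forall>\<beta>. \<exists>\<gamma>\<in>D. \<beta> < \<gamma>) \<and> (\<forall>\<alpha>. reaches D \<alpha> \<longrightarrow> \<alpha> \<in> D)"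

definition otp :: "'k::wellorder set \<Rightarrow> 'k" where
  "otp X = (THE a. \<exists>f. bij_betw f {..<a} X \<and> strict_mono_on {..<a} f)"

definition is_cardinal :: "'k::wellorder \<Rightarrow> bool" where
  "is_cardinal m \<longleftrightarrow> (\<forall>x<m. \<not> ({..<x} \<approx> {..<m}))"

definition infinite_cardinal :: "'k::wellorder \<Rightarrow> bool" where
  "infinite_cardinal m \<longleftrightarrow> is_cardinal m \<and> infinite {..<m}"

text \<open>The whole type 'k has order type mu^+ where mu = m.\<close>
definition is_succ_of :: "'k::wellorder \<Rightarrow> bool" where
  "is_succ_of m \<longleftrightarrow> (\<forall>a::'k. {..<a} \<lesssim> {..<m}) \<and> \<not> ((UNIV::'k set) \<lesssim> {..<m})"

definition omega :: "'k::wellorder" where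
  "omega = (LEAST x. is_lim x)"

definition C_seq_over :: "'k::wellorder set \<Rightarrow> ('k \<Rightarrow> 'k set) \<Rightarrow> bool" where
  "C_seq_over S C \<longleftrightarrow> (\<forall>\<delta>\<in>S. C \<delta> \<subseteq> {..<\<delta>} \<and> closed_below (C \<delta>) \<delta> \<and>
      (\<forall>s. is_sup (C \<delta>) s \<longleftrightarrow> is_sup {..<\<delta>} s))"

definition square_star :: "'k::wellorder \<Rightarrow> ('k \<Rightarrow> 'k set) \<Rightarrow> bool" where
  "square_star m C \<longleftrightarrow> C_seq_over UNIV C \<and> (\<forall>\<delta>. otp (C \<delta>) \<le> m) \<and>
      (\<forall>\<epsilon>. {C \<delta> \<inter> {..<\<epsilon>} | \<delta>. True} \<lesssim> {..<m})"

definition Vset :: "('k::wellorder \<Rightarrow> 'k set) \<Rightarrow> 'k set" where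
  "Vset C = {\<delta>. is_lim \<delta> \<and> (\<forall>\<alpha>>\<delta>. \<forall>\<epsilon><\<delta>. C \<delta> \<inter> {\<epsilon>..<\<delta>} \<noteq> C \<alpha> \<inter> {\<epsilon>..<\<delta>})}"

definition Aset :: "('k::wellorder \<Rightarrow> 'k set) \<Rightarrow> 'k set" where
  "Aset C = {\<delta>. is_lim \<delta> \<and> (\<forall>\<alpha>>\<delta>. \<delta> \<notin> acc (C \<alpha>))}"

text \<open>Theta_1^mu(C restricted to S, T) for cardinals theta below kappa; mu = m.\<close>
definition Theta1 :: "'k::wellorder \<Rightarrow> 'k set \<Rightarrow> ('k \<Rightarrow> 'k set) \<Rightarrow> 'k set \<Rightarrow> 'k set" where
  "Theta1 m S C T = {\<theta>. (\<exists>x. x < \<theta>) \<and> is_cardinal \<theta> \<and>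
     (\<exists>g h. (\<forall>x. g x < m) \<and> (\<forall>x. h x < \<theta>) \<and>
       (\<forall>D. club D \<longrightarrow> (\<forall>\<nu><m. \<exists>\<delta>\<in>S. \<forall>\<tau><\<theta>.
          reaches {\<gamma> \<in> nacc (C \<delta>) \<inter> D \<inter> T.
                    g (otp (C \<delta> \<inter> {..<\<gamma>})) = \<nu> \<and> h (otp (C \<delta> \<inter> {..<\<gamma>})) = \<tau>} \<delta>)))}"

fun Tr :: "('k::wellorder \<Rightarrow> 'k set) \<Rightarrow> 'k \<Rightarrow> 'k \<Rightarrow> nat \<Rightarrow> 'k" where
  "Tr C \<beta> \<gamma> 0 = \<gamma>"
| "Tr C \<beta> \<gamma> (Suc n) = (if \<beta> < Tr C \<beta> \<gamma> n
      then (LEAST x. x \<in> C (Tr C \<beta> \<gamma> n) \<and> \<beta> \<le> x) else \<beta>)"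

definition rho2 :: "('k::wellorder \<Rightarrow> 'k set) \<Rightarrow> 'k \<Rightarrow> 'k \<Rightarrow> nat" where
  "rho2 C \<beta> \<gamma> = (LEAST l. Tr C \<beta> \<gamma> l = \<beta>)"

definition rho0 :: "('k::wellorder \<Rightarrow> 'k set) \<Rightarrow> 'k \<Rightarrow> 'k \<Rightarrow> 'k list" where
  "rho0 C \<beta> \<gamma> = map (\<lambda>n. otp (C (Tr C \<beta> \<gamma> n) \<inter> {..<\<beta>})) [0..<rho2 C \<beta> \<gamma>]"

text \<open>Nodes are partial functions from 'k with domain an initial segment {..<gamma}.\<close>
type_synonym 'k node = "'k \<Rightarrow> 'k list option"

definition rho0_node :: "('k::wellorder \<Rightarrow> 'k set) \<Rightarrow> 'k \<Rightarrow> 'k \<Rightarrow> 'k node" where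
  "rho0_node C \<delta> \<gamma> = (\<lambda>\<xi>. if \<xi> < \<gamma> then Some (rho0 C \<xi> \<delta>) else None)"

definition tree_rho0 :: "('k::wellorder \<Rightarrow> 'k set) \<Rightarrow> 'k node set" where
  "tree_rho0 C = {rho0_node C \<delta> \<gamma> | \<gamma> \<delta>. \<gamma> \<le> \<delta>}"

definition ht :: "'k::wellorder node \<Rightarrow> 'k" where
  "ht t = (LEAST \<gamma>. dom t = {..<\<gamma>})"

definition list_lex :: "'k::linorder list \<Rightarrow> 'k list \<Rightarrow> bool" where
  "list_lex s t \<longleftrightarrow> (if prefix s t \<or> prefix t s then strict_prefix t s
     else (\<exists>i. i < length s \<and> i < length t \<and> s!i \<noteq> t!i \<and> (\<forall>j<i. s!j = t!j) \<and> s!i < t!i))"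

definition node_lex :: "'k::wellorder node \<Rightarrow> 'k node \<Rightarrow> bool" where
  "node_lex x y \<longleftrightarrow> (if x \<subseteq>\<^sub>m y \<or> y \<subseteq>\<^sub>m x then (y \<subseteq>\<^sub>m x \<and> x \<noteq> y)
     else (\<exists>\<xi>. \<xi> \<in> dom x \<inter> dom y \<and> x \<xi> \<noteq> y \<xi> \<and>
             (\<forall>\<eta><\<xi>. \<eta> \<in> dom x \<inter> dom y \<longrightarrow> x \<eta> = y \<eta>) \<and>
             list_lex (the (x \<xi>)) (the (y \<xi>))))"

definition Delta :: "'k::wellorder node \<Rightarrow> 'k node \<Rightarrow> 'k" where
  "Delta x y = (if \<exists>\<xi>\<in>dom x \<inter> dom y. x \<xi> \<noteq> y \<xi>
     then (LEAST \<xi>. \<xi> \<in> dom x \<inter> dom y \<and> x \<xi> \<noteq> y \<xi>) else min (ht x) (ht y))"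

definition meet :: "'k::wellorder node \<Rightarrow> 'k node \<Rightarrow> 'k node" where
  "meet x y = x |` {..<Delta x y}"

definition rapid :: "nat \<Rightarrow> 'k::wellorder node list set \<Rightarrow> bool" where
  "rapid n S \<longleftrightarrow> (\<forall>s\<in>S. \<forall>t\<in>S. s \<noteq> t \<longrightarrow>
     (\<forall>i<n. \<forall>j<n. ht (s!i) < ht (t!j)) \<or> (\<forall>i<n. \<forall>j<n. ht (t!i) < ht (s!j)))"

definition good_pair :: "('k::wellorder node \<Rightarrow> 'k) \<Rightarrow> nat \<Rightarrow> nat \<Rightarrow> 'k node list \<Rightarrow> 'k node list \<Rightarrow> (nat \<Rightarrow> 'k) \<Rightarrow> bool" where
  "good_pair c n m x y \<tau> \<longleftrightarrow> x \<noteq> y \<and>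
     (\<forall>k<n. c (meet (x!k) (y!k)) = \<tau> k \<and> (node_lex (x!k) (y!k) \<longrightarrow> ht (x!k) < ht (y!k))) \<and>
     card {ht (meet (x!k) (y!k)) | k. k < n} \<le> m"

definition tree_neg_arrow :: "'k::wellorder node set \<Rightarrow> nat \<Rightarrow> nat \<Rightarrow> 'k set \<Rightarrow> bool" where
  "tree_neg_arrow T n m \<Theta> \<longleftrightarrow> (\<exists>c. (\<forall>t\<in>T. c t \<in> \<Theta>) \<and>
     (\<forall>S. S \<subseteq> {s. length s = n \<and> set s \<subseteq> T} \<and> rapid n S \<and> S \<approx> (UNIV::'k::wellorder set) \<longrightarrow>
        (\<forall>\<tau>\<in>\<Theta>. \<exists>x\<in>S. \<exists>y\<in>S. good_pair c n m x y (\<lambda>_. \<tau>))) \<and>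
     (\<forall>T'. T' \<subseteq> T \<and> T' \<approx> (UNIV::'k::wellorder set) \<longrightarrow>
        (\<exists>S'. S' \<subseteq> {s. length s = n \<and> set s \<subseteq> T'} \<and> rapid n S' \<and> S' \<approx> (UNIV::'k::wellorder set) \<and>
           (\<forall>S. S \<subseteq> S' \<and> S \<approx> (UNIV::'k::wellorder set) \<longrightarrow>
              (\<forall>\<tau>. (\<forall>k<n. \<tau> k \<in> \<Theta>) \<longrightarrow> (\<exists>x\<in>S. \<exists>y\<in>S. good_pair c n m x y \<tau>))))))"

end

theory Submission
  imports Defs "HOL-Library.Countable"
begin

text \<open>
  Walks concatenate at points of \<open>A(C)\<close>: \<open>\<rho>\<^sub>0(\<xi>,\<alpha>) = \<rho>\<^sub>0(\<delta>,\<alpha>) @ \<rho>\<^sub>0(\<xi>,\<delta>)\<close> for \<open>\<delta> \<in> A(C)\<close> and \<open>\<xi> < \<delta>\<close>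
  close to \<open>\<delta>\<close>; and two branches of the tree never split at a point of \<open>V(C)\<close>.  From a rapid
  family, pressing down (the ideal of sets that do not guess is normal) extracts members whose
  \<open>k\<close>-th words near a guessing point \<open>\<delta>\<close> are \<open>s\<^sub>k @ i\<^sub>1 # y\<^sub>j @ \<rho>\<^sub>0(\<xi>,\<delta>)\<close>, simultaneously for \<open>n\<^sup>2 + 1\<close>
  increasing words \<open>y\<^sub>j\<close>.  Guessing the right letter \<open>i\<close> in \<open>nacc(C\<^sub>\<delta>)\<close> and comparing with some
  \<open>\<delta>' < \<delta>\<close> that agrees with \<open>\<delta>\<close> for long enough, all \<open>n\<close> coordinates split at the same \<open>\<epsilon>\<close>, and
  their words at the last point below \<open>\<epsilon>\<close> of a club contained in \<open>V(C)\<close> are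
  \<open>s\<^sub>k @ i\<^sub>1 # y\<^sub>j @ i # \<dots>\<close>.  The colour is decoded from this word: a selector on words of natural
  numbers finds the position of \<open>i\<close>, for a suitable \<open>j\<close> and all \<open>k\<close> at once; \<open>i\<close> tells which
  letter \<open>i\<^sub>1\<close> delimits the stem, hence the level \<open>\<psi>\<close> up to which the \<open>k\<close>-th coordinates are
  constant, and \<open>g(i)\<close> codes a finite function from nodes of level \<open>\<psi>\<close> to colours.
\<close>

text \<open>The colour must be computed from the meet alone. Its word continues behind
  \<open>i\<close> with the walk from \<open>\<gamma>\<close>, which is not controlled and may
  contain larger letters with claims of their own, so \<open>i\<close> cannot be found by its size.
  It can announce what it wants, being guessed after \<open>s\<^sub>k\<close>,
  \<open>i\<^sub>1\<close> and all \<open>y\<^sub>j\<close> are fixed, but the tail is known only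
  later; hence it offers alternatives \<open>j\<close>. Competing claims are kept down to
  \<open>n\<close> words, each blocking at most one alternative per coordinate, so
  \<open>n\<^sup>2 + 1\<close> alternatives suffice. The value at \<open>\<epsilon>\<close> does not
  belong to the meet, so the word is read off earlier, at a place that the height of the meet
  determines. The given club has a last point below \<open>\<epsilon>\<close> because it is closed
  and, being contained in \<open>V(C)\<close>, omits \<open>\<epsilon>\<close>. The colours are
  coded by \<open>g(i)\<close> and not by the label of \<open>i\<close>, since there can be \<mu>
  many finite functions to code but only countably many labels. Which value of \<open>g\<close> is
  wanted depends on the level \<open>\<psi>\<close>, so the stem is fixed by a first round of
  pressing down and the words \<open>y\<^sub>j\<close> by a second.\<close>

section \<open>Selecting a letter in a word\<close>

text \<open>A letter \<open>a\<close> codes a matrix \<open>fam a\<close> of words with letters below \<open>a\<close>, increasing along each column.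
  For each tail \<open>r\<close>, some row \<open>j\<close> is needed all of whose words \<open>fam a j k @ a # r\<close> are assigned the
  position of \<open>a\<close>.  The assignment is built by recursion on a bound for the letters: \<open>owner\<close> gives
  a row to the largest letter and passes on the words thus used up as a set \<open>Z\<close> to be avoided by
  smaller letters.  Identifying the words of a common task (\<open>class_word\<close>) keeps \<open>Z\<close> of size at
  most \<open>n\<close>; as \<open>class_word\<close> is injective along columns, \<open>Z\<close> rules out at most \<open>n\<^sup>2\<close> rows.\<close>

context
  fixes n J :: nat and fam :: "nat \<Rightarrow> nat \<Rightarrow> nat \<Rightarrow> nat list"
begin

definition valid_letter :: "nat \<Rightarrow> bool" where
  "valid_letter a \<longleftrightarrow> (\<forall>j\<le>J. \<forall>k<n. set (fam a j k) \<subseteq> {..<a}) \<and>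
     (\<forall>k<n. \<forall>j'\<le>J. \<forall>j<j'. strict_prefix (fam a j k) (fam a j' k))"

primrec class_word :: "nat \<Rightarrow> nat list \<Rightarrow> nat list" where
  "class_word 0 w = w"
| "class_word (Suc M) w = (if M \<in> set w then
     (let y = takeWhile (\<lambda>a. a \<noteq> M) w in
       (if valid_letter M \<and> (\<exists>j\<le>J. \<exists>k<n. class_word M y = class_word M (fam M j k))
        then class_word M (fam M 0 0) else class_word M y) @ dropWhile (\<lambda>a. a \<noteq> M) w)
     else class_word M w)"

definition free_option :: "nat \<Rightarrow> nat list set \<Rightarrow> nat \<Rightarrow> bool" where
  "free_option M Z j \<longleftrightarrow> j \<le> J \<and> (\<forall>k<n. \<forall>z\<in>Z. class_word M (fam M j k) \<noteq> class_word M z)"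

definition claimed :: "nat \<Rightarrow> nat list set \<Rightarrow> nat list set" where
  "claimed M Z = (if valid_letter M then {fam M (LEAST j. free_option M Z j) k | k. k < n} else {})"

definition strip :: "nat \<Rightarrow> nat list \<Rightarrow> nat list set \<Rightarrow> nat list set" where
  "strip M z Z = {y. M \<notin> set y \<and> y @ z \<in> Z}"

primrec owner :: "nat \<Rightarrow> nat list set \<Rightarrow> nat list \<Rightarrow> nat" where
  "owner 0 Z w = 0"
| "owner (Suc M) Z w = (if M \<in> set w then
     (let y = takeWhile (\<lambda>a. a \<noteq> M) w; Z' = strip M (dropWhile (\<lambda>a. a \<noteq> M) w) Z;
          X = claimed M Z' in
        if y \<in> X then length y
        else owner M {y' \<in> Z' \<union> X. class_word M y' = class_word M y} y)
     else owner M Z w)"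

section \<open>Cutting a word at the first occurrence of its largest letter\<close>

lemma takeWhile_first: "M \<notin> set y \<Longrightarrow> takeWhile (\<lambda>a. a \<noteq> M) (y @ M # z) = y"
  by (subst takeWhile_append2) auto

lemma dropWhile_first: "M \<notin> set y \<Longrightarrow> dropWhile (\<lambda>a. a \<noteq> M) (y @ M # z) = M # z"
  by (subst dropWhile_append2) auto

lemma class_word_Suc:
  assumes "M \<notin> set y"
  shows "class_word (Suc M) (y @ M # z) =
     (if valid_letter M \<and> (\<exists>j\<le>J. \<exists>k<n. class_word M y = class_word M (fam M j k))
        then class_word M (fam M 0 0) else class_word M y) @ M # z"
  using assms by (simp add: takeWhile_first dropWhile_first Let_def del: takeWhile.simps dropWhile.simps)

lemma owner_Suc:
  assumes "M \<notin> set y" "Z' = strip M (M # z) Z" "X = claimed M Z'"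
  shows "owner (Suc M) Z (y @ M # z) = (if y \<in> X then length y
        else owner M {y' \<in> Z' \<union> X. class_word M y' = class_word M y} y)"
  using assms by (simp add: takeWhile_first dropWhile_first Let_def)

lemma split_first:
  assumes "M \<in> set w"
  obtains y z where "w = y @ M # z" "M \<notin> set y"
  using split_list_first[OF assms] by blast

lemma append_Cons_first_eq:
  assumes "c @ M # z = c' @ M # z'" "M \<notin> set c" "M \<notin> set c'"
  shows "c = c' \<and> z = z'"
proof -
  have "c = c'" using takeWhile_first[OF assms(2), of z] takeWhile_first[OF assms(3), of z'] assms(1) by simp
  then show ?thesis using assms(1) by simp
qed

lemma below_Suc_cases:
  assumes "set w \<subseteq> {..<Suc M}" "M \<notin> set w" shows "set w \<subseteq> {..<M}"
  using assms by (auto simp: less_Suc_eq)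

lemma class_word_letters:
  "0 < n \<Longrightarrow> set w \<subseteq> {..<B} \<Longrightarrow> set (class_word B w) \<subseteq> {..<B}"
proof (induction B arbitrary: w)
  case (Suc M)
  show ?case
  proof (cases "M \<in> set w")
    case True
    then obtain y z where yz: "w = y @ M # z" "M \<notin> set y" by (rule split_first)
    have 1: "set (class_word M y) \<subseteq> {..<M}"
      using Suc yz by (intro Suc.IH) (auto simp: less_Suc_eq)
    have 2: "set (class_word M (fam M 0 0)) \<subseteq> {..<M}" if "valid_letter M"
      using that Suc by (intro Suc.IH) (auto simp: valid_letter_def)
    have 3: "set z \<subseteq> {..<Suc M}" using Suc.prems yz by auto
    have 1: "set (class_word M y) \<subseteq> {..<Suc M}" using 1 by auto
    have 2: "set (class_word M (fam M 0 0)) \<subseteq> {..<Suc M}" if "valid_letter M"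
      using 2[OF that] by auto
    show ?thesis unfolding yz(1) class_word_Suc[OF yz(2)] using 1 2 3 by simp
  next
    case False
    then show ?thesis using Suc.IH[OF Suc.prems(1) below_Suc_cases[OF Suc.prems(2) False]]
      by (auto simp: less_Suc_eq)
  qed
qed simp

lemma class_word_shape:
  assumes "0 < n" "set w \<subseteq> {..<Suc M}" "w = y @ M # z" "M \<notin> set y"
  shows "\<exists>c. class_word (Suc M) w = c @ M # z \<and> M \<notin> set c"
proof -
  have 1: "set (class_word M y) \<subseteq> {..<M}"
    using assms by (intro class_word_letters) (auto simp: less_Suc_eq)
  have 2: "set (class_word M (fam M 0 0)) \<subseteq> {..<M}" if "valid_letter M"
    using that assms by (intro class_word_letters) (auto simp: valid_letter_def)
  show ?thesis unfolding assms(3) class_word_Suc[OF assms(4)] using 1 2 by auto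
qed

text \<open>From the first \<open>M\<close> on nothing is changed, so equal classes have equal
  remainders behind the first \<open>M\<close>, and a proper extension would lengthen that
  remainder. Injectivity may fail for unrelated words, since whole matrices are collapsed, but the
  words of a column form a prefix chain.\<close>

lemma class_word_prefix_inj:
  assumes "0 < n"
  shows "\<lbrakk>set w \<subseteq> {..<B}; set w' \<subseteq> {..<B}; prefix w w'; class_word B w = class_word B w'\<rbrakk> \<Longrightarrow> w = w'"
proof (induction B arbitrary: w w')
  case (Suc M)
  show ?case
  proof (cases "M \<in> set w'")
    case True
    then obtain y' z' where yz': "w' = y' @ M # z'" "M \<notin> set y'" by (rule split_first)
    from class_word_shape[OF assms Suc.prems(2) yz'] obtain c'
      where c': "class_word (Suc M) w' = c' @ M # z'" "M \<notin> set c'" by blast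
    show ?thesis
    proof (cases "M \<in> set w")
      case True
      then obtain y z where yz: "w = y @ M # z" "M \<notin> set y" by (rule split_first)
      from class_word_shape[OF assms Suc.prems(1) yz] obtain c
        where c: "class_word (Suc M) w = c @ M # z" "M \<notin> set c" by blast
      have "z = z'" using append_Cons_first_eq[of c M z c' z'] c c' Suc.prems(4) by simp
      moreover obtain v where "w' = w @ v" using Suc.prems(3) by (auto simp: prefix_def)
      then have "y @ M # (z @ v) = y' @ M # z'" using yz yz' by simp
      then have "y = y'" using append_Cons_first_eq yz(2) yz'(2) by metis
      ultimately show ?thesis using yz yz' by simp
    next
      case False
      then have "set w \<subseteq> {..<M}" using below_Suc_cases Suc.prems(1) by blast
      then have "set (class_word M w) \<subseteq> {..<M}" by (rule class_word_letters[OF assms])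
      moreover have "class_word M w = c' @ M # z'" using Suc.prems(4) c'(1) False by simp
      ultimately have "set (c' @ M # z') \<subseteq> {..<M}" by simp
      then show ?thesis by simp
    qed
  next
    case False
    moreover have "M \<notin> set w" using False Suc.prems(3) set_mono_prefix by blast
    ultimately show ?thesis
      using Suc.IH[of w w'] Suc.prems below_Suc_cases by simp
  qed
qed simp

text \<open>A blocked row \<open>j\<close> is charged to a pair of a coordinate \<open>k\<close> and
  a word of \<open>Z\<close>. Different entries of one column have different classes, so the
  charging is injective, and there are at most \<open>n * n\<close> pairs for
  \<open>n * n + 1\<close> rows.\<close>

lemma free_option_exists:
  assumes n: "0 < n" and J: "J = n * n" and v: "valid_letter M"
    and Z: "finite Z" "card Z \<le> n"
  shows "\<exists>j. free_option M Z j"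
proof (rule ccontr)
  assume "\<not> ?thesis"
  then have "\<forall>j\<in>{..J}. \<exists>p. fst p < n \<and> snd p \<in> Z \<and> class_word M (fam M j (fst p)) = class_word M (snd p)"
    unfolding free_option_def by fastforce
  then obtain p where p: "\<And>j. j \<le> J \<Longrightarrow> fst (p j) < n \<and> snd (p j) \<in> Z \<and>
      class_word M (fam M j (fst (p j))) = class_word M (snd (p j))"
    by (metis atMost_iff)
  have aux: "p j \<noteq> p j'" if "j < j'" "j' \<le> J" for j j'
  proof
    assume e: "p j = p j'"
    define k where "k = fst (p j)"
    have k: "k < n" using p[of j] that by (auto simp: k_def)
    have "class_word M (fam M j k) = class_word M (fam M j' k)"
      using p[of j] p[of j'] that e by (auto simp: k_def)
    moreover have sp: "strict_prefix (fam M j k) (fam M j' k)"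
      using v k that unfolding valid_letter_def by blast
    moreover have "set (fam M j k) \<subseteq> {..<M}" "set (fam M j' k) \<subseteq> {..<M}"
      using v k that unfolding valid_letter_def by auto
    ultimately have "fam M j k = fam M j' k"
      using class_word_prefix_inj[OF n] by (metis strict_prefix_def)
    then show False using sp by simp
  qed
  have "inj_on p {..J}"
    by (rule inj_onI) (metis aux atMost_iff nat_neq_iff)
  moreover have "p ` {..J} \<subseteq> {..<n} \<times> Z" using p by (metis atMost_iff image_subsetI lessThan_iff mem_Times_iff)
  moreover have "finite ({..<n} \<times> Z)" using Z by simp
  ultimately have "card {..J} \<le> card ({..<n} \<times> Z)" by (rule card_inj_on_le)
  also have "\<dots> \<le> n * n" using Z by (simp add: card_cartesian_product)
  finally show False using J by simp
qed

lemma strip_card: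
  assumes "finite Z" shows "finite (strip M z Z)" "card (strip M z Z) \<le> card Z"
proof -
  have i: "inj_on (\<lambda>y. y @ z) (strip M z Z)" by (auto intro: inj_onI)
  have s: "(\<lambda>y. y @ z) ` strip M z Z \<subseteq> Z" by (auto simp: strip_def)
  show "finite (strip M z Z)" using inj_on_finite[OF i s assms] .
  show "card (strip M z Z) \<le> card Z" using card_inj_on_le[OF i s assms] .
qed

text \<open>The union could have \<open>2 * n\<close> elements, but the claimed row is free, so no
  class contains both a word of \<open>Z\<close> and a claimed word. Restricting to one class leaves
  a subset of one of the two sets, and the bound \<open>n\<close> survives the recursion.\<close>

lemma next_avoid_card:
  assumes n: "0 < n" and J: "J = n * n" and Z: "finite Z" "card Z \<le> n"
  shows "finite {y' \<in> Z \<union> claimed M Z. class_word M y' = c}"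
    "card {y' \<in> Z \<union> claimed M Z. class_word M y' = c} \<le> n"
proof -
  have clm: "claimed M Z \<subseteq> (\<lambda>k. fam M (LEAST j. free_option M Z j) k) ` {..<n}"
    by (auto simp: claimed_def)
  have fin: "finite (claimed M Z)" using clm finite_subset by blast
  have card: "card (claimed M Z) \<le> n"
    using card_mono[OF _ clm] card_image_le[of "{..<n}" "\<lambda>k. fam M (LEAST j. free_option M Z j) k"] by simp
  show "finite {y' \<in> Z \<union> claimed M Z. class_word M y' = c}" using fin Z by simp
  have "{y' \<in> Z \<union> claimed M Z. class_word M y' = c} \<subseteq> Z \<or>
        {y' \<in> Z \<union> claimed M Z. class_word M y' = c} \<subseteq> claimed M Z"
  proof (rule ccontr)
    assume "\<not> ?thesis"
    then obtain z x where zx: "z \<in> Z" "class_word M z = c" "x \<in> claimed M Z" "class_word M x = c" by blast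
    then have v: "valid_letter M" by (auto simp: claimed_def split: if_splits)
    define j where "j = (LEAST j. free_option M Z j)"
    have "free_option M Z j"
      unfolding j_def using LeastI_ex[OF free_option_exists[OF n J v Z]] .
    then have "class_word M (fam M j k) \<noteq> class_word M z" if "k < n" for k
      using zx(1) that by (auto simp: free_option_def)
    moreover have "x \<in> {fam M j k | k. k < n}" using zx(3) v by (simp add: claimed_def j_def)
    ultimately show False using zx by auto
  qed
  then show "card {y' \<in> Z \<union> claimed M Z. class_word M y' = c} \<le> n"
  proof
    assume "{y' \<in> Z \<union> claimed M Z. class_word M y' = c} \<subseteq> Z"
    from card_mono[OF Z(1) this] show ?thesis using Z(2) by simp
  next
    assume "{y' \<in> Z \<union> claimed M Z. class_word M y' = c} \<subseteq> claimed M Z"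
    from card_mono[OF fin this] show ?thesis using card by simp
  qed
qed

text \<open>The set that \<open>owner\<close> hands on depends on a word only through its class and
  its remainder, so all words of one task face the same set at every stage, whichever larger letters
  occur in \<open>r\<close>.\<close>

lemma class_word_task:
  assumes n: "0 < n"
  shows "\<lbrakk>valid_letter a; set (a # r) \<subseteq> {..<B}; j \<le> J; k < n\<rbrakk> \<Longrightarrow>
    class_word B (fam a j k @ a # r) = class_word B (fam a 0 0 @ a # r)"
proof (induction B arbitrary: r)
  case (Suc M)
  have fa: "set (fam a j k) \<subseteq> {..<a}" "set (fam a 0 0) \<subseteq> {..<a}"
    using Suc.prems n unfolding valid_letter_def by auto
  have aM: "a \<le> M" using Suc.prems by auto
  show ?case
  proof (cases "M \<in> set (a # r)")
    case False
    then have "M \<notin> set (fam a j k @ a # r)" "M \<notin> set (fam a 0 0 @ a # r)" using fa aM by auto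
    then show ?thesis using Suc.IH[OF Suc.prems(1)] below_Suc_cases[OF Suc.prems(2) False] Suc.prems by simp
  next
    case True
    show ?thesis
    proof (cases "a = M")
      case True
      have 1: "M \<notin> set (fam M j k)" "M \<notin> set (fam M 0 0)" using fa True by auto
      have 2: "\<exists>j'\<le>J. \<exists>k'<n. class_word M (fam M j k) = class_word M (fam M j' k')"
        using Suc.prems(3,4) by blast
      have 3: "\<exists>j'\<le>J. \<exists>k'<n. class_word M (fam M 0 0) = class_word M (fam M j' k')"
        using n by blast
      have v: "valid_letter M" using Suc.prems(1) True by simp
      show ?thesis unfolding True class_word_Suc[OF 1(1)] class_word_Suc[OF 1(2)]
        by (simp only: v 2 3 simp_thms if_True)
    next
      case False
      with True have "M \<in> set r" by simp
      then obtain y z where yz: "r = y @ M # z" "M \<notin> set y" by (rule split_first)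
      have M1: "M \<notin> set (fam a j k @ a # y)" "M \<notin> set (fam a 0 0 @ a # y)"
        using fa aM False yz by auto
      have "set (a # y) \<subseteq> {..<M}" using Suc.prems(2) yz False aM by (auto simp: less_Suc_eq)
      then have "class_word M (fam a j k @ a # y) = class_word M (fam a 0 0 @ a # y)"
        using Suc.IH Suc.prems by blast
      then have "class_word (Suc M) ((fam a j k @ a # y) @ M # z) = class_word (Suc M) ((fam a 0 0 @ a # y) @ M # z)"
        by (simp only: class_word_Suc[OF M1(1)] class_word_Suc[OF M1(2)])
      then show ?thesis unfolding yz(1) by (simp only: append_assoc append_Cons)
    qed
  qed
qed simp

text \<open>Avoiding \<open>Z\<close> is part of the induction because the set handed down contains
  words that a larger letter has taken for itself: a word in it would be selected for that letter
  instead.\<close>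

lemma owner_task:
  assumes n: "0 < n" and J: "J = n * n"
  shows "\<lbrakk>valid_letter a; set (a # r) \<subseteq> {..<B}; finite Z; card Z \<le> n\<rbrakk> \<Longrightarrow>
    \<exists>j\<le>J. \<forall>k<n. fam a j k @ a # r \<notin> Z \<and> owner B Z (fam a j k @ a # r) = length (fam a j k)"
proof (induction B arbitrary: r Z)
  case (Suc M)
  have fa: "set (fam a j k) \<subseteq> {..<a}" if "j \<le> J" "k < n" for j k
    using Suc.prems that unfolding valid_letter_def by auto
  have aM: "a \<le> M" using Suc.prems by auto
  show ?case
  proof (cases "M \<in> set (a # r)")
    case False
    from Suc.IH[OF Suc.prems(1) below_Suc_cases[OF Suc.prems(2) False] Suc.prems(3,4)]
    obtain j where j: "j \<le> J" "\<forall>k<n. fam a j k @ a # r \<notin> Z \<and> owner M Z (fam a j k @ a # r) = length (fam a j k)"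
      by blast
    have "M \<notin> set (fam a j k @ a # r)" if "k < n" for k using fa[OF j(1) that] False aM by auto
    then show ?thesis using j by (intro exI[of _ j]) auto
  next
    case True
    show ?thesis
    proof (cases "a = M")
      case True
      define Z' where "Z' = strip M (M # r) Z"
      have Z': "finite Z'" "card Z' \<le> n"
        using strip_card[OF Suc.prems(3), of M "M # r"] Suc.prems(4) by (auto simp: Z'_def)
      define j where "j = (LEAST j. free_option M Z' j)"
      have j: "free_option M Z' j"
        unfolding j_def using LeastI_ex[OF free_option_exists[OF n J _ Z']] Suc.prems(1) True by simp
      then have jJ: "j \<le> J" by (simp add: free_option_def)
      have "fam a j k @ a # r \<notin> Z \<and> owner (Suc M) Z (fam a j k @ a # r) = length (fam a j k)" if "k < n" for k
      proof -
        have M1: "M \<notin> set (fam a j k)" using fa[OF jJ that] True by auto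
        have "fam a j k \<in> claimed M Z'"
          using Suc.prems(1) True that by (auto simp: claimed_def j_def)
        moreover have "fam a j k \<notin> Z'" using j that True by (auto simp: free_option_def)
        ultimately show ?thesis
          using owner_Suc[OF M1 Z'_def refl] M1 True by (auto simp: Z'_def strip_def)
      qed
      then show ?thesis using jJ by blast
    next
      case False
      with True have "M \<in> set r" by simp
      then obtain y z where yz: "r = y @ M # z" "M \<notin> set y" by (rule split_first)
      have M1: "M \<notin> set (fam a j k @ a # y)" if "j \<le> J" "k < n" for j k
        using fa[OF that] aM False yz by auto
      have ay: "set (a # y) \<subseteq> {..<M}" using Suc.prems(2) yz False aM by (auto simp: less_Suc_eq)
      define Z' where "Z' = strip M (M # z) Z"
      have Z': "finite Z'" "card Z' \<le> n"
        using strip_card[OF Suc.prems(3), of M "M # z"] Suc.prems(4) by (auto simp: Z'_def)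
      define c where "c = class_word M (fam a 0 0 @ a # y)"
      define Z2 where "Z2 = {y' \<in> Z' \<union> claimed M Z'. class_word M y' = c}"
      have Z2: "finite Z2" "card Z2 \<le> n"
        unfolding Z2_def using next_avoid_card[OF n J Z'] by auto
      from Suc.IH[OF Suc.prems(1) ay Z2] obtain j where j: "j \<le> J"
        "\<forall>k<n. fam a j k @ a # y \<notin> Z2 \<and> owner M Z2 (fam a j k @ a # y) = length (fam a j k)" by blast
      have "fam a j k @ a # r \<notin> Z \<and> owner (Suc M) Z (fam a j k @ a # r) = length (fam a j k)" if k: "k < n" for k
      proof -
        have ceq: "class_word M (fam a j k @ a # y) = c"
          unfolding c_def by (rule class_word_task[OF n Suc.prems(1) ay j(1) k])
        have nin: "fam a j k @ a # y \<notin> Z' \<union> claimed M Z'" using j k ceq by (auto simp: Z2_def)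
        then have "fam a j k @ a # r \<notin> Z" using M1[OF j(1) k] yz by (auto simp: Z'_def strip_def)
        moreover have "owner (Suc M) Z (fam a j k @ a # r) = owner M Z2 (fam a j k @ a # y)"
          using owner_Suc[OF M1[OF j(1) k] Z'_def refl] nin ceq yz by (simp add: Z2_def)
        ultimately show ?thesis using j k by simp
      qed
      then show ?thesis using j(1) by blast
    qed
  qed
qed simp

lemma selector_exists:
  assumes n: "0 < n" and J: "J = n * n"
  shows "\<exists>sel. \<forall>a r. valid_letter a \<longrightarrow>
    (\<exists>j\<le>J. \<forall>k<n. sel (fam a j k @ a # r) = length (fam a j k))"
proof (intro exI[of _ "\<lambda>w. owner (Suc (Max (set w))) {} w"] allI impI)
  fix a r assume v: "valid_letter a"
  define B where "B = Suc (Max (set (a # r)))"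
  have B: "set (a # r) \<subseteq> {..<B}" by (auto simp: B_def less_Suc_eq_le simp del: set_simps)
  \<comment> \<open>The letters of the matrix lie below \<open>a\<close>, so the recursion starts
    from the same bound for every row and column.\<close>
  have mx: "Suc (Max (set (fam a j k @ a # r))) = B" if "j \<le> J" "k < n" for j k
  proof -
    have "x \<le> Max (set (a # r))" if "x \<in> set (fam a j k)" for x
    proof -
      have "x < a" using v that \<open>j \<le> J\<close> \<open>k < n\<close> unfolding valid_letter_def by blast
      also have "a \<le> Max (set (a # r))" by (intro Max_ge) auto
      finally show ?thesis by simp
    qed
    then have "Max (set (fam a j k) \<union> set (a # r)) = Max (set (a # r))"
      by (intro Max_eqI) (auto simp del: set_simps intro: Max_ge)
    then show ?thesis by (simp add: B_def)
  qed
  from owner_task[OF n J v B, of "{}"] obtain j where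
    j: "j \<le> J" "\<And>k. k < n \<Longrightarrow> owner B {} (fam a j k @ a # r) = length (fam a j k)" by fastforce
  have "owner (Suc (Max (set (fam a j k @ a # r)))) {} (fam a j k @ a # r) = length (fam a j k)"
    if "k < n" for k
    unfolding mx[OF j(1) that] by (rule j(2)[OF that])
  then show "\<exists>j\<le>J. \<forall>k<n. owner (Suc (Max (set (fam a j k @ a # r)))) {} (fam a j k @ a # r) = length (fam a j k)"
    using j(1) by blast
qed

end

text \<open>A letter codes a matrix, a mark and a padding number. The mark is side information
  carried by the selected letter: in the colouring it names the label of the letter that ends the
  stem.\<close>

lemma coded_selector:
  assumes n: "0 < (n::nat)"
  shows "\<exists>(sel :: nat list \<Rightarrow> nat) (mark :: nat \<Rightarrow> nat). \<forall>(x :: nat \<Rightarrow> nat \<Rightarrow> nat list) (N :: nat).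
    (\<forall>k<n. \<forall>j'\<le>n*n. \<forall>j<j'. strict_prefix (x j k) (x j' k)) \<longrightarrow>
    (\<exists>a. mark a = N \<and> (\<forall>r. \<exists>j\<le>n*n. \<forall>k<n. sel (x j k @ a # r) = length (x j k)))"
proof -
  define dec :: "nat \<Rightarrow> (nat list list list \<times> nat) \<times> nat" where "dec = from_nat"
  define fam where "fam = (\<lambda>a j k. fst (fst (dec a)) ! j ! k)"
  obtain sel where sel: "\<And>a r. valid_letter n (n*n) fam a \<Longrightarrow>
    (\<exists>j\<le>n*n. \<forall>k<n. sel (fam a j k @ a # r) = length (fam a j k))"
    using selector_exists[OF n refl] by blast
  show ?thesis
  proof (intro exI[of _ sel] exI[of _ "\<lambda>a. snd (fst (dec a))"] allI impI)
    fix x :: "nat \<Rightarrow> nat \<Rightarrow> nat list" and N :: nat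
    assume x: "\<forall>k<n. \<forall>j'\<le>n*n. \<forall>j<j'. strict_prefix (x j k) (x j' k)"
    define L where "L = map (\<lambda>j. map (x j) [0..<n]) [0..<Suc (n*n)]"
    have L: "L ! j ! k = x j k" if "j \<le> n*n" "k < n" for j k
      using that by (simp add: L_def less_Suc_eq_le del: upt_Suc)
    define b where "b = Max (insert 0 (\<Union>j\<in>{..n*n}. \<Union>k\<in>{..<n}. set (x j k)))"
    have b: "l \<le> b" if "l \<in> set (x j k)" "j \<le> n*n" "k < n" for j k l
      unfolding b_def using that by (intro Max_ge) auto
    \<comment> \<open>Varying the padding gives infinitely many codes of the same data, so one of
      them exceeds all letters of the matrix, as validity demands.\<close>
    have "inj (\<lambda>i. to_nat ((L, N), i::nat))" by (rule injI) simp
    then have "infinite (range (\<lambda>i. to_nat ((L, N), i::nat)))" by (rule range_inj_infinite)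
    then obtain a where a: "a \<in> range (\<lambda>i. to_nat ((L, N), i::nat))" "b < a"
      by (meson infinite_nat_iff_unbounded)
    then obtain i :: nat where i: "a = to_nat ((L, N), i)" by blast
    have d: "dec a = ((L, N), i)" by (simp add: dec_def i)
    have f: "fam a j k = x j k" if "j \<le> n*n" "k < n" for j k
      using L[OF that] by (simp add: fam_def d)
    have "valid_letter n (n*n) fam a"
      unfolding valid_letter_def
    proof (intro conjI allI impI)
      show "set (fam a j k) \<subseteq> {..<a}" if "j \<le> n*n" "k < n" for j k
        using f[OF that] b[OF _ that] a(2) by fastforce
      show "strict_prefix (fam a j k) (fam a j' k)" if "k < n" "j' \<le> n*n" "j < j'" for j j' k
        using x that f[of j k] f[of j' k] by simp
    qed
    from sel[OF this] have "\<forall>r. \<exists>j\<le>n*n. \<forall>k<n. sel (x j k @ a # r) = length (x j k)"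
      using f by metis
    then show "\<exists>a. snd (fst (dec a)) = N \<and> (\<forall>r. \<exists>j\<le>n*n. \<forall>k<n. sel (x j k @ a # r) = length (x j k))"
      using d by (intro exI[of _ a]) simp
  qed
qed

section \<open>Order types and clubs below a successor cardinal\<close>

text \<open>The order type of the part of \<open>X\<close> below \<open>x\<close>, see
  \<open>otp_eq_rank_in\<close>. The recursion makes it total and monotone without first proving
  that order types exist; the \<open>LEAST\<close> is attained because \<open>x\<close> itself is a
  bound.\<close>

function rank_in :: "'k::wellorder set \<Rightarrow> 'k \<Rightarrow> 'k" where
  "rank_in X x = (LEAST a. \<forall>y\<in>X. y < x \<longrightarrow> rank_in X y < a)"
  by auto
termination
  by (relation "inv_image {(x, y). x < y} snd") (auto intro: wf_inv_image wf)

declare rank_in.simps [simp del]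

lemma rank_in_le: "rank_in X x \<le> x"
proof (induction x rule: less_induct)
  case (less x)
  then have "\<forall>y\<in>X. y < x \<longrightarrow> rank_in X y < x" by (meson le_less_trans)
  then show ?case by (subst rank_in.simps) (rule Least_le)
qed

lemma rank_in_less:
  assumes "y \<in> X" "y < x" shows "rank_in X y < rank_in X x"
proof -
  have "\<forall>y\<in>X. y < x \<longrightarrow> rank_in X y < x" by (meson rank_in_le le_less_trans)
  then have "\<forall>y\<in>X. y < x \<longrightarrow> rank_in X y < (LEAST a. \<forall>y\<in>X. y < x \<longrightarrow> rank_in X y < a)"
    by (rule LeastI)
  then show ?thesis using assms by (subst (2) rank_in.simps) blast
qed

lemma rank_in_mono: "x \<le> x' \<Longrightarrow> rank_in X x \<le> rank_in X x'"
  by (subst rank_in.simps) (intro Least_le ballI impI rank_in_less, auto)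

lemma rank_in_onto:
  assumes "a < rank_in X x" shows "\<exists>y\<in>X. y < x \<and> rank_in X y = a"
  using assms
proof (induction x rule: less_induct)
  case (less x)
  have "\<not> (\<forall>y\<in>X. y < x \<longrightarrow> rank_in X y < a)"
    using less.prems not_less_Least by (subst (asm) rank_in.simps) blast
  then obtain y where y: "y \<in> X" "y < x" "a \<le> rank_in X y" by force
  show ?case
  proof (cases "rank_in X y = a")
    case False
    then have "a < rank_in X y" using y by simp
    from less.IH[OF y(2) this] y(2) show ?thesis by (meson less_trans)
  qed (use y in blast)
qed

lemma inj_on_rank_in: "inj_on (rank_in X) X"
proof (rule inj_onI)
  fix y z assume "y \<in> X" "z \<in> X" "rank_in X y = rank_in X z"
  then show "y = z"
    using rank_in_less[of y X z] rank_in_less[of z X y] by (cases y z rule: linorder_cases) auto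
qed

lemma strict_mono_on_ge_self:
  fixes f :: "'k::wellorder \<Rightarrow> 'k"
  assumes "strict_mono_on {..<a} f" "f ` {..<a} \<subseteq> {..<b}" shows "a \<le> b"
proof (rule ccontr)
  assume "\<not> a \<le> b"
  then have ba: "b < a" by simp
  have "x \<le> f x" if "x < a" for x using that
  proof (induction x rule: less_induct)
    case (less x)
    show ?case
    proof (rule ccontr)
      assume "\<not> x \<le> f x"
      then have l: "f x < x" by simp
      then have "f (f x) < f x" using assms(1) less.prems by (auto simp: strict_mono_on_def)
      moreover have "f x \<le> f (f x)" using less l by auto
      ultimately show False by simp
    qed
  qed
  from this[OF ba] have "b \<le> f b" .
  moreover have "f b < b" using assms(2) ba by auto
  ultimately show False by simp
qed

text \<open>The inverse of the rank function is an increasing enumeration. Comparing it with another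
  enumeration in both directions gives increasing maps between initial segments, and these never
  move a point down, so the two lengths agree.\<close>

lemma otp_eq_rank_in:
  fixes X :: "'k::wellorder set"
  shows "otp (X \<inter> {..<x}) = rank_in X x"
proof -
  define Y where "Y = X \<inter> {..<x}"
  have inj: "inj_on (rank_in X) Y" by (rule inj_on_subset[OF inj_on_rank_in]) (simp add: Y_def)
  have im: "rank_in X ` Y = {..<rank_in X x}"
    using rank_in_less rank_in_onto unfolding Y_def by fastforce
  have bij: "bij_betw (rank_in X) Y {..<rank_in X x}" using inj im by (simp add: bij_betw_def)
  define f where "f = inv_into Y (rank_in X)"
  have f: "bij_betw f {..<rank_in X x} Y" unfolding f_def by (rule bij_betw_inv_into[OF bij])
  have rf: "rank_in X (f a) = a" if "a < rank_in X x" for a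
    unfolding f_def by (rule f_inv_into_f) (use im that in auto)
  have fY: "f a \<in> Y" if "a < rank_in X x" for a using f that by (auto simp: bij_betw_def)
  have mono: "strict_mono_on {..<rank_in X x} f"
  proof (rule strict_mono_onI)
    fix a b assume ab: "a \<in> {..<rank_in X x}" "b \<in> {..<rank_in X x}" "a < b"
    show "f a < f b"
    proof (rule ccontr)
      assume "\<not> f a < f b"
      then have "rank_in X (f b) \<le> rank_in X (f a)" by (intro rank_in_mono) simp
      then show False using ab rf by simp
    qed
  qed
  show ?thesis unfolding otp_def Y_def[symmetric]
  proof (rule the_equality)
    show "\<exists>f. bij_betw f {..<rank_in X x} Y \<and> strict_mono_on {..<rank_in X x} f" using f mono by blast
    fix a :: 'k assume "\<exists>f. bij_betw f {..<a} Y \<and> strict_mono_on {..<a} f"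
    then obtain g where g: "bij_betw g {..<a} Y" "strict_mono_on {..<a} g" by blast
    have gY: "g b \<in> Y" if "b < a" for b using g that by (auto simp: bij_betw_def)
    have "a \<le> rank_in X x"
    proof (rule strict_mono_on_ge_self)
      show "strict_mono_on {..<a} (\<lambda>b. rank_in X (g b))"
        using g(2) gY by (auto simp: strict_mono_on_def Y_def intro!: rank_in_less)
      show "(\<lambda>b. rank_in X (g b)) ` {..<a} \<subseteq> {..<rank_in X x}" using gY im by auto
    qed
    moreover have "rank_in X x \<le> a"
    proof (rule strict_mono_on_ge_self)
      define g' where "g' = inv_into {..<a} g"
      have g': "g (g' y) = y" "g' y < a" if "y \<in> Y" for y
        using that g(1) f_inv_into_f[of y g "{..<a}"] inv_into_into[of y g "{..<a}"]
        by (auto simp: g'_def bij_betw_def)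
      show "(\<lambda>b. g' (f b)) ` {..<rank_in X x} \<subseteq> {..<a}" using g'(2) fY by auto
      show "strict_mono_on {..<rank_in X x} (\<lambda>b. g' (f b))"
      proof (rule strict_mono_onI)
        fix b c assume bc: "b \<in> {..<rank_in X x}" "c \<in> {..<rank_in X x}" "b < c"
        then have lt: "f b < f c" using mono by (auto simp: strict_mono_on_def)
        show "g' (f b) < g' (f c)"
        proof (rule ccontr)
          assume "\<not> g' (f b) < g' (f c)"
          then have "g' (f c) \<le> g' (f b)" by simp
          then have "g (g' (f c)) \<le> g (g' (f b))"
            using g(2) g' fY bc by (metis lessThan_iff order.order_iff_strict strict_mono_onD)
          then show False using g' fY bc lt by auto
        qed
      qed
    qed
    ultimately show "a = rank_in X x" by simp
  qed
qed

lemma club_unbounded: "club D \<Longrightarrow> \<exists>z. z \<in> D \<and> x < z"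
  unfolding club_def by blast

lemma club_closed: "club D \<Longrightarrow> reaches D x \<Longrightarrow> x \<in> D"
  unfolding club_def by blast

lemma reachesD: "reaches X a \<Longrightarrow> b < a \<Longrightarrow> \<exists>c\<in>X. b < c \<and> c < a"
  unfolding reaches_def by blast

section \<open>The ideal of sets of size at most \<mu>, and clubs\<close>

locale succ_cardinal =
  fixes m :: "'k::wellorder"
  assumes infinite_m: "infinite {..<m}" and succ_m: "is_succ_of m"
begin

definition small :: "'a set \<Rightarrow> bool" where "small X \<longleftrightarrow> X \<lesssim> {..<m}"

lemma small_subset: "small Y \<Longrightarrow> X \<subseteq> Y \<Longrightarrow> small X"
  unfolding small_def by (meson lepoll_trans subset_imp_lepoll)

lemma small_image: "small X \<Longrightarrow> small (f ` X)"
  unfolding small_def by (meson lepoll_trans image_lepoll)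

lemma small_UN:
  assumes "small I" "\<And>i. i \<in> I \<Longrightarrow> small (F i)" shows "small (\<Union>i\<in>I. F i)"
  using card_of_UNION_ordLeq_infinite[OF infinite_m, of I F] assms
  unfolding small_def lepoll_def card_of_ordLeq by blast

lemma small_nat: "small (X :: nat set)"
  by (rule small_subset[of UNIV]) (use infinite_m infinite_le_lepoll in \<open>auto simp: small_def\<close>)

lemma small_finite: "finite X \<Longrightarrow> small X"
  unfolding small_def by (rule finite_lepoll_infinite[OF infinite_m])

lemma small_Un: assumes "small X" "small Y" shows "small (X \<union> Y)"
proof -
  have "small (\<Union>b\<in>{True, False}. if b then X else Y)"
    by (rule small_UN[OF small_finite]) (use assms in simp_all)
  then show ?thesis by (simp add: Un_commute)
qed

lemma small_Times: assumes "small X" "small Y" shows "small (X \<times> Y)"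
proof -
  have "small (\<Union>x\<in>X. Pair x ` Y)" by (rule small_UN[OF assms(1) small_image[OF assms(2)]])
  then show ?thesis by (rule small_subset) auto
qed

lemma small_lists: assumes "small X" shows "small (lists X)"
proof -
  have "small {xs \<in> lists X. length xs = l}" for l
  proof (induction l)
    case 0
    have "{xs \<in> lists X. length xs = 0} = {[]}" by auto
    then show ?case by (simp add: small_finite)
  next
    case (Suc l)
    have "small ((\<lambda>p. fst p # snd p) ` (X \<times> {xs \<in> lists X. length xs = l}))"
      by (rule small_image[OF small_Times[OF assms Suc]])
    moreover have "{xs \<in> lists X. length xs = Suc l} \<subseteq> (\<lambda>p. fst p # snd p) ` (X \<times> {xs \<in> lists X. length xs = l})"
      by (force simp: length_Suc_conv image_iff)
    ultimately show ?case by (rule small_subset)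
  qed
  then have "small (\<Union>l\<in>UNIV. {xs \<in> lists X. length xs = l})" by (rule small_UN[OF small_nat])
  then show ?thesis by (rule small_subset) auto
qed

lemma small_lessThan: "small {..<a::'k}"
  using succ_m by (simp add: is_succ_of_def small_def)

lemma small_atMost: "small {..a::'k}"
proof -
  have "{..a} = {..<a} \<union> {a}" by auto
  then show ?thesis using small_Un[OF small_lessThan small_finite, of "{a}" a] by simp
qed

lemma not_small_UNIV: "\<not> small (UNIV :: 'k set)"
  using succ_m by (simp add: is_succ_of_def small_def)

text \<open>Regularity of the successor cardinal: an unbounded set of size at most \<mu> would cover
  everything by at most \<mu> initial segments, each of size at most \<mu>.\<close>

lemma small_bounded: assumes "small (X :: 'k set)" shows "\<exists>b. \<forall>x\<in>X. x < b"
proof (rule ccontr)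
  assume a: "\<not> ?thesis"
  have "\<exists>x\<in>X. b \<le> x" for b
  proof (rule ccontr)
    assume "\<not> (\<exists>x\<in>X. b \<le> x)"
    then have "\<forall>x\<in>X. x < b" by (simp add: not_le)
    then show False using a by blast
  qed
  then have "UNIV \<subseteq> (\<Union>x\<in>X. {..x})" by (simp add: subset_iff)
  then have "small (UNIV :: 'k set)" by (rule small_subset[OF small_UN[OF assms small_atMost]])
  then show False using not_small_UNIV by (rule notE[rotated])
qed

lemma ex_greater: "\<exists>y. (x::'k) < y"
proof -
  have "small {x}" by (rule small_finite) simp
  from small_bounded[OF this] show ?thesis by simp
qed

text \<open>The index set is arbitrary and only ranked by \<open>r\<close>, since the functions
  pressed down later take tuples of words and nodes as values. With at most \<mu> indices of rank at
  most \<open>e\<close>, the usual closing off along a sequence of length \<omega> goes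
  through.\<close>

lemma club_diagonal:
  assumes clubs: "\<And>v. v \<in> I \<Longrightarrow> club (D v)" and few: "\<And>e. small {v \<in> I. r v \<le> (e::'k)}"
  shows "club {d. \<forall>v\<in>I. r v < d \<longrightarrow> d \<in> D v}"
  unfolding club_def
proof (intro conjI allI impI)
  fix \<beta> :: 'k
  have "\<exists>y. x < y \<and> (\<forall>v\<in>I. r v \<le> x \<longrightarrow> (\<exists>z\<in>D v. x < z \<and> z < y))" for x
  proof -
    have "\<forall>v\<in>I. \<exists>z. z \<in> D v \<and> x < z" using club_unbounded[OF clubs] by blast
    then obtain z where z: "\<And>v. v \<in> I \<Longrightarrow> z v \<in> D v \<and> x < z v" by metis
    have "small (insert x (z ` {v \<in> I. r v \<le> x}))"
      using small_Un[OF small_finite[of "{x}"] small_image[OF few]] by simp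
    then obtain y where "\<forall>u\<in>insert x (z ` {v \<in> I. r v \<le> x}). u < y" using small_bounded by blast
    then show ?thesis using z by (intro exI[of _ y]) auto
  qed
  then obtain nxt where nxt: "\<And>x. x < nxt x"
    "\<And>x v. v \<in> I \<Longrightarrow> r v \<le> x \<Longrightarrow> \<exists>z\<in>D v. x < z \<and> z < nxt x" by metis
  define s where "s i = (nxt ^^ i) \<beta>" for i :: nat
  have s: "s (Suc i) = nxt (s i)" for i by (simp add: s_def)
  have mono: "s i \<le> s j" if "i \<le> j" for i j
    using that by (rule lift_Suc_mono_le[rotated]) (simp add: s nxt less_imp_le)
  obtain b where "\<forall>x\<in>range s. x < b" using small_bounded[OF small_image[OF small_nat]] by blast
  then have ex: "\<forall>i. s i < b" by blast
  define \<alpha> where "\<alpha> = (LEAST a. \<forall>i. s i < a)"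
  have \<alpha>: "s i < \<alpha>" for i unfolding \<alpha>_def using LeastI[of "\<lambda>a. \<forall>i. s i < a", OF ex] by blast
  have below: "\<exists>i. x \<le> s i" if "x < \<alpha>" for x
  proof (rule ccontr)
    assume "\<not> ?thesis"
    then have "\<forall>i. s i < x" by (simp add: not_le)
    then have "\<alpha> \<le> x" unfolding \<alpha>_def by (rule Least_le)
    then show False using that by simp
  qed
  have "\<alpha> \<in> D v" if v: "v \<in> I" "r v < \<alpha>" for v
  proof -
    obtain i where i: "r v \<le> s i" using below v by blast
    have "reaches (D v) \<alpha>" unfolding reaches_def
    proof (intro conjI allI impI)
      show "\<exists>\<beta>. \<beta> < \<alpha>" using \<alpha> by blast
      fix x assume "x < \<alpha>"
      then obtain j where j: "x \<le> s j" using below by blast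
      define k where "k = max i j"
      have "r v \<le> s k" "x \<le> s k" using i j mono[of i k] mono[of j k] by (auto simp: k_def intro: order_trans)
      then obtain z where "z \<in> D v" "s k < z" "z < s (Suc k)" using nxt(2)[OF v(1)] s by metis
      then show "\<exists>\<gamma>\<in>D v. x < \<gamma> \<and> \<gamma> < \<alpha>" using \<open>x \<le> s k\<close> \<alpha>[of "Suc k"] by (meson le_less_trans less_trans)
    qed
    then show ?thesis by (rule club_closed[OF clubs[OF v(1)]])
  qed
  moreover have "\<beta> < \<alpha>" using \<alpha>[of 0] by (simp add: s_def)
  ultimately show "\<exists>\<gamma>\<in>{d. \<forall>v\<in>I. r v < d \<longrightarrow> d \<in> D v}. \<beta> < \<gamma>" by blast
next
  fix \<alpha> assume a: "reaches {d. \<forall>v\<in>I. r v < d \<longrightarrow> d \<in> D v} \<alpha>"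
  have "\<alpha> \<in> D v" if v: "v \<in> I" "r v < \<alpha>" for v
  proof -
    have "reaches (D v) \<alpha>" unfolding reaches_def
    proof (intro conjI allI impI)
      show "\<exists>\<beta>. \<beta> < \<alpha>" using v by blast
      fix x assume "x < \<alpha>"
      then have "max x (r v) < \<alpha>" using v by simp
      then obtain \<gamma> where "\<forall>v\<in>I. r v < \<gamma> \<longrightarrow> \<gamma> \<in> D v" "max x (r v) < \<gamma>" "\<gamma> < \<alpha>"
        using a unfolding reaches_def by blast
      then show "\<exists>\<gamma>\<in>D v. x < \<gamma> \<and> \<gamma> < \<alpha>" using v by auto
    qed
    then show ?thesis by (rule club_closed[OF clubs[OF v(1)]])
  qed
  then show "\<alpha> \<in> {d. \<forall>v\<in>I. r v < d \<longrightarrow> d \<in> D v}" by blast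
qed

lemma club_above: "club {d::'k. b < d}"
  unfolding club_def
proof (intro conjI allI impI)
  fix \<beta> obtain y where "max \<beta> b < y" using ex_greater by blast
  then show "\<exists>\<gamma>\<in>{d. b < d}. \<beta> < \<gamma>" by auto
qed (auto simp: reaches_def)

lemma club_closure_points: "club {d::'k. \<forall>x<d. F x < d}"
  using club_diagonal[of UNIV "\<lambda>x. {d. F x < d}" "\<lambda>x. x"] club_above small_atMost
  by (auto simp: atMost_def)

lemma unbounded_eqpoll:
  assumes "\<And>b::'k. \<exists>x\<in>E. b < x" shows "E \<approx> (UNIV :: 'k set)"
proof (rule lepoll_antisym)
  show "E \<lesssim> (UNIV :: 'k set)" by (rule subset_imp_lepoll) simp
  have "\<exists>y\<in>E. rank_in E y = a" for a
  proof (rule ccontr)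
    assume no: "\<not> ?thesis"
    have le: "rank_in E x \<le> a" for x
    proof (rule ccontr)
      assume "\<not> rank_in E x \<le> a"
      then have "a < rank_in E x" by simp
      from rank_in_onto[OF this] show False using no by blast
    qed
    have "inj_on (rank_in E) E" by (rule inj_on_rank_in)
    moreover have "rank_in E ` E \<subseteq> {..a}" using le by auto
    ultimately have "E \<lesssim> {..a}" unfolding lepoll_def by blast
    then have "small E" using small_atMost[of a] unfolding small_def by (rule lepoll_trans)
    from small_bounded[OF this] obtain b where "\<forall>x\<in>E. x < b" by (rule exE)
    then show False using assms[of b] by auto
  qed
  then have "UNIV \<subseteq> rank_in E ` E" by (metis image_eqI subsetI)
  then show "(UNIV :: 'k set) \<lesssim> E" unfolding lepoll_iff by (rule exI[of _ "rank_in E"])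
qed

end

section \<open>Walks\<close>

lemma ex_Max_below:
  fixes X :: "'k::wellorder set"
  assumes cl: "\<And>x. x < b \<Longrightarrow> reaches X x \<Longrightarrow> x \<in> X" and nr: "\<not> reaches X b" and c: "c \<in> X" "c < b"
  shows "\<exists>z\<in>X. c \<le> z \<and> z < b \<and> (\<forall>x\<in>X. x < b \<longrightarrow> x \<le> z)"
proof -
  obtain e where e: "e < b" "\<forall>x\<in>X. x < b \<longrightarrow> x \<le> e"
    using nr c(2) unfolding reaches_def by (metis not_le)
  define z where "z = (LEAST y. \<forall>x\<in>X. x < b \<longrightarrow> x \<le> y)"
  have z1: "\<forall>x\<in>X. x < b \<longrightarrow> x \<le> z" unfolding z_def using e(2) by (rule LeastI)
  have z2: "z \<le> y" if "\<forall>x\<in>X. x < b \<longrightarrow> x \<le> y" for y unfolding z_def using that by (rule Least_le)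
  have zb: "z < b" using z2[OF e(2)] e(1) by simp
  have cz: "c \<le> z" using z1 c by blast
  have "z \<in> X"
  proof (rule ccontr)
    assume nz: "z \<notin> X"
    have "reaches X z" unfolding reaches_def
    proof (intro conjI allI impI)
      show "\<exists>\<beta>. \<beta> < z" using cz c(1) nz by (metis order_le_less)
      fix \<beta> assume "\<beta> < z"
      then have "\<not> (\<forall>x\<in>X. x < b \<longrightarrow> x \<le> \<beta>)" using z2[of \<beta>] leD by blast
      then obtain x where x: "x \<in> X" "x < b" "\<beta> < x" by (auto simp: not_le)
      then have "x < z" using z1 nz by (metis order_le_less)
      then show "\<exists>\<gamma>\<in>X. \<beta> < \<gamma> \<and> \<gamma> < z" using x by blast
    qed
    then show False using cl zb nz by blast
  qed
  then show ?thesis using cz zb z1 by blast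
qed

lemma tuple_nth_mem:
  assumes "S \<subseteq> {s. length s = n \<and> set s \<subseteq> T}" "s \<in> S" "k < n"
  shows "s ! k \<in> T"
proof -
  have "length s = n" "set s \<subseteq> T" using assms(1,2) by auto
  then show ?thesis using assms(3) nth_mem[of k s] by blast
qed

lemma finite_threshold:
  fixes d :: "'k::linorder"
  assumes "e0 < d" "\<And>k. k < n \<Longrightarrow> \<exists>e<d. \<forall>x. e < x \<longrightarrow> P k x"
  shows "\<exists>e<d. \<forall>k<n. \<forall>x. e < x \<longrightarrow> P (k::nat) x"
  using assms(2)
proof (induction n)
  case (Suc n)
  then obtain e where e: "e < d" "\<forall>k<n. \<forall>x. e < x \<longrightarrow> P k x" by (metis less_SucI)
  obtain e' where e': "e' < d" "\<forall>x. e' < x \<longrightarrow> P n x" using Suc.prems by blast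
  show ?case using e e' by (intro exI[of _ "max e e'"]) (auto simp: less_Suc_eq)
qed (use assms(1) in blast)

lemma restrict_restrict_atMost:
  "a \<le> (b::'a::preorder) \<Longrightarrow> (t |` {..b}) |` {..a} = t |` {..a}"
  by (auto simp: restrict_map_def fun_eq_iff intro: order_trans)

lemma rank_in_cong: "X \<inter> {..<x} = Y \<inter> {..<y} \<Longrightarrow> rank_in X x = rank_in Y y"
  by (metis otp_eq_rank_in)

text \<open>The rank jumps exactly behind the elements of \<open>X\<close>, so a set can be
  recovered from its rank function. The hypothesis provides a successor of \<open>x\<close> below
  \<open>b\<close> at which the jump is seen.\<close>

lemma mem_iff_rank_in_less:
  assumes "\<exists>y. x < y \<and> y < b"
  shows "x \<in> X \<longleftrightarrow> (\<forall>y. x < y \<and> y < b \<longrightarrow> rank_in X x < rank_in X y)"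
proof
  assume "x \<in> X" then show "\<forall>y. x < y \<and> y < b \<longrightarrow> rank_in X x < rank_in X y"
    by (simp add: rank_in_less)
next
  assume r: "\<forall>y. x < y \<and> y < b \<longrightarrow> rank_in X x < rank_in X y"
  define s where "s = (LEAST y. x < y)"
  obtain y where y: "x < y" "y < b" using assms by blast
  have s: "x < s" unfolding s_def using y(1) by (rule LeastI)
  have "s \<le> y" unfolding s_def using y(1) by (rule Least_le)
  then have rs: "rank_in X x < rank_in X s" using r s y(2) by auto
  show "x \<in> X"
  proof (rule ccontr)
    assume "x \<notin> X"
    moreover have "z \<le> x" if "z < s" for z using not_less_Least[of z "\<lambda>y. x < y"] that by (simp add: s_def)
    ultimately have "X \<inter> {..<s} = X \<inter> {..<x}" using s by (auto simp: order_le_less)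
    then show False using rank_in_cong[of X s X x] rs by simp
  qed
qed

locale c_sequence = succ_cardinal m for m :: "'k::wellorder" +
  fixes C :: "'k \<Rightarrow> 'k set"
  assumes square: "square_star m C"
begin

section \<open>Single steps and words of the walk\<close>

abbreviation rho :: "'k \<Rightarrow> 'k \<Rightarrow> 'k list" where "rho \<equiv> rho0 C"

definition walk_step :: "'k \<Rightarrow> 'k \<Rightarrow> 'k" where
  "walk_step \<xi> \<alpha> = (LEAST x. x \<in> C \<alpha> \<and> \<xi> \<le> x)"

lemma C_subset: "x \<in> C \<delta> \<Longrightarrow> x < \<delta>"
  using square by (auto simp: square_star_def C_seq_over_def)

lemma C_closed: "\<alpha> < \<delta> \<Longrightarrow> reaches (C \<delta>) \<alpha> \<Longrightarrow> \<alpha> \<in> C \<delta>"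
  using square by (auto simp: square_star_def C_seq_over_def closed_below_def)

lemma C_sup: "is_sup (C \<delta>) s \<longleftrightarrow> is_sup {..<\<delta>} s"
  using square by (auto simp: square_star_def C_seq_over_def)

lemma rank_in_C_le: "rank_in (C \<delta>) \<xi> \<le> m"
proof -
  have "rank_in (C \<delta>) \<xi> \<le> rank_in (C \<delta>) (max \<xi> \<delta>)" by (rule rank_in_mono) simp
  also have "C \<delta> \<inter> {..<max \<xi> \<delta>} = C \<delta>" using C_subset[of _ \<delta>] by (auto simp: less_max_iff_disj)
  then have "rank_in (C \<delta>) (max \<xi> \<delta>) = otp (C \<delta>)" by (metis otp_eq_rank_in)
  also have "\<dots> \<le> m" using square by (simp add: square_star_def)
  finally show ?thesis .
qed

lemma rho_letters: "set (rho \<xi> \<alpha>) \<subseteq> {..m}"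
  by (auto simp: rho0_def otp_eq_rank_in rank_in_C_le)

text \<open>If all elements of \<open>C \<alpha>\<close> were below \<open>\<xi>\<close>, equality
  of the suprema would make \<open>\<xi>\<close> a limit of \<open>C \<alpha>\<close>, hence an
  element by closure. The witness \<open>x0\<close> excludes the least ordinal, as \<open>C\<close>
  may be empty at the second one.\<close>

lemma C_cofinal:
  assumes "x0 < \<xi>" "\<xi> < \<alpha>" shows "\<exists>x\<in>C \<alpha>. \<xi> \<le> x"
proof (rule ccontr)
  assume "\<not> ?thesis"
  then have lt: "\<forall>x\<in>C \<alpha>. x < \<xi>" by (simp add: not_le)
  define s where "s = (LEAST t. \<forall>x\<in>C \<alpha>. x \<le> t)"
  have ub: "\<forall>x\<in>C \<alpha>. x \<le> \<xi>" using lt by (simp add: less_imp_le)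
  have s1: "\<forall>x\<in>C \<alpha>. x \<le> s" unfolding s_def using ub by (rule LeastI)
  have s2: "s \<le> t" if "\<forall>x\<in>C \<alpha>. x \<le> t" for t unfolding s_def using that by (rule Least_le)
  have "is_sup (C \<alpha>) s" using s1 s2 by (simp add: is_sup_def)
  then have "is_sup {..<\<alpha>} s" by (simp add: C_sup)
  then have "\<xi> \<le> s" using assms(2) by (simp add: is_sup_def)
  have "reaches (C \<alpha>) \<xi>" unfolding reaches_def
  proof (intro conjI allI impI)
    show "\<exists>\<beta>. \<beta> < \<xi>" using assms(1) by blast
    fix \<beta> assume b: "\<beta> < \<xi>"
    show "\<exists>\<gamma>\<in>C \<alpha>. \<beta> < \<gamma> \<and> \<gamma> < \<xi>"
    proof (rule ccontr)
      assume "\<not> ?thesis"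
      then have "\<forall>x\<in>C \<alpha>. x \<le> \<beta>" using lt by (metis not_le)
      from s2[OF this] show False using b \<open>\<xi> \<le> s\<close> by simp
    qed
  qed
  then have "\<xi> \<in> C \<alpha>" by (rule C_closed[OF assms(2)])
  then show False using lt by blast
qed

lemma reaches_C_limit: assumes "is_lim \<gamma>" shows "reaches (C \<gamma>) \<gamma>"
  unfolding reaches_def
proof (intro conjI allI impI)
  show "\<exists>\<beta>. \<beta> < \<gamma>" using assms by (simp add: is_lim_def)
  fix \<beta> assume "\<beta> < \<gamma>"
  then obtain \<xi> where x: "\<beta> < \<xi>" "\<xi> < \<gamma>" using assms by (auto simp: is_lim_def)
  from C_cofinal[OF this] obtain x where "x \<in> C \<gamma>" "\<xi> \<le> x" by blast
  then show "\<exists>\<gamma>'\<in>C \<gamma>. \<beta> < \<gamma>' \<and> \<gamma>' < \<gamma>" using x C_subset by (meson less_le_trans)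
qed

lemma walk_step:
  assumes "x0 < \<xi>" "\<xi> < \<alpha>"
  shows "walk_step \<xi> \<alpha> \<in> C \<alpha>" "\<xi> \<le> walk_step \<xi> \<alpha>" "walk_step \<xi> \<alpha> < \<alpha>"
proof -
  have "\<exists>x. x \<in> C \<alpha> \<and> \<xi> \<le> x" using C_cofinal[OF assms] by blast
  from LeastI_ex[OF this] show 1: "walk_step \<xi> \<alpha> \<in> C \<alpha>" "\<xi> \<le> walk_step \<xi> \<alpha>"
    by (simp_all add: walk_step_def)
  show "walk_step \<xi> \<alpha> < \<alpha>" using 1(1) by (rule C_subset)
qed

lemma Tr_shift: "\<xi> < \<alpha> \<Longrightarrow> Tr C \<xi> \<alpha> (Suc l) = Tr C \<xi> (walk_step \<xi> \<alpha>) l"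
  by (induction l) (simp_all add: walk_step_def)

lemma Tr_reaches: assumes "x0 < \<xi>" shows "\<xi> \<le> \<alpha> \<Longrightarrow> \<exists>l. Tr C \<xi> \<alpha> l = \<xi>"
proof (induction \<alpha> rule: less_induct)
  case (less \<alpha>)
  show ?case
  proof (cases "\<xi> = \<alpha>")
    case True then show ?thesis by (intro exI[of _ 0]) simp
  next
    case False
    then have lt: "\<xi> < \<alpha>" using less.prems by simp
    from less.IH[OF walk_step(3,2)[OF assms lt]] show ?thesis using Tr_shift[OF lt] by metis
  qed
qed

lemma rho_self [simp]: "rho \<xi> \<xi> = []"
proof -
  have "rho2 C \<xi> \<xi> = 0" unfolding rho2_def by (rule Least_eq_0) simp
  then show ?thesis by (simp add: rho0_def)
qed

lemma rho_step:
  assumes "x0 < \<xi>" "\<xi> < \<alpha>"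
  shows "rho \<xi> \<alpha> = rank_in (C \<alpha>) \<xi> # rho \<xi> (walk_step \<xi> \<alpha>)"
proof -
  obtain l where "Tr C \<xi> \<alpha> l = \<xi>" using Tr_reaches[OF assms(1)] assms(2) by (meson less_imp_le)
  moreover have "Tr C \<xi> \<alpha> 0 \<noteq> \<xi>" using assms by simp
  ultimately have "rho2 C \<xi> \<alpha> = Suc (LEAST l. Tr C \<xi> \<alpha> (Suc l) = \<xi>)"
    unfolding rho2_def by (rule Least_Suc)
  also have "\<dots> = Suc (rho2 C \<xi> (walk_step \<xi> \<alpha>))" unfolding rho2_def Tr_shift[OF assms(2)] ..
  finally have l: "rho2 C \<xi> \<alpha> = Suc (rho2 C \<xi> (walk_step \<xi> \<alpha>))" .
  show ?thesis unfolding rho0_def l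
    by (simp only: upt_conv_Cons zero_less_Suc list.map map_Suc_upt[symmetric] map_map o_def
        Tr_shift[OF assms(2)] Tr.simps(1) otp_eq_rank_in)
qed

text \<open>As long as the part of \<open>C \<alpha>\<close> below \<open>\<gamma>\<close> is
  bounded in \<open>\<gamma>\<close>, the first step and its letter are the same for
  \<open>\<gamma>\<close> and for all \<open>\<xi>\<close> close below it. So the walks run through
  the fixed letters \<open>p\<close> until they meet the first \<open>\<beta>\<close> for which
  \<open>C \<beta>\<close> accumulates at \<open>\<gamma>\<close>; this is \<open>\<gamma>\<close>
  itself or the last stop before it.\<close>

lemma walk_last:
  assumes "is_lim \<gamma>"
  shows "\<gamma> \<le> \<alpha> \<Longrightarrow> \<exists>p \<beta> \<epsilon>. \<epsilon> < \<gamma> \<and> \<gamma> \<le> \<beta> \<and> reaches (C \<beta>) \<gamma> \<and>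
    (\<forall>\<xi>. \<epsilon> < \<xi> \<and> \<xi> < \<gamma> \<longrightarrow> rho \<xi> \<alpha> = p @ rho \<xi> \<beta>) \<and>
    (\<beta> = \<gamma> \<and> rho \<gamma> \<alpha> = p \<or> \<gamma> < \<beta> \<and> rho \<gamma> \<alpha> = p @ [rank_in (C \<beta>) \<gamma>])"
proof (induction \<alpha> rule: less_induct)
  case (less \<alpha>)
  obtain x0 where x0: "x0 < \<gamma>" using assms by (auto simp: is_lim_def)
  consider "\<gamma> = \<alpha>" | "\<gamma> < \<alpha>" "reaches (C \<alpha>) \<gamma>" | "\<gamma> < \<alpha>" "\<not> reaches (C \<alpha>) \<gamma>"
    using less.prems by fastforce
  then show ?case
  proof cases
    case 1
    then show ?thesis using reaches_C_limit[OF assms] x0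
      by (intro exI[of _ "[]"] exI[of _ \<gamma>] exI[of _ x0]) auto
  next
    case 2
    have "\<gamma> \<in> C \<alpha>" using C_closed 2 by blast
    then have "walk_step \<gamma> \<alpha> = \<gamma>" unfolding walk_step_def by (intro Least_equality) auto
    then have "rho \<gamma> \<alpha> = [rank_in (C \<alpha>) \<gamma>]" using rho_step[OF x0 2(1)] by simp
    then show ?thesis using 2 x0
      by (intro exI[of _ "[]"] exI[of _ \<alpha>] exI[of _ x0]) auto
  next
    case 3
    then obtain \<epsilon> where e: "\<epsilon> < \<gamma>" "\<And>x. x \<in> C \<alpha> \<Longrightarrow> \<epsilon> < x \<Longrightarrow> \<gamma> \<le> x"
      using x0 unfolding reaches_def by (metis not_le)
    define \<alpha>' where "\<alpha>' = walk_step \<gamma> \<alpha>"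
    note st = walk_step[OF x0 3(1), folded \<alpha>'_def]
    from less.IH[OF st(3,2)] obtain p \<beta> \<epsilon>' where IH: "\<epsilon>' < \<gamma>" "\<gamma> \<le> \<beta>" "reaches (C \<beta>) \<gamma>"
      "\<And>\<xi>. \<epsilon>' < \<xi> \<Longrightarrow> \<xi> < \<gamma> \<Longrightarrow> rho \<xi> \<alpha>' = p @ rho \<xi> \<beta>"
      "\<beta> = \<gamma> \<and> rho \<gamma> \<alpha>' = p \<or> \<gamma> < \<beta> \<and> rho \<gamma> \<alpha>' = p @ [rank_in (C \<beta>) \<gamma>]" by blast
    define r where "r = rank_in (C \<alpha>) \<gamma>"
    have g: "rho \<gamma> \<alpha> = r # rho \<gamma> \<alpha>'" using rho_step[OF x0 3(1)] by (simp add: r_def \<alpha>'_def)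
    have "rho \<xi> \<alpha> = (r # p) @ rho \<xi> \<beta>" if x: "max \<epsilon> \<epsilon>' < \<xi>" "\<xi> < \<gamma>" for \<xi>
    proof -
      have "C \<alpha> \<inter> {..<\<xi>} = C \<alpha> \<inter> {..<\<gamma>}"
      proof (rule equalityI; rule subsetI)
        fix z assume z: "z \<in> C \<alpha> \<inter> {..<\<gamma>}"
        then have "\<not> \<epsilon> < z" using e(2)[of z] by auto
        then show "z \<in> C \<alpha> \<inter> {..<\<xi>}" using z x by auto
      qed (use x in auto)
      then have 1: "rank_in (C \<alpha>) \<xi> = r" unfolding r_def by (rule rank_in_cong)
      have 2: "walk_step \<xi> \<alpha> = \<alpha>'" unfolding walk_step_def
      proof (rule Least_equality)
        show "\<alpha>' \<in> C \<alpha> \<and> \<xi> \<le> \<alpha>'" using st x by auto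
        fix y assume y: "y \<in> C \<alpha> \<and> \<xi> \<le> y"
        then have "\<gamma> \<le> y" using e(2)[of y] x by auto
        then show "\<alpha>' \<le> y" unfolding \<alpha>'_def walk_step_def using y by (intro Least_le) simp
      qed
      have "\<epsilon> < \<xi>" "\<xi> < \<alpha>" using x 3(1) by auto
      from rho_step[OF this] 1 2 IH(4)[of \<xi>] x show ?thesis by simp
    qed
    then show ?thesis using e(1) IH(1-3,5) g
      by (intro exI[of _ "r # p"] exI[of _ \<beta>] exI[of _ "max \<epsilon> \<epsilon>'"]) auto
  qed
qed

text \<open>The \<open>\<beta>\<close> of \<open>walk_last\<close> must be \<open>\<gamma>\<close>,
  since otherwise \<open>\<gamma>\<close> would be an accumulation point of
  \<open>C \<beta>\<close>. So every walk to points close below \<open>\<gamma>\<close> passes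
  through \<open>\<gamma>\<close>.\<close>

lemma Aset_walk:
  assumes "\<gamma> \<in> Aset C" "\<gamma> \<le> \<alpha>"
  shows "\<exists>\<epsilon><\<gamma>. \<forall>\<xi>. \<epsilon> < \<xi> \<and> \<xi> < \<gamma> \<longrightarrow> rho \<xi> \<alpha> = rho \<gamma> \<alpha> @ rho \<xi> \<gamma>"
proof -
  have lim: "is_lim \<gamma>" using assms by (simp add: Aset_def)
  from walk_last[OF lim assms(2)] obtain p \<beta> \<epsilon> where l: "\<epsilon> < \<gamma>" "\<gamma> \<le> \<beta>" "reaches (C \<beta>) \<gamma>"
      "\<forall>\<xi>. \<epsilon> < \<xi> \<and> \<xi> < \<gamma> \<longrightarrow> rho \<xi> \<alpha> = p @ rho \<xi> \<beta>"
      "\<beta> = \<gamma> \<and> rho \<gamma> \<alpha> = p \<or> \<gamma> < \<beta> \<and> rho \<gamma> \<alpha> = p @ [rank_in (C \<beta>) \<gamma>]" by blast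
  have "\<not> \<gamma> < \<beta>"
  proof
    assume b: "\<gamma> < \<beta>"
    then have "\<gamma> \<in> acc (C \<beta>)" using C_closed[OF b l(3)] l(3) by (simp add: acc_def)
    then show False using assms(1) b by (auto simp: Aset_def)
  qed
  then show ?thesis using l by blast
qed

section \<open>Walks that agree on a tail of a limit ordinal\<close>

lemma rank_in_tail_cong:
  assumes "reaches X \<gamma>" "\<epsilon> < \<gamma>"
    and eq: "\<And>\<xi>. \<epsilon> < \<xi> \<Longrightarrow> \<xi> < \<gamma> \<Longrightarrow> rank_in X \<xi> = rank_in Y \<xi>"
  shows "rank_in Y \<gamma> \<le> rank_in X \<gamma>"
proof (rule ccontr)
  assume "\<not> ?thesis"
  then have "rank_in X \<gamma> < rank_in Y \<gamma>" by simp
  from rank_in_onto[OF this] obtain y where y: "y \<in> Y" "y < \<gamma>" "rank_in Y y = rank_in X \<gamma>" by blast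
  obtain c where c: "c \<in> X" "max y \<epsilon> < c" "c < \<gamma>"
    using reachesD[OF assms(1), of "max y \<epsilon>"] y(2) assms(2) by auto
  have "rank_in Y y \<le> rank_in Y c" using c by (intro rank_in_mono) (simp add: less_imp_le)
  also have "\<dots> = rank_in X c" using eq[of c] c by simp
  also have "\<dots> < rank_in X \<gamma>" using c by (intro rank_in_less)
  finally show False using y by simp
qed

text \<open>The letter behind \<open>p\<close> is the rank of \<open>\<xi>\<close> in
  \<open>C \<beta>\<close>, which differs at two elements of \<open>C \<beta>\<close> close to
  \<open>\<gamma>\<close>. Inside a longer \<open>p'\<close> the letter at this position would be
  constant.\<close>

lemma walk_tail_length_le:
  assumes lim: "\<epsilon> < \<gamma>" "\<gamma> \<le> \<beta>" "\<gamma> \<le> \<beta>'" "reaches (C \<beta>) \<gamma>"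
    and eq: "\<And>\<xi>. \<epsilon> < \<xi> \<Longrightarrow> \<xi> < \<gamma> \<Longrightarrow> p @ rho \<xi> \<beta> = p' @ rho \<xi> \<beta>'"
  shows "length p' \<le> length p"
proof (rule ccontr)
  assume "\<not> ?thesis"
  then have l: "length p < length p'" by simp
  obtain c where c: "c \<in> C \<beta>" "\<epsilon> < c" "c < \<gamma>" using reachesD[OF lim(4) lim(1)] by blast
  obtain d where d: "d \<in> C \<beta>" "c < d" "d < \<gamma>" using reachesD[OF lim(4) c(3)] by blast
  have "rank_in (C \<beta>) \<xi> = p' ! length p" if "\<epsilon> < \<xi>" "\<xi> < \<gamma>" for \<xi>
  proof -
    have "rho \<xi> \<beta> = rank_in (C \<beta>) \<xi> # rho \<xi> (walk_step \<xi> \<beta>)"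
      using that lim by (intro rho_step) auto
    then have "(p @ rho \<xi> \<beta>) ! length p = rank_in (C \<beta>) \<xi>" by simp
    moreover have "(p' @ rho \<xi> \<beta>') ! length p = p' ! length p" using l by (simp add: nth_append)
    ultimately show ?thesis using eq[OF that] by simp
  qed
  from this[of c] this[of d] have "rank_in (C \<beta>) c = rank_in (C \<beta>) d" using c d by auto
  then show False using rank_in_less[OF c(1) d(2)] by simp
qed

text \<open>Equal words near \<open>\<gamma>\<close> force equal constant parts, then equal ranks in
  \<open>C \<beta>\<close> and \<open>C \<beta>'\<close>, hence equality of these sets on a tail of
  \<open>\<gamma>\<close>. If just one of \<open>\<beta>\<close>, \<open>\<beta>'\<close> were
  \<open>\<gamma>\<close>, this would contradict \<open>Vset C\<close>. If neither is, the last
  letters agree, because the rank at a limit of a set is determined by the ranks below.\<close>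

lemma Vset_walk:
  assumes V: "\<gamma> \<in> Vset C" and le: "\<gamma> \<le> \<alpha>" "\<gamma> \<le> \<alpha>'" and e0: "\<epsilon>0 < \<gamma>"
    and eq: "\<And>\<xi>. \<epsilon>0 < \<xi> \<Longrightarrow> \<xi> < \<gamma> \<Longrightarrow> rho \<xi> \<alpha> = rho \<xi> \<alpha>'"
  shows "rho \<gamma> \<alpha> = rho \<gamma> \<alpha>'"
proof -
  have lim: "is_lim \<gamma>" using V by (simp add: Vset_def)
  from walk_last[OF lim le(1)] obtain p \<beta> \<epsilon>1 where a: "\<epsilon>1 < \<gamma>" "\<gamma> \<le> \<beta>" "reaches (C \<beta>) \<gamma>"
      "\<And>\<xi>. \<epsilon>1 < \<xi> \<Longrightarrow> \<xi> < \<gamma> \<Longrightarrow> rho \<xi> \<alpha> = p @ rho \<xi> \<beta>"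
      "\<beta> = \<gamma> \<and> rho \<gamma> \<alpha> = p \<or> \<gamma> < \<beta> \<and> rho \<gamma> \<alpha> = p @ [rank_in (C \<beta>) \<gamma>]" by blast
  from walk_last[OF lim le(2)] obtain p' \<beta>' \<epsilon>2 where b: "\<epsilon>2 < \<gamma>" "\<gamma> \<le> \<beta>'" "reaches (C \<beta>') \<gamma>"
      "\<And>\<xi>. \<epsilon>2 < \<xi> \<Longrightarrow> \<xi> < \<gamma> \<Longrightarrow> rho \<xi> \<alpha>' = p' @ rho \<xi> \<beta>'"
      "\<beta>' = \<gamma> \<and> rho \<gamma> \<alpha>' = p' \<or> \<gamma> < \<beta>' \<and> rho \<gamma> \<alpha>' = p' @ [rank_in (C \<beta>') \<gamma>]" by blast
  define \<epsilon> where "\<epsilon> = max \<epsilon>0 (max \<epsilon>1 \<epsilon>2)"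
  have e: "\<epsilon> < \<gamma>" using e0 a(1) b(1) by (simp add: \<epsilon>_def)
  have eq': "p @ rho \<xi> \<beta> = p' @ rho \<xi> \<beta>'" if "\<epsilon> < \<xi>" "\<xi> < \<gamma>" for \<xi>
    using eq[of \<xi>] a(4)[of \<xi>] b(4)[of \<xi>] that by (simp add: \<epsilon>_def)
  have len: "length p = length p'"
    using walk_tail_length_le[OF e a(2) b(2) a(3) eq'] walk_tail_length_le[OF e b(2) a(2) b(3) eq'[symmetric]]
    by simp
  have tails: "p = p' \<and> rank_in (C \<beta>) \<xi> = rank_in (C \<beta>') \<xi>" if x: "\<epsilon> < \<xi>" "\<xi> < \<gamma>" for \<xi>
  proof -
    have "rho \<xi> \<beta> = rank_in (C \<beta>) \<xi> # rho \<xi> (walk_step \<xi> \<beta>)"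
      using x a(2) by (intro rho_step) auto
    moreover have "rho \<xi> \<beta>' = rank_in (C \<beta>') \<xi> # rho \<xi> (walk_step \<xi> \<beta>')"
      using x b(2) by (intro rho_step) auto
    ultimately show ?thesis using eq'[OF x] len by simp
  qed
  obtain x1 where x1: "\<epsilon> < x1" "x1 < \<gamma>" using lim e by (auto simp: is_lim_def)
  have p: "p = p'" using tails[OF x1] by simp
  have mem: "\<xi> \<in> C \<beta> \<longleftrightarrow> \<xi> \<in> C \<beta>'" if x: "\<epsilon> < \<xi>" "\<xi> < \<gamma>" for \<xi>
  proof -
    have ex: "\<exists>y. \<xi> < y \<and> y < \<gamma>" using lim x by (auto simp: is_lim_def)
    have "rank_in (C \<beta>) y = rank_in (C \<beta>') y" if "\<xi> \<le> y" "y < \<gamma>" for y using tails[of y] x that by simp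
    then show ?thesis
      unfolding mem_iff_rank_in_less[OF ex, of "C \<beta>"] mem_iff_rank_in_less[OF ex, of "C \<beta>'"] using x by auto
  qed
  have tail: "C \<beta> \<inter> {x1..<\<gamma>} = C \<beta>' \<inter> {x1..<\<gamma>}" using mem x1 by fastforce
  have "\<beta> = \<gamma> \<longleftrightarrow> \<beta>' = \<gamma>"
  proof (rule ccontr)
    assume "\<not> ?thesis"
    then consider "\<beta> = \<gamma>" "\<gamma> < \<beta>'" | "\<beta>' = \<gamma>" "\<gamma> < \<beta>" using a(2) b(2) by fastforce
    then show False by cases (use V tail x1(2) in \<open>auto simp: Vset_def\<close>)
  qed
  moreover have "rank_in (C \<beta>) \<gamma> = rank_in (C \<beta>') \<gamma>"
    using rank_in_tail_cong[OF a(3) e, of "C \<beta>'"] rank_in_tail_cong[OF b(3) e, of "C \<beta>"] tails by (simp add: order.antisym)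
  ultimately show ?thesis using a(5) b(5) p by auto
qed

section \<open>The levels of the tree have size at most \<mu>\<close>

definition level_node :: "'k \<Rightarrow> 'k \<Rightarrow> 'k node" where
  "level_node \<alpha> a = (\<lambda>\<xi>. if \<xi> \<le> a then Some (rho \<xi> \<alpha>) else None)"

text \<open>If \<open>C\<close> is empty at the second ordinal, walks to the least ordinal do not terminate and the value
  of \<open>rho2\<close> is junk.\<close>
lemma rho_bottom: "{..<\<xi>} = {} \<Longrightarrow> rho \<xi> \<alpha> \<in> range (\<lambda>l. replicate l (otp ({}::'k set)))"
  by (auto simp: rho0_def map_replicate_const)

text \<open>The words of walks from some \<open>\<alpha> > a\<close> to points up to
  \<open>a\<close>, computed from the trace \<open>K\<close> of \<open>C \<alpha>\<close> up to
  \<open>a\<close>. If the next stop lies in \<open>K\<close>, it is known outright; otherwise it is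
  the least element of \<open>C \<alpha>\<close> above \<open>a\<close>, whose words are supplied by
  \<open>f\<close>.\<close>

definition level_step :: "'k \<Rightarrow> 'k set \<Rightarrow> ('k \<Rightarrow> 'k list) \<Rightarrow> 'k \<Rightarrow> 'k list" where
  "level_step a K f = (\<lambda>\<xi>. if {..<\<xi>} \<noteq> {} \<and> \<xi> \<le> a
     then rank_in K \<xi> # (if \<exists>x\<in>K. \<xi> \<le> x then rho \<xi> (LEAST x. x \<in> K \<and> \<xi> \<le> x) else f \<xi>) else [])"

definition level_rho :: "'k \<Rightarrow> 'k \<Rightarrow> 'k \<Rightarrow> 'k list" where
  "level_rho a \<alpha> = (\<lambda>\<xi>. if {..<\<xi>} \<noteq> {} \<and> \<xi> \<le> a then rho \<xi> \<alpha> else [])"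

lemma level_step_rho:
  assumes "a < \<alpha>" and f: "(\<exists>x\<in>C \<alpha>. a < x) \<Longrightarrow> f = level_rho a (LEAST x. x \<in> C \<alpha> \<and> a < x)"
  shows "level_rho a \<alpha> = level_step a (C \<alpha> \<inter> {..a}) f"
proof
  fix \<xi>
  show "level_rho a \<alpha> \<xi> = level_step a (C \<alpha> \<inter> {..a}) f \<xi>"
  proof (cases "{..<\<xi>} \<noteq> {} \<and> \<xi> \<le> a")
    case True
    then obtain x0 where x: "x0 < \<xi>" "\<xi> \<le> a" "\<xi> < \<alpha>" using le_less_trans[OF _ assms(1)] by auto
    have r: "rank_in (C \<alpha> \<inter> {..a}) \<xi> = rank_in (C \<alpha>) \<xi>" using x(2) by (intro rank_in_cong) auto
    note st = walk_step[OF x(1,3)]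
    show ?thesis
    proof (cases "\<exists>y\<in>C \<alpha> \<inter> {..a}. \<xi> \<le> y")
      case ex: True
      then obtain y where y: "y \<in> C \<alpha>" "\<xi> \<le> y" "y \<le> a" by auto
      have "walk_step \<xi> \<alpha> \<le> y" unfolding walk_step_def using y by (intro Least_le) simp
      then have "(LEAST x. x \<in> C \<alpha> \<inter> {..a} \<and> \<xi> \<le> x) = walk_step \<xi> \<alpha>"
        using st y(3) by (intro Least_equality) (auto simp: walk_step_def intro: Least_le)
      then show ?thesis using True ex rho_step[OF x(1,3)] r by (simp add: level_step_def level_rho_def)
    next
      case no: False
      then have gt: "a < y" if "y \<in> C \<alpha>" "\<xi> \<le> y" for y using that by (metis Int_iff atMost_iff not_le)
      have "(\<lambda>x. x \<in> C \<alpha> \<and> a < x) = (\<lambda>x. x \<in> C \<alpha> \<and> \<xi> \<le> x)" using gt x(2) by fastforce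
      then have "(LEAST x. x \<in> C \<alpha> \<and> a < x) = walk_step \<xi> \<alpha>" by (simp add: walk_step_def)
      moreover have "\<exists>x\<in>C \<alpha>. a < x" using st gt by blast
      ultimately have "f \<xi> = rho \<xi> (walk_step \<xi> \<alpha>)" using f True by (simp add: level_rho_def)
      then show ?thesis using True no rho_step[OF x(1,3)] r by (simp add: level_step_def level_rho_def)
    qed
  next
    case False then show ?thesis unfolding level_step_def level_rho_def by (simp only: if_False)
  qed
qed

text \<open>The descent through stops above \<open>a\<close> is finite, so finitely many traces
  determine all the words. By weak coherence there are at most \<mu> traces, hence at most \<mu>
  such lists.\<close>

lemma level_word:
  "a < \<alpha> \<Longrightarrow> \<exists>Ks\<in>lists {C \<delta> \<inter> {..a} |\<delta>. True}.
    level_rho a \<alpha> = foldr (level_step a) Ks (\<lambda>_. [])"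
proof (induction \<alpha> rule: less_induct)
  case (less \<alpha>)
  have mem: "C \<alpha> \<inter> {..a} \<in> {C \<delta> \<inter> {..a} |\<delta>. True}" by (rule CollectI, rule exI[of _ \<alpha>]) simp
  show ?case
  proof (cases "\<exists>x\<in>C \<alpha>. a < x")
    case True
    define \<alpha>' where "\<alpha>' = (LEAST x. x \<in> C \<alpha> \<and> a < x)"
    from True have "\<exists>x. x \<in> C \<alpha> \<and> a < x" by (simp only: Bex_def)
    then have 1: "\<alpha>' \<in> C \<alpha> \<and> a < \<alpha>'" unfolding \<alpha>'_def by (rule LeastI_ex)
    have "\<alpha>' < \<alpha>" using C_subset 1 by simp
    from less.IH[OF this conjunct2[OF 1]] obtain Ks where Ks: "Ks \<in> lists {C \<delta> \<inter> {..a} |\<delta>. True}"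
      "level_rho a \<alpha>' = foldr (level_step a) Ks (\<lambda>_. [])" by (rule bexE)
    have "level_rho a \<alpha> = level_step a (C \<alpha> \<inter> {..a}) (foldr (level_step a) Ks (\<lambda>_. []))"
      by (rule level_step_rho[OF less.prems]) (simp only: \<alpha>'_def[symmetric] Ks(2))
    then have "level_rho a \<alpha> = foldr (level_step a) ((C \<alpha> \<inter> {..a}) # Ks) (\<lambda>_. [])"
      by (simp only: foldr_Cons o_apply)
    then show ?thesis by (rule bexI) (rule lists.Cons[OF mem Ks(1)])
  next
    case False
    have "level_rho a \<alpha> = level_step a (C \<alpha> \<inter> {..a}) (\<lambda>_. [])"
      by (rule level_step_rho[OF less.prems]) (rule notE[OF False])
    then have "level_rho a \<alpha> = foldr (level_step a) [C \<alpha> \<inter> {..a}] (\<lambda>_. [])"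
      by (simp only: foldr_Cons foldr_Nil o_apply id_apply)
    then show ?thesis by (rule bexI) (rule lists.Cons[OF mem lists.Nil])
  qed
qed

lemma small_traces: "small {C \<delta> \<inter> {..a} |\<delta>. True}"
proof -
  define b where "b = (LEAST b. a < b)"
  have b: "a < b" unfolding b_def using ex_greater by (rule LeastI_ex)
  have "z \<le> a" if "z < b" for z using not_less_Least[of z "\<lambda>y. a < y"] that by (simp add: b_def)
  then have "{..a} = {..<b}" using b by auto
  moreover have "small {C \<delta> \<inter> {..<b} |\<delta>. True}" unfolding small_def using square unfolding square_star_def by blast
  ultimately show ?thesis by (simp only:)
qed

lemma small_level: "small (range (\<lambda>\<alpha>. level_node \<alpha> a))"
proof -
  define W where "W = (\<lambda>Ks. foldr (level_step a) Ks (\<lambda>_. [])) ` lists {C \<delta> \<inter> {..a} |\<delta>. True}"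
  define Z where "Z = range (\<lambda>l. replicate l (otp ({}::'k set)))"
  define G where "G = (\<lambda>(f::'k \<Rightarrow> 'k list, w) \<xi>. if \<xi> \<le> a then Some (if {..<\<xi>} \<noteq> {} then f \<xi> else w) else None)"
  have "small (W \<times> Z)" unfolding W_def Z_def
    by (intro small_Times small_image small_lists small_traces small_nat)
  then have 1: "small (G ` (W \<times> Z) \<union> (\<lambda>\<alpha>. level_node \<alpha> a) ` {..a})"
    by (intro small_Un small_image small_atMost)
  have "level_node \<alpha> a \<in> G ` (W \<times> Z)" if "a < \<alpha>" for \<alpha>
  proof -
    have fW: "level_rho a \<alpha> \<in> W" using level_word[OF that] unfolding W_def by (rule bexE) (rule image_eqI)
    \<comment> \<open>The least ordinal is recorded separately: \<open>level_rho\<close> ignores it,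
      and \<open>rho_bottom\<close> leaves countably many possible words there.\<close>
    define z :: 'k where "z = (LEAST z. True)"
    have z: "{..<z} = {}" unfolding z_def using not_less_Least[of _ "\<lambda>z. True"] by auto
    have zu: "\<xi> = z" if "{..<\<xi>} = {}" for \<xi>
      using that z by (metis lessThan_iff empty_iff linorder_neqE)
    have "rho z \<alpha> \<in> Z" unfolding Z_def by (rule rho_bottom[OF z])
    moreover have "level_node \<alpha> a = G (level_rho a \<alpha>, rho z \<alpha>)"
      unfolding level_node_def G_def level_rho_def using zu by auto
    ultimately show ?thesis using fW by blast
  qed
  then have "range (\<lambda>\<alpha>. level_node \<alpha> a) \<subseteq> G ` (W \<times> Z) \<union> (\<lambda>\<alpha>. level_node \<alpha> a) ` {..a}"
    by (metis (no_types, lifting) UnCI atMost_iff image_eqI image_subsetI not_le)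
  with 1 show ?thesis by (rule small_subset)
qed

section \<open>Nodes, heights and restrictions\<close>

lemma dom_rho0_node: "dom (rho0_node C \<delta> \<gamma>) = {..<\<gamma>}"
  by (auto simp: rho0_node_def split: if_splits)

lemma lessThan_inject: "{..<a} = {..<b} \<Longrightarrow> a = (b::'k)"
  by (metis lessThan_iff linorder_neqE order_less_irrefl)

lemma ht_eq: "dom t = {..<a} \<Longrightarrow> ht t = (a::'k)"
  unfolding ht_def by (rule Least_equality) (auto dest: lessThan_inject)

lemma ht_rho0_node [simp]: "ht (rho0_node C \<delta> \<gamma>) = \<gamma>"
  by (rule ht_eq[OF dom_rho0_node])

lemma tree_nodeE:
  assumes "t \<in> tree_rho0 C"
  obtains \<delta> where "t = rho0_node C \<delta> (ht t)" "ht t \<le> \<delta>"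
  using assms unfolding tree_rho0_def by auto

lemma dom_tree_node: "t \<in> tree_rho0 C \<Longrightarrow> dom t = {..<ht t}"
  by (metis tree_nodeE dom_rho0_node)

lemma restrict_tree_node:
  assumes "t \<in> tree_rho0 C" "a < ht t" shows "t |` {..a} \<in> range (\<lambda>\<alpha>. level_node \<alpha> a)"
proof -
  obtain \<delta> where d: "t = rho0_node C \<delta> (ht t)" by (rule tree_nodeE[OF assms(1)])
  have "t |` {..a} = level_node \<delta> a" using assms(2)
    by (subst d) (auto simp: rho0_node_def level_node_def restrict_map_def fun_eq_iff)
  then show ?thesis by blast
qed

lemma small_nodes_below: "small {t \<in> tree_rho0 C. ht t \<le> a}"
proof -
  have "small ((\<lambda>(t, \<gamma>). t |` {..<\<gamma>}) ` (range (\<lambda>\<alpha>. level_node \<alpha> a) \<times> {..a}))"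
    by (intro small_image small_Times small_level small_atMost)
  moreover have "{t \<in> tree_rho0 C. ht t \<le> a} \<subseteq> (\<lambda>(t, \<gamma>). t |` {..<\<gamma>}) ` (range (\<lambda>\<alpha>. level_node \<alpha> a) \<times> {..a})"
  proof
    fix t assume t: "t \<in> {t \<in> tree_rho0 C. ht t \<le> a}"
    then obtain \<delta> where d: "t = rho0_node C \<delta> (ht t)" using tree_nodeE by blast
    have "t = level_node \<delta> a |` {..<ht t}" using t
      by (subst d) (auto simp: rho0_node_def level_node_def restrict_map_def fun_eq_iff)
    then show "t \<in> (\<lambda>(t, \<gamma>). t |` {..<\<gamma>}) ` (range (\<lambda>\<alpha>. level_node \<alpha> a) \<times> {..a})"
      using t by (intro image_eqI[of _ _ "(level_node \<delta> a, ht t)"]) auto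
  qed
  ultimately show ?thesis by (rule small_subset)
qed

text \<open>No element of \<open>C \<delta>\<close> lies strictly between \<open>\<psi>\<close> and
  \<open>\<gamma>\<close>, so every walk into this gap steps to \<open>\<gamma>\<close> first, with
  the same letter. A guessed \<open>\<gamma>\<close> thus inserts a letter of prescribed label into
  all words on an interval.\<close>

lemma rho_gap:
  assumes "\<gamma> \<in> C \<delta>" "\<psi> < \<xi>" "\<xi> \<le> \<gamma>" and gap: "\<forall>x\<in>C \<delta>. x < \<gamma> \<longrightarrow> x \<le> \<psi>"
  shows "rho \<xi> \<delta> = rank_in (C \<delta>) \<gamma> # rho \<xi> \<gamma>"
proof -
  have gd: "\<gamma> < \<delta>" by (rule C_subset[OF assms(1)])
  have "walk_step \<xi> \<delta> = \<gamma>" unfolding walk_step_def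
  proof (rule Least_equality)
    show "\<gamma> \<in> C \<delta> \<and> \<xi> \<le> \<gamma>" using assms by simp
    fix y assume y: "y \<in> C \<delta> \<and> \<xi> \<le> y"
    show "\<gamma> \<le> y"
    proof (rule ccontr)
      assume "\<not> \<gamma> \<le> y"
      then have "y \<le> \<psi>" using gap y by simp
      then show False using conjunct2[OF y] assms(2) by order
    qed
  qed
  moreover have "C \<delta> \<inter> {..<\<xi>} = C \<delta> \<inter> {..<\<gamma>}"
  proof (rule equalityI; rule subsetI)
    fix z assume z: "z \<in> C \<delta> \<inter> {..<\<gamma>}"
    then have "z \<le> \<psi>" using gap by simp
    then show "z \<in> C \<delta> \<inter> {..<\<xi>}" using z assms(2) by simp
  qed (use assms(3) in auto)
  then have "rank_in (C \<delta>) \<xi> = rank_in (C \<delta>) \<gamma>" by (rule rank_in_cong)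
  moreover have "\<xi> < \<delta>" using assms(3) gd by simp
  ultimately show ?thesis using rho_step[OF assms(2)] by simp
qed

lemma nacc_pred:
  assumes "\<gamma> \<in> nacc (C \<delta>)" "c \<in> C \<delta>" "c < \<gamma>"
  shows "\<exists>\<psi>\<in>C \<delta>. c \<le> \<psi> \<and> \<psi> < \<gamma> \<and> (\<forall>x\<in>C \<delta>. x < \<gamma> \<longrightarrow> x \<le> \<psi>)"
proof (rule ex_Max_below[OF _ _ assms(2,3)])
  have g: "\<gamma> \<in> C \<delta>" "\<not> reaches (C \<delta>) \<gamma>" using assms(1) by (auto simp: nacc_def acc_def)
  show "\<not> reaches (C \<delta>) \<gamma>" by (rule g(2))
  fix x assume "x < \<gamma>" "reaches (C \<delta>) x"
  moreover have "\<gamma> < \<delta>" by (rule C_subset[OF g(1)])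
  ultimately show "x \<in> C \<delta>" by (intro C_closed) auto
qed

text \<open>Pressing down for values that are not ordinals but ranked by \<open>r\<close>. Only
  unboundedness of a fibre is claimed, so the clubs to be diagonalised are final segments.\<close>

lemma fodor_unbounded:
  assumes stat: "\<And>D. club D \<Longrightarrow> \<exists>\<gamma>\<in>G. \<gamma> \<in> D" and reg: "\<And>\<gamma>. \<gamma> \<in> G \<Longrightarrow> r (f \<gamma>) < \<gamma>"
    and few: "\<And>e. small {v \<in> f ` G. r v \<le> (e::'k)}"
  shows "\<exists>v. \<forall>b. \<exists>\<gamma>\<in>G. b < \<gamma> \<and> f \<gamma> = v"
proof (rule ccontr)
  assume "\<not> ?thesis"
  then have "\<forall>v. \<exists>b. \<forall>\<gamma>\<in>G. f \<gamma> = v \<longrightarrow> \<gamma> \<le> b" by (metis not_le)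
  then obtain b where b: "\<And>v \<gamma>. \<gamma> \<in> G \<Longrightarrow> f \<gamma> = v \<Longrightarrow> \<gamma> \<le> b v" by metis
  have "club {d. \<forall>v\<in>f ` G. r v < d \<longrightarrow> d \<in> {d. b v < d}}"
    by (rule club_diagonal[OF club_above few])
  from stat[OF this] obtain \<gamma> where g: "\<gamma> \<in> G" "\<forall>v\<in>f ` G. r v < \<gamma> \<longrightarrow> b v < \<gamma>" by auto
  then have "b (f \<gamma>) < \<gamma>" using reg by blast
  then show False using b[OF g(1) refl] by simp
qed

section \<open>Walks behind nodes, rapid families and meets\<close>

definition top_of :: "'k node \<Rightarrow> 'k" where
  "top_of t = (SOME \<delta>. t = rho0_node C \<delta> (ht t) \<and> ht t \<le> \<delta>)"

lemma top_of:
  assumes "t \<in> tree_rho0 C"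
  shows "ht t \<le> top_of t" "\<xi> < ht t \<Longrightarrow> t \<xi> = Some (rho \<xi> (top_of t))"
proof -
  have "\<exists>\<delta>. t = rho0_node C \<delta> (ht t) \<and> ht t \<le> \<delta>" using tree_nodeE[OF assms] by metis
  from someI_ex[OF this] have *: "t = rho0_node C (top_of t) (ht t)" "ht t \<le> top_of t"
    by (simp_all add: top_of_def)
  show "ht t \<le> top_of t" by (rule *(2))
  assume "\<xi> < ht t"
  then show "t \<xi> = Some (rho \<xi> (top_of t))" by (subst *(1)) (simp add: rho0_node_def)
qed

text \<open>Otherwise every member has a coordinate of height at most \<open>b\<close>. Rapidity
  makes the choice of such a coordinate injective, but there are at most \<mu> nodes of height at
  most \<open>b\<close>.\<close>

lemma rapid_unbounded:
  assumes n: "0 < n" and S: "S \<subseteq> {s. length s = n \<and> set s \<subseteq> tree_rho0 C}" "rapid n S" "S \<approx> (UNIV :: 'k set)"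
  shows "\<exists>x\<in>S. \<forall>k<n. b < ht (x ! k)"
proof (rule ccontr)
  assume "\<not> ?thesis"
  then have "\<forall>x\<in>S. \<exists>k<n. ht (x ! k) \<le> b" by (metis not_le)
  then obtain k where k: "\<And>x. x \<in> S \<Longrightarrow> k x < n \<and> ht (x ! k x) \<le> b" by metis
  have "inj_on (\<lambda>x. x ! k x) S"
  proof (rule inj_onI, rule ccontr)
    fix x y assume xy: "x \<in> S" "y \<in> S" "x ! k x = y ! k y" "x \<noteq> y"
    then have "ht (x ! k x) < ht (y ! k y) \<or> ht (y ! k y) < ht (x ! k x)"
      using S(2) k unfolding rapid_def by blast
    then show False using xy by simp
  qed
  moreover have "(\<lambda>x. x ! k x) ` S \<subseteq> {t \<in> tree_rho0 C. ht t \<le> b}"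
  proof (rule image_subsetI)
    fix x assume x: "x \<in> S"
    then have "x ! k x \<in> set x" using k[OF x] S(1) by (intro nth_mem) auto
    then show "x ! k x \<in> {t \<in> tree_rho0 C. ht t \<le> b}" using k[OF x] S(1) x by auto
  qed
  ultimately have "S \<lesssim> {t \<in> tree_rho0 C. ht t \<le> b}" unfolding lepoll_def by blast
  then have "small S" using small_nodes_below unfolding small_def by (rule lepoll_trans)
  then have "small (UNIV :: 'k set)" using S(3) unfolding small_def by (meson eqpoll_imp_lepoll eqpoll_sym lepoll_trans)
  then show False using not_small_UNIV by (rule notE[rotated])
qed

lemma Delta_meet:
  assumes t: "t \<in> tree_rho0 C" "t' \<in> tree_rho0 C" and e: "\<epsilon> < ht t" "\<epsilon> < ht t'" "t \<epsilon> \<noteq> t' \<epsilon>"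
    and eq: "\<And>\<xi>. \<xi> < \<epsilon> \<Longrightarrow> t \<xi> = t' \<xi>"
  shows "meet t t' = t |` {..<\<epsilon>}" "ht (meet t t') = \<epsilon>"
proof -
  have e': "\<epsilon> \<in> dom t \<inter> dom t'" using dom_tree_node[OF t(1)] dom_tree_node[OF t(2)] e by auto
  have "(LEAST \<xi>. \<xi> \<in> dom t \<inter> dom t' \<and> t \<xi> \<noteq> t' \<xi>) = \<epsilon>"
  proof (rule Least_equality)
    show "\<epsilon> \<in> dom t \<inter> dom t' \<and> t \<epsilon> \<noteq> t' \<epsilon>" using e' e(3) by blast
    fix y assume "y \<in> dom t \<inter> dom t' \<and> t y \<noteq> t' y"
    then show "\<epsilon> \<le> y" using eq[of y] by (metis not_le)
  qed
  then have "Delta t t' = \<epsilon>" unfolding Delta_def using e' e(3) by auto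
  then show m: "meet t t' = t |` {..<\<epsilon>}" by (simp add: meet_def)
  have "dom (meet t t') = {..<\<epsilon>}" unfolding m dom_restrict dom_tree_node[OF t(1)] using e(1) by auto
  then show "ht (meet t t') = \<epsilon>" by (rule ht_eq)
qed

end

section \<open>The ideal of non-guessing sets\<close>

locale guessing = c_sequence m C for m :: "'k::wellorder" and C +
  fixes D0 :: "'k set" and g :: "'k \<Rightarrow> 'k" and H :: "'k \<Rightarrow> nat"
  assumes D0: "club D0" "D0 \<subseteq> Vset C"
    and guess: "\<And>D \<nu>. club D \<Longrightarrow> \<nu> < m \<Longrightarrow> \<exists>\<delta>\<in>Aset C. \<forall>N.
      reaches {\<gamma> \<in> nacc (C \<delta>) \<inter> D. g (rank_in (C \<delta>) \<gamma>) = \<nu> \<and> H (rank_in (C \<delta>) \<gamma>) = N} \<delta>"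
begin

definition guesses :: "'k \<Rightarrow> 'k \<Rightarrow> 'k set \<Rightarrow> bool" where
  "guesses \<nu> \<delta> D \<longleftrightarrow> (\<forall>N.
      reaches {\<gamma> \<in> nacc (C \<delta>) \<inter> D. g (rank_in (C \<delta>) \<gamma>) = \<nu> \<and> H (rank_in (C \<delta>) \<gamma>) = N} \<delta>)"

text \<open>The ideal of non-positive sets is normal, as guessing at \<open>\<delta>\<close> only depends on the club on a
  tail of \<open>\<delta>\<close>.\<close>
definition Pos :: "'k \<Rightarrow> 'k set \<Rightarrow> bool" where
  "Pos \<nu> Q \<longleftrightarrow> Q \<subseteq> Aset C \<and> (\<forall>D. club D \<longrightarrow> (\<exists>\<delta>\<in>Q. guesses \<nu> \<delta> D))"

lemma guessesD:
  assumes "guesses \<nu> \<delta> D" "b < \<delta>"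
  obtains \<gamma> where "\<gamma> \<in> nacc (C \<delta>)" "\<gamma> \<in> D" "g (rank_in (C \<delta>) \<gamma>) = \<nu>" "H (rank_in (C \<delta>) \<gamma>) = N" "b < \<gamma>" "\<gamma> < \<delta>"
proof -
  have "reaches {\<gamma> \<in> nacc (C \<delta>) \<inter> D. g (rank_in (C \<delta>) \<gamma>) = \<nu> \<and> H (rank_in (C \<delta>) \<gamma>) = N} \<delta>"
    using assms(1) by (simp add: guesses_def)
  from reachesD[OF this assms(2)] show ?thesis using that by blast
qed

lemma guesses_tail:
  assumes "guesses \<nu> \<delta> D" "b < \<delta>" "\<And>\<gamma>. \<gamma> \<in> D \<Longrightarrow> b < \<gamma> \<Longrightarrow> \<gamma> < \<delta> \<Longrightarrow> \<gamma> \<in> D'"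
  shows "guesses \<nu> \<delta> D'"
  unfolding guesses_def reaches_def
proof (intro allI conjI impI)
  show "\<exists>\<beta>. \<beta> < \<delta>" using assms(2) by blast
  fix N \<beta> assume "\<beta> < \<delta>"
  then have "max \<beta> b < \<delta>" using assms(2) by simp
  from guessesD[OF assms(1) this, of N] obtain \<gamma> where
    "\<gamma> \<in> nacc (C \<delta>)" "\<gamma> \<in> D" "g (rank_in (C \<delta>) \<gamma>) = \<nu>" "H (rank_in (C \<delta>) \<gamma>) = N" "max \<beta> b < \<gamma>" "\<gamma> < \<delta>" .
  then show "\<exists>\<gamma>\<in>{\<gamma> \<in> nacc (C \<delta>) \<inter> D'. g (rank_in (C \<delta>) \<gamma>) = \<nu> \<and> H (rank_in (C \<delta>) \<gamma>) = N}. \<beta> < \<gamma> \<and> \<gamma> < \<delta>"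
    using assms(3) by (intro bexI[of _ \<gamma>]) auto
qed

lemma Pos_Aset: "\<nu> < m \<Longrightarrow> Pos \<nu> (Aset C)"
  using guess by (simp add: Pos_def guesses_def)

text \<open>If every fibre were refuted by a club \<open>D v\<close>, some \<open>\<delta>\<close>
  would guess their diagonal intersection; above the rank of \<open>f \<delta>\<close> all these
  guesses lie in \<open>D (f \<delta>)\<close>, a contradiction.\<close>

lemma Pos_normal:
  assumes Q: "Pos \<nu> Q" and reg: "\<And>\<delta>. \<delta> \<in> Q \<Longrightarrow> r (f \<delta>) < \<delta>" and few: "\<And>e. small {v \<in> f ` Q. r v \<le> (e::'k)}"
  shows "\<exists>v. Pos \<nu> {\<delta> \<in> Q. f \<delta> = v}"
proof (rule ccontr)
  assume no: "\<not> ?thesis"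
  have "\<exists>D. club D \<and> (\<forall>\<delta>. \<delta> \<in> Q \<longrightarrow> f \<delta> = v \<longrightarrow> \<not> guesses \<nu> \<delta> D)" for v
  proof -
    have "\<not> Pos \<nu> {\<delta> \<in> Q. f \<delta> = v}" using no by simp
    moreover have "{\<delta> \<in> Q. f \<delta> = v} \<subseteq> Aset C" using Q unfolding Pos_def by (simp add: subset_iff)
    ultimately have "\<not> (\<forall>D. club D \<longrightarrow> (\<exists>\<delta>\<in>{\<delta> \<in> Q. f \<delta> = v}. guesses \<nu> \<delta> D))"
      unfolding Pos_def by (simp only: simp_thms)
    then show ?thesis by simp blast
  qed
  then obtain D where D: "\<And>v. club (D v) \<and> (\<forall>\<delta>. \<delta> \<in> Q \<longrightarrow> f \<delta> = v \<longrightarrow> \<not> guesses \<nu> \<delta> (D v))" by metis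
  define E where "E = {d. \<forall>v\<in>f ` Q. r v < d \<longrightarrow> d \<in> D v}"
  have "club E" unfolding E_def by (rule club_diagonal[OF _ few]) (simp add: D)
  then have "\<exists>\<delta>\<in>Q. guesses \<nu> \<delta> E" using Q by (simp add: Pos_def)
  then obtain \<delta> where d: "\<delta> \<in> Q" "guesses \<nu> \<delta> E" by (rule bexE)
  have "guesses \<nu> \<delta> (D (f \<delta>))"
    by (rule guesses_tail[OF d(2) reg[OF d(1)]]) (use d(1) in \<open>simp add: E_def\<close>)
  then show False using D d(1) by simp
qed

lemma Pos_tail:
  assumes Q: "Pos \<nu> Q" shows "Pos \<nu> {\<delta> \<in> Q. b < \<delta>}"
  unfolding Pos_def
proof (intro conjI allI impI)
  show "{\<delta> \<in> Q. b < \<delta>} \<subseteq> Aset C" using Q by (auto simp: Pos_def)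
  fix D :: "'k set" assume D: "club D"
  have "club {d \<in> D. b < d}" unfolding club_def
  proof (intro conjI allI impI)
    fix \<beta> obtain z where "z \<in> D" "max \<beta> b < z" using club_unbounded[OF D] by blast
    then show "\<exists>\<gamma>\<in>{d \<in> D. b < d}. \<beta> < \<gamma>" by auto
  next
    fix \<alpha> assume a: "reaches {d \<in> D. b < d} \<alpha>"
    then have "reaches D \<alpha>" unfolding reaches_def by blast
    moreover have "b < \<alpha>" using a unfolding reaches_def by fastforce
    ultimately show "\<alpha> \<in> {d \<in> D. b < d}" using club_closed[OF D] by simp
  qed
  then obtain \<delta> where d: "\<delta> \<in> Q" "guesses \<nu> \<delta> {d \<in> D. b < d}" using Q unfolding Pos_def by blast
  have "is_lim \<delta>" using d(1) Q by (auto simp: Pos_def Aset_def)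
  then obtain x where x: "x < \<delta>" by (auto simp: is_lim_def)
  obtain \<gamma> where "\<gamma> \<in> {d \<in> D. b < d}" "\<gamma> < \<delta>" by (rule guessesD[OF d(2) x])
  then have "b < \<delta>" by auto
  moreover have "guesses \<nu> \<delta> D" by (rule guesses_tail[OF d(2) x]) simp
  ultimately show "\<exists>\<delta>\<in>{\<delta> \<in> Q. b < \<delta>}. guesses \<nu> \<delta> D" using d(1) by blast
qed

lemma Pos_unbounded: assumes "Pos \<nu> Q" shows "\<exists>\<delta>\<in>Q. b < \<delta>"
proof -
  have "\<exists>\<delta>\<in>{\<delta> \<in> Q. b < \<delta>}. guesses \<nu> \<delta> {d. b < d}"
    using Pos_tail[OF assms, of b] club_above unfolding Pos_def by blast
  then show ?thesis by blast
qed

text \<open>Near a point \<open>\<delta>\<close> of \<open>Aset C\<close>, the words of a node above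
  \<open>\<delta>\<close> are a fixed word followed by the walk from \<open>\<delta>\<close>. The
  threshold is regressive and there are at most \<mu> words, so pressing down fixes both. Any
  \<open>\<nu>\<close> serves at this stage, as no colour is coded yet.\<close>

lemma stable_family:
  assumes n: "0 < n" and S: "S \<subseteq> {s. length s = n \<and> set s \<subseteq> tree_rho0 C}" "rapid n S" "S \<approx> (UNIV :: 'k set)"
  shows "\<exists>Q \<epsilon> s x. (\<exists>\<nu>. Pos \<nu> Q) \<and> (\<forall>\<delta>\<in>Q. \<epsilon> < \<delta> \<and> x \<delta> \<in> S \<and> (\<forall>k<n. \<delta> < ht (x \<delta> ! k) \<and>
    (\<forall>\<xi>. \<epsilon> < \<xi> \<and> \<xi> < \<delta> \<longrightarrow> (x \<delta> ! k) \<xi> = Some (s ! k @ rho \<xi> \<delta>))))"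
proof -
  obtain x where x: "\<And>\<delta>. x \<delta> \<in> S" "\<And>\<delta> k. k < n \<Longrightarrow> \<delta> < ht (x \<delta> ! k)"
    using rapid_unbounded[OF n S] by metis
  have xT: "x \<delta> ! k \<in> tree_rho0 C" if "k < n" for \<delta> k
    by (rule tuple_nth_mem[OF S(1) x(1) that])
  define al where "al \<delta> k = top_of (x \<delta> ! k)" for \<delta> k
  have al: "\<delta> \<le> al \<delta> k" if "k < n" for \<delta> k
    using top_of(1)[OF xT[OF that], of \<delta>] x(2)[OF that, of \<delta>] unfolding al_def by order
  have ex: "\<exists>\<epsilon><\<delta>. \<forall>k<n. \<forall>\<xi>. \<epsilon> < \<xi> \<longrightarrow> (\<xi> < \<delta> \<longrightarrow> rho \<xi> (al \<delta> k) = rho \<delta> (al \<delta> k) @ rho \<xi> \<delta>)"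
    if d: "\<delta> \<in> Aset C" for \<delta>
  proof -
    obtain x0 where x0: "x0 < \<delta>" using d by (auto simp: Aset_def is_lim_def)
    show ?thesis
    proof (rule finite_threshold[OF x0])
      fix k assume "k < n"
      from Aset_walk[OF d al[OF this]] show "\<exists>e<\<delta>. \<forall>\<xi>. e < \<xi> \<longrightarrow> (\<xi> < \<delta> \<longrightarrow> rho \<xi> (al \<delta> k) = rho \<delta> (al \<delta> k) @ rho \<xi> \<delta>)"
        by (simp add: imp_conjL)
    qed
  qed
  then obtain ep where ep: "\<And>\<delta>. \<delta> \<in> Aset C \<Longrightarrow> ep \<delta> < \<delta>"
    "\<And>\<delta> k \<xi>. \<delta> \<in> Aset C \<Longrightarrow> k < n \<Longrightarrow> ep \<delta> < \<xi> \<Longrightarrow> \<xi> < \<delta> \<Longrightarrow> rho \<xi> (al \<delta> k) = rho \<delta> (al \<delta> k) @ rho \<xi> \<delta>"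
    by metis
  define f where "f \<delta> = (ep \<delta>, map (\<lambda>k. rho \<delta> (al \<delta> k)) [0..<n])" for \<delta>
  have "\<exists>\<nu>. \<nu> < m" using infinite_m by (metis finite.emptyI lessThan_iff equals0I)
  then obtain \<nu> where \<nu>: "\<nu> < m" by blast
  have "\<exists>v. Pos \<nu> {\<delta> \<in> Aset C. f \<delta> = v}"
  proof (rule Pos_normal[OF Pos_Aset[OF \<nu>], of fst])
    fix \<delta> assume "\<delta> \<in> Aset C" then show "fst (f \<delta>) < \<delta>" by (simp add: f_def ep(1))
  next
    fix e :: 'k
    have "small ({..e} \<times> lists (lists {..m}))"
      by (intro small_Times small_lists small_atMost)
    then show "small {v \<in> f ` Aset C. fst v \<le> e}"
      by (rule small_subset) (auto simp: f_def dest: subsetD[OF rho_letters])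
  qed
  then obtain v where v: "Pos \<nu> {\<delta> \<in> Aset C. f \<delta> = v}" by blast
  define Q where "Q = {\<delta> \<in> Aset C. f \<delta> = v}"
  have "fst v < \<delta> \<and> x \<delta> \<in> S \<and> (\<forall>k<n. \<delta> < ht (x \<delta> ! k) \<and>
    (\<forall>\<xi>. fst v < \<xi> \<and> \<xi> < \<delta> \<longrightarrow> (x \<delta> ! k) \<xi> = Some (snd v ! k @ rho \<xi> \<delta>)))" if "\<delta> \<in> Q" for \<delta>
  proof -
    have d: "\<delta> \<in> Aset C" "v = f \<delta>" using that by (auto simp: Q_def)
    have "(x \<delta> ! k) \<xi> = Some (snd v ! k @ rho \<xi> \<delta>)" if k: "k < n" and xi: "fst v < \<xi>" "\<xi> < \<delta>" for k \<xi>
    proof -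
      have "\<xi> < ht (x \<delta> ! k)" using x(2)[OF k, of \<delta>] xi by order
      from top_of(2)[OF xT[OF k] this] have "(x \<delta> ! k) \<xi> = Some (rho \<xi> (al \<delta> k))" by (simp add: al_def)
      then show ?thesis using ep(2)[OF d(1) k _ xi(2)] xi(1) k by (simp add: d(2) f_def)
    qed
    moreover have "fst v < \<delta>" using ep(1)[OF d(1)] by (simp add: d(2) f_def)
    ultimately show ?thesis using x by blast
  qed
  then show ?thesis using v unfolding Q_def[symmetric] by blast
qed

text \<open>The letter \<open>i1\<close> makes the level \<open>\<psi>\<close> legible. As
  \<open>\<psi>\<close> is the predecessor of \<open>\<gamma>\<close> in some
  \<open>C \<delta>\<close>, all words strictly between them begin with \<open>s ! k @ [i1]\<close>,
  while the word at \<open>\<psi>\<close> is \<open>s ! k\<close> with one other letter, of smaller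
  rank. The label of \<open>i1\<close> is chosen outside the stem, so its first occurrence marks the
  end of the stem. Pressing down on \<open>\<gamma>\<close> fixes \<open>\<psi>\<close>,
  \<open>i1\<close> and the restrictions to \<open>\<psi>\<close>.\<close>

lemma common_stem:
  assumes n: "0 < n" and S: "S \<subseteq> {s. length s = n \<and> set s \<subseteq> tree_rho0 C}" "rapid n S" "S \<approx> (UNIV :: 'k set)"
  shows "\<exists>\<Gamma> \<psi> s i1 u X. b0 < \<psi> \<and> (\<forall>b. \<exists>\<gamma>\<in>\<Gamma>. b < \<gamma>) \<and>
    (\<forall>k<n. H i1 \<notin> H ` set (s ! k) \<and> (\<exists>i0. i0 \<noteq> i1 \<and> (u ! k) \<psi> = Some (s ! k @ [i0]))) \<and>
    (\<forall>\<gamma>\<in>\<Gamma>. X \<gamma> \<in> S \<and> (\<forall>k<n. \<gamma> < ht (X \<gamma> ! k) \<and> (X \<gamma> ! k) |` {..\<psi>} = u ! k \<and>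
      (\<forall>\<xi>. \<psi> < \<xi> \<and> \<xi> < \<gamma> \<longrightarrow> (X \<gamma> ! k) \<xi> = Some (s ! k @ i1 # rho \<xi> \<gamma>))))"
proof -
  obtain Q \<epsilon> s x \<nu> where Q: "Pos \<nu> Q" and Q': "\<And>\<delta>. \<delta> \<in> Q \<Longrightarrow> \<epsilon> < \<delta> \<and> x \<delta> \<in> S"
    "\<And>\<delta> k. \<delta> \<in> Q \<Longrightarrow> k < n \<Longrightarrow> \<delta> < ht (x \<delta> ! k)"
    "\<And>\<delta> k \<xi>. \<delta> \<in> Q \<Longrightarrow> k < n \<Longrightarrow> \<epsilon> < \<xi> \<Longrightarrow> \<xi> < \<delta> \<Longrightarrow> (x \<delta> ! k) \<xi> = Some (s ! k @ rho \<xi> \<delta>)"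
    using stable_family[OF n S] by metis
  define L where "L = (\<Union>k<n. H ` set (s ! k))"
  have "finite L" unfolding L_def by simp
  then obtain N1 where N1: "N1 \<notin> L" using ex_new_if_finite infinite_UNIV_nat by blast
  define b where "b = max b0 \<epsilon>"
  define R where "R \<gamma> \<delta> \<psi> \<longleftrightarrow> \<delta> \<in> Q \<and> \<gamma> \<in> C \<delta> \<and> H (rank_in (C \<delta>) \<gamma>) = N1 \<and> \<psi> \<in> C \<delta> \<and> b < \<psi> \<and> \<psi> < \<gamma> \<and>
    (\<forall>x\<in>C \<delta>. x < \<gamma> \<longrightarrow> x \<le> \<psi>)" for \<gamma> \<delta> \<psi>
  define G where "G = {\<gamma>. \<exists>\<delta> \<psi>. R \<gamma> \<delta> \<psi>}"
  have "\<exists>\<delta> \<psi>. R \<gamma> \<delta> \<psi>" if "\<gamma> \<in> G" for \<gamma> using that by (simp add: G_def)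
  then obtain de ps where R: "\<And>\<gamma>. \<gamma> \<in> G \<Longrightarrow> R \<gamma> (de \<gamma>) (ps \<gamma>)" by metis
  define f where "f \<gamma> = (ps \<gamma>, rank_in (C (de \<gamma>)) \<gamma>, map (\<lambda>k. (x (de \<gamma>) ! k) |` {..ps \<gamma>}) [0..<n])" for \<gamma>
  have xT: "x \<delta> ! k \<in> tree_rho0 C" if "k < n" "\<delta> \<in> Q" for \<delta> k
    using Q'(1)[OF that(2)] by (intro tuple_nth_mem[OF S(1) _ that(1)]) simp
  have "\<exists>v. \<forall>b. \<exists>\<gamma>\<in>G. b < \<gamma> \<and> f \<gamma> = v"
  proof (rule fodor_unbounded[of G fst])
    \<comment> \<open>\<open>G\<close> is stationary: a guessing \<open>\<delta>\<close> has points
      of label \<open>N1\<close> in the club above any element \<open>c > b\<close> of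
      \<open>C \<delta>\<close>, and the predecessor of such a point is at least
      \<open>c\<close>.\<close>
    fix D :: "'k set" assume "club D"
    from Pos_tail[OF Q, of b] this have "\<exists>\<delta>\<in>{\<delta> \<in> Q. b < \<delta>}. guesses \<nu> \<delta> D" by (simp only: Pos_def simp_thms)
    then obtain \<delta> where d: "\<delta> \<in> Q" "b < \<delta>" "guesses \<nu> \<delta> D" by blast
    have "is_lim \<delta>" using d(1) Q by (auto simp: Pos_def Aset_def)
    from reachesD[OF reaches_C_limit[OF this] d(2)] obtain c where c: "c \<in> C \<delta>" "b < c" "c < \<delta>" by blast
    obtain \<gamma> where g: "\<gamma> \<in> nacc (C \<delta>)" "\<gamma> \<in> D" "H (rank_in (C \<delta>) \<gamma>) = N1" "c < \<gamma>" "\<gamma> < \<delta>"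
      by (rule guessesD[OF d(3) c(3)])
    from nacc_pred[OF g(1) c(1) g(4)] obtain \<psi> where p: "\<psi> \<in> C \<delta>" "c \<le> \<psi>" "\<psi> < \<gamma>"
      "\<forall>x\<in>C \<delta>. x < \<gamma> \<longrightarrow> x \<le> \<psi>" by blast
    have "b < \<psi>" using c(2) p(2) by order
    then have "R \<gamma> \<delta> \<psi>" using d(1) g p by (simp add: R_def nacc_def)
    then have "\<gamma> \<in> G" by (auto simp: G_def)
    then show "\<exists>\<gamma>\<in>G. \<gamma> \<in> D" using g(2) by blast
  next
    fix \<gamma> assume "\<gamma> \<in> G" then show "fst (f \<gamma>) < \<gamma>" using R[of \<gamma>] by (simp add: f_def R_def)
  next
    fix e :: 'k
    have "small (\<Union>\<psi>\<in>{..e}. {\<psi>} \<times> {..m} \<times> lists (range (\<lambda>\<alpha>. level_node \<alpha> \<psi>)))"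
      by (intro small_UN small_Times small_lists small_atMost small_level small_finite) simp
    moreover have "{v \<in> f ` G. fst v \<le> e} \<subseteq> (\<Union>\<psi>\<in>{..e}. {\<psi>} \<times> {..m} \<times> lists (range (\<lambda>\<alpha>. level_node \<alpha> \<psi>)))"
    proof
      fix v assume "v \<in> {v \<in> f ` G. fst v \<le> e}"
      then obtain \<gamma> where g: "\<gamma> \<in> G" "v = f \<gamma>" "ps \<gamma> \<le> e" by (auto simp: f_def)
      have r: "R \<gamma> (de \<gamma>) (ps \<gamma>)" by (rule R[OF g(1)])
      have "(x (de \<gamma>) ! k) |` {..ps \<gamma>} \<in> range (\<lambda>\<alpha>. level_node \<alpha> (ps \<gamma>))" if k: "k < n" for k
      proof (rule restrict_tree_node)
        have dq: "de \<gamma> \<in> Q" "ps \<gamma> < de \<gamma>" using r C_subset by (auto simp: R_def)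
        show "x (de \<gamma>) ! k \<in> tree_rho0 C" by (rule xT[OF k dq(1)])
        show "ps \<gamma> < ht (x (de \<gamma>) ! k)" using Q'(2)[OF dq(1) k] dq(2) by order
      qed
      then show "v \<in> (\<Union>\<psi>\<in>{..e}. {\<psi>} \<times> {..m} \<times> lists (range (\<lambda>\<alpha>. level_node \<alpha> \<psi>)))"
        using g rank_in_C_le by (intro UN_I[of "ps \<gamma>"]) (auto simp: f_def in_lists_conv_set)
    qed
    ultimately show "small {v \<in> f ` G. fst v \<le> e}" by (rule small_subset)
  qed
  then obtain v where v: "\<And>b. \<exists>\<gamma>\<in>G. b < \<gamma> \<and> f \<gamma> = v" by blast
  obtain \<psi> i1 u where v': "v = (\<psi>, i1, u)" by (cases v)
  define \<Gamma> where "\<Gamma> = {\<gamma> \<in> G. f \<gamma> = v}"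
  have unb: "\<forall>b. \<exists>\<gamma>\<in>\<Gamma>. b < \<gamma>" unfolding \<Gamma>_def using v by blast
  have gam: "R \<gamma> (de \<gamma>) \<psi>" "rank_in (C (de \<gamma>)) \<gamma> = i1" "\<And>k. k < n \<Longrightarrow> (x (de \<gamma>) ! k) |` {..\<psi>} = u ! k"
    if "\<gamma> \<in> \<Gamma>" for \<gamma>
  proof -
    have g: "\<gamma> \<in> G" "f \<gamma> = (\<psi>, i1, u)" using that v' by (auto simp: \<Gamma>_def)
    then have e: "ps \<gamma> = \<psi>" "rank_in (C (de \<gamma>)) \<gamma> = i1" "map (\<lambda>k. (x (de \<gamma>) ! k) |` {..\<psi>}) [0..<n] = u"
      by (auto simp: f_def)
    show "R \<gamma> (de \<gamma>) \<psi>" using R[OF g(1)] e by simp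
    show "rank_in (C (de \<gamma>)) \<gamma> = i1" by (rule e(2))
    show "(x (de \<gamma>) ! k) |` {..\<psi>} = u ! k" if "k < n" for k using that by (simp add: e(3)[symmetric])
  qed
  obtain \<gamma>0 where g0: "\<gamma>0 \<in> \<Gamma>" using unb by blast
  note R0 = gam(1)[OF g0, unfolded R_def]
  have bp: "b < \<psi>" using R0 by simp
  have stem: "H i1 \<notin> H ` set (s ! k) \<and> (\<exists>i0. i0 \<noteq> i1 \<and> (u ! k) \<psi> = Some (s ! k @ [i0]))" if k: "k < n" for k
  proof
    have "H i1 = N1" using R0 gam(2)[OF g0] by auto
    then show "H i1 \<notin> H ` set (s ! k)" using N1 k by (auto simp: L_def)
    have pd: "\<psi> < de \<gamma>0" using R0 C_subset by auto
    have ep: "\<epsilon> < \<psi>" using bp by (simp add: b_def)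
    have "rho \<psi> (de \<gamma>0) = rank_in (C (de \<gamma>0)) \<psi> # rho \<psi> \<psi>"
    proof (rule rho_step[OF ep pd, THEN trans])
      have "walk_step \<psi> (de \<gamma>0) = \<psi>" unfolding walk_step_def using R0 by (intro Least_equality) auto
      then show "rank_in (C (de \<gamma>0)) \<psi> # rho \<psi> (walk_step \<psi> (de \<gamma>0)) = rank_in (C (de \<gamma>0)) \<psi> # rho \<psi> \<psi>" by simp
    qed
    then have "(x (de \<gamma>0) ! k) \<psi> = Some (s ! k @ [rank_in (C (de \<gamma>0)) \<psi>])"
      using Q'(3)[OF _ k ep pd] R0 by simp
    moreover have "(u ! k) \<psi> = (x (de \<gamma>0) ! k) \<psi>" using gam(3)[OF g0 k, symmetric] by simp
    moreover have "rank_in (C (de \<gamma>0)) \<psi> < i1" unfolding gam(2)[OF g0, symmetric] using R0 by (intro rank_in_less) auto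
    ultimately show "\<exists>i0. i0 \<noteq> i1 \<and> (u ! k) \<psi> = Some (s ! k @ [i0])" by (metis less_irrefl)
  qed
  have fam: "x (de \<gamma>) \<in> S \<and> (\<forall>k<n. \<gamma> < ht (x (de \<gamma>) ! k) \<and> (x (de \<gamma>) ! k) |` {..\<psi>} = u ! k \<and>
      (\<forall>\<xi>. \<psi> < \<xi> \<and> \<xi> < \<gamma> \<longrightarrow> (x (de \<gamma>) ! k) \<xi> = Some (s ! k @ i1 # rho \<xi> \<gamma>)))" if g: "\<gamma> \<in> \<Gamma>" for \<gamma>
  proof (intro conjI allI impI)
    note Rg = gam(1)[OF g, unfolded R_def]
    have dq: "de \<gamma> \<in> Q" "\<gamma> \<in> C (de \<gamma>)" using Rg by auto
    have gd: "\<gamma> < de \<gamma>" by (rule C_subset[OF dq(2)])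
    show "x (de \<gamma>) \<in> S" using Q'(1)[OF dq(1)] by simp
    fix k assume k: "k < n"
    show "\<gamma> < ht (x (de \<gamma>) ! k)" using Q'(2)[OF dq(1) k] gd by order
    show "(x (de \<gamma>) ! k) |` {..\<psi>} = u ! k" by (rule gam(3)[OF g k])
    fix \<xi> assume xi: "\<psi> < \<xi> \<and> \<xi> < \<gamma>"
    have "rho \<xi> (de \<gamma>) = rank_in (C (de \<gamma>)) \<gamma> # rho \<xi> \<gamma>"
      using Rg xi by (intro rho_gap[of _ _ \<psi>]) auto
    moreover have "\<epsilon> < \<xi>" "\<xi> < de \<gamma>" using xi bp gd by (auto simp: b_def)
    ultimately show "(x (de \<gamma>) ! k) \<xi> = Some (s ! k @ i1 # rho \<xi> \<gamma>)"
      using Q'(3)[OF dq(1) k] gam(2)[OF g] by simp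
  qed
  have "b0 < \<psi>" using bp by (simp add: b_def)
  show ?thesis
    by (rule exI[of _ \<Gamma>], rule exI[of _ \<psi>], rule exI[of _ s], rule exI[of _ i1], rule exI[of _ u],
        rule exI[of _ "\<lambda>\<gamma>. x (de \<gamma>)"], rule conjI[OF \<open>b0 < \<psi>\<close> conjI[OF unb conjI]],
        rule allI, rule impI, erule stem, rule ballI, erule fam)
qed

text \<open>Climbing from \<open>\<delta>\<close> to a larger \<open>t \<delta>\<close> costs a
  constant word \<open>e\<close> on a positive set. It is nonempty because
  \<open>\<delta> < t \<delta>\<close>, which is what makes the words of the ladder grow
  strictly.\<close>

lemma uniform_walk:
  assumes Q: "Pos \<nu> Q" and a: "\<forall>\<delta>\<in>Q. a < \<delta>" and t: "\<And>\<delta>. \<delta> < t \<delta>"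
  shows "\<exists>Q' a' e. Q' \<subseteq> Q \<and> Pos \<nu> Q' \<and> a \<le> a' \<and> e \<noteq> [] \<and>
    (\<forall>\<delta>\<in>Q'. a' < \<delta> \<and> (\<forall>\<xi>. a' < \<xi> \<and> \<xi> < \<delta> \<longrightarrow> rho \<xi> (t \<delta>) = e @ rho \<xi> \<delta>))"
proof -
  have A: "\<delta> \<in> Aset C" if "\<delta> \<in> Q" for \<delta> using Q that by (auto simp: Pos_def)
  have "\<forall>\<delta>\<in>Q. \<exists>\<epsilon><\<delta>. \<forall>\<xi>. \<epsilon> < \<xi> \<and> \<xi> < \<delta> \<longrightarrow> rho \<xi> (t \<delta>) = rho \<delta> (t \<delta>) @ rho \<xi> \<delta>"
    using Aset_walk[OF A] t less_imp_le by metis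
  then obtain ep where ep: "\<And>\<delta>. \<delta> \<in> Q \<Longrightarrow> ep \<delta> < \<delta>"
    "\<And>\<delta> \<xi>. \<delta> \<in> Q \<Longrightarrow> ep \<delta> < \<xi> \<Longrightarrow> \<xi> < \<delta> \<Longrightarrow> rho \<xi> (t \<delta>) = rho \<delta> (t \<delta>) @ rho \<xi> \<delta>" by metis
  define f where "f \<delta> = (max a (ep \<delta>), rho \<delta> (t \<delta>))" for \<delta>
  have "\<exists>v. Pos \<nu> {\<delta> \<in> Q. f \<delta> = v}"
  proof (rule Pos_normal[OF Q, of fst])
    fix \<delta> assume "\<delta> \<in> Q" then show "fst (f \<delta>) < \<delta>" using ep(1) a by (simp add: f_def)
  next
    fix e :: 'k
    have "small ({..e} \<times> lists {..m})" by (intro small_Times small_lists small_atMost)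
    then show "small {v \<in> f ` Q. fst v \<le> e}"
      by (rule small_subset) (auto simp: f_def dest: subsetD[OF rho_letters])
  qed
  then obtain a' e where v: "Pos \<nu> {\<delta> \<in> Q. f \<delta> = (a', e)}" by auto
  have *: "a \<le> a' \<and> e \<noteq> [] \<and> a' < \<delta> \<and> (\<forall>\<xi>. a' < \<xi> \<and> \<xi> < \<delta> \<longrightarrow> rho \<xi> (t \<delta>) = e @ rho \<xi> \<delta>)"
    if "\<delta> \<in> Q" "f \<delta> = (a', e)" for \<delta>
  proof -
    have e: "a' = max a (ep \<delta>)" "e = rho \<delta> (t \<delta>)" using that(2) by (auto simp: f_def)
    have "e \<noteq> []" using rho_step[OF a[rule_format, OF that(1)] t] e(2) by simp
    then show ?thesis using ep[OF that(1)] a[rule_format, OF that(1)] e by auto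
  qed
  obtain \<delta>0 where "\<delta>0 \<in> Q" "f \<delta>0 = (a', e)" using Pos_unbounded[OF v] by blast
  from *[OF this] have "a \<le> a' \<and> e \<noteq> []" by simp
  then show ?thesis using v * by (intro exI[of _ "{\<delta> \<in> Q. f \<delta> = (a', e)}"] exI[of _ a'] exI[of _ e]) auto
qed

text \<open>The new entry climbs from \<open>\<delta>\<close> to some \<open>t \<delta>\<close> in
  the old positive set and uses the last old entry there, so its word is \<open>y j @ e\<close>. In
  this way the words form a prefix chain although all walks start in
  \<open>\<Gamma>\<close>.\<close>

lemma ladder:
  assumes \<nu>: "\<nu> < m" and \<Gamma>: "\<And>b. \<exists>\<gamma>\<in>\<Gamma>. b < \<gamma>"
  shows "\<exists>Q a y \<beta>. Pos \<nu> Q \<and> \<psi> \<le> a \<and> (\<forall>i<j. \<exists>e. e \<noteq> [] \<and> y (Suc i) = y i @ e) \<and>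
    (\<forall>\<delta>\<in>Q. a < \<delta> \<and> (\<forall>i\<le>j. \<delta> < \<beta> i \<delta> \<and> \<beta> i \<delta> \<in> \<Gamma> \<and>
      (\<forall>\<xi>. a < \<xi> \<and> \<xi> < \<delta> \<longrightarrow> rho \<xi> (\<beta> i \<delta>) = y i @ rho \<xi> \<delta>)))"
proof (induction j)
  case 0
  obtain t where t: "\<And>\<delta>. t \<delta> \<in> \<Gamma>" "\<And>\<delta>. \<delta> < t \<delta>" using \<Gamma> by metis
  have gt: "\<forall>\<delta>\<in>{\<delta> \<in> Aset C. \<psi> < \<delta>}. \<psi> < \<delta>" by simp
  obtain Q a e where "Pos \<nu> Q" "\<psi> \<le> a"
    "\<forall>\<delta>\<in>Q. a < \<delta> \<and> (\<forall>\<xi>. a < \<xi> \<and> \<xi> < \<delta> \<longrightarrow> rho \<xi> (t \<delta>) = e @ rho \<xi> \<delta>)"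
    using uniform_walk[OF Pos_tail[OF Pos_Aset[OF \<nu>], of \<psi>] gt t(2)]
    by (elim exE conjE)
  then show ?case using t by (intro exI[of _ Q] exI[of _ a] exI[of _ "\<lambda>_. e"] exI[of _ "\<lambda>_. t"]) simp
next
  case (Suc j)
  then obtain Q a y \<beta> where L: "Pos \<nu> Q" "\<psi> \<le> a" "\<forall>i<j. \<exists>e. e \<noteq> [] \<and> y (Suc i) = y i @ e"
    "\<forall>\<delta>\<in>Q. a < \<delta> \<and> (\<forall>i\<le>j. \<delta> < \<beta> i \<delta> \<and> \<beta> i \<delta> \<in> \<Gamma> \<and>
      (\<forall>\<xi>. a < \<xi> \<and> \<xi> < \<delta> \<longrightarrow> rho \<xi> (\<beta> i \<delta>) = y i @ rho \<xi> \<delta>))" by (elim exE conjE)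
  have IH: "\<And>\<delta>. \<delta> \<in> Q \<Longrightarrow> a < \<delta>" "\<And>\<delta> i. \<delta> \<in> Q \<Longrightarrow> i \<le> j \<Longrightarrow> \<delta> < \<beta> i \<delta> \<and> \<beta> i \<delta> \<in> \<Gamma>"
    "\<And>\<delta> i \<xi>. \<delta> \<in> Q \<Longrightarrow> i \<le> j \<Longrightarrow> a < \<xi> \<Longrightarrow> \<xi> < \<delta> \<Longrightarrow> rho \<xi> (\<beta> i \<delta>) = y i @ rho \<xi> \<delta>"
    using L(4) by simp_all
  note IH = L(1-3) IH
  obtain t where t: "\<And>\<delta>. t \<delta> \<in> Q" "\<And>\<delta>. \<delta> < t \<delta>" using Pos_unbounded[OF IH(1)] by metis
  have Q_gt: "\<forall>\<delta>\<in>Q. a < \<delta>" using IH(4) by simp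
  obtain Q' a' e where U: "Q' \<subseteq> Q" "Pos \<nu> Q'" "a \<le> a'" "e \<noteq> []"
    "\<forall>\<delta>\<in>Q'. a' < \<delta> \<and> (\<forall>\<xi>. a' < \<xi> \<and> \<xi> < \<delta> \<longrightarrow> rho \<xi> (t \<delta>) = e @ rho \<xi> \<delta>)"
    using uniform_walk[OF IH(1) Q_gt t(2)] by (elim exE conjE)
  have Q': "\<And>\<delta>. \<delta> \<in> Q' \<Longrightarrow> a' < \<delta>"
    "\<And>\<delta> \<xi>. \<delta> \<in> Q' \<Longrightarrow> a' < \<xi> \<Longrightarrow> \<xi> < \<delta> \<Longrightarrow> rho \<xi> (t \<delta>) = e @ rho \<xi> \<delta>" using U(5) by simp_all
  note Q' = U(1-4) Q'
  define y' where "y' = y(Suc j := y j @ e)"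
  define \<beta>' where "\<beta>' = \<beta>(Suc j := (\<lambda>\<delta>. \<beta> j (t \<delta>)))"
  have "\<psi> \<le> a'" using IH(2) Q'(3) by order
  moreover have "\<forall>i<Suc j. \<exists>e. e \<noteq> [] \<and> y' (Suc i) = y' i @ e"
    using IH(3) Q'(4) by (auto simp: y'_def less_Suc_eq)
  moreover have "\<delta> < \<beta>' i \<delta> \<and> \<beta>' i \<delta> \<in> \<Gamma> \<and> (\<forall>\<xi>. a' < \<xi> \<and> \<xi> < \<delta> \<longrightarrow> rho \<xi> (\<beta>' i \<delta>) = y' i @ rho \<xi> \<delta>)"
    if d: "\<delta> \<in> Q'" and i: "i \<le> Suc j" for \<delta> i
  proof (cases "i = Suc j")
    case True
    have b: "t \<delta> < \<beta> j (t \<delta>)" "\<beta> j (t \<delta>) \<in> \<Gamma>" using IH(5)[OF t(1)] by auto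
    have "rho \<xi> (\<beta> j (t \<delta>)) = (y j @ e) @ rho \<xi> \<delta>" if xi: "a' < \<xi>" "\<xi> < \<delta>" for \<xi>
    proof -
      have "a < \<xi>" using Q'(3) xi(1) by order
      moreover have "\<xi> < t \<delta>" using xi(2) t(2)[of \<delta>] by order
      ultimately have "rho \<xi> (\<beta> j (t \<delta>)) = y j @ rho \<xi> (t \<delta>)" by (intro IH(6)[OF t(1)]) auto
      then show ?thesis using Q'(6)[OF d xi] by simp
    qed
    moreover have "\<delta> < \<beta> j (t \<delta>)" using b(1) t(2)[of \<delta>] by order
    ultimately show ?thesis using True b(2) by (simp add: y'_def \<beta>'_def)
  next
    case False
    then have i: "i \<le> j" using i by simp
    have dQ: "\<delta> \<in> Q" using d Q'(1) by blast
    have "rho \<xi> (\<beta> i \<delta>) = y i @ rho \<xi> \<delta>" if xi: "a' < \<xi>" "\<xi> < \<delta>" for \<xi>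
    proof -
      have "a < \<xi>" using Q'(3) xi(1) by order
      then show ?thesis using IH(6)[OF dQ i] xi(2) by simp
    qed
    then show ?thesis using IH(5)[OF dQ i] i by (simp add: y'_def \<beta>'_def)
  qed
  ultimately show ?case using Q'(2,5)
    by (intro exI[of _ Q'] exI[of _ a'] exI[of _ y'] exI[of _ \<beta>']) simp
qed

text \<open>Up to the threshold \<open>a\<close> the decomposition of words says nothing, so the
  walks there are fixed by one more pressing down. The rank is constantly \<open>a\<close>, as there
  are at most \<mu> possible values in all.\<close>

lemma ladder_uniform:
  assumes \<nu>: "\<nu> < m" and \<Gamma>: "\<And>b. \<exists>\<gamma>\<in>\<Gamma>. b < \<gamma>"
  shows "\<exists>Q a y \<beta>. Pos \<nu> Q \<and> \<psi> \<le> a \<and> (\<forall>i<j. \<exists>e. e \<noteq> [] \<and> y (Suc i) = y i @ e) \<and>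
    (\<forall>\<delta>\<in>Q. a < \<delta> \<and> (\<forall>i\<le>j. \<delta> < \<beta> i \<delta> \<and> \<beta> i \<delta> \<in> \<Gamma> \<and>
      (\<forall>\<xi>. a < \<xi> \<and> \<xi> < \<delta> \<longrightarrow> rho \<xi> (\<beta> i \<delta>) = y i @ rho \<xi> \<delta>))) \<and>
    (\<forall>\<delta>\<in>Q. \<forall>\<delta>'\<in>Q. \<forall>i\<le>j. \<forall>\<xi>\<le>a. rho \<xi> (\<beta> i \<delta>) = rho \<xi> (\<beta> i \<delta>'))"
proof -
  obtain Q a y \<beta> where L: "Pos \<nu> Q" "\<psi> \<le> a" "\<forall>i<j. \<exists>e. e \<noteq> [] \<and> y (Suc i) = y i @ e"
    "\<forall>\<delta>\<in>Q. a < \<delta> \<and> (\<forall>i\<le>j. \<delta> < \<beta> i \<delta> \<and> \<beta> i \<delta> \<in> \<Gamma> \<and>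
      (\<forall>\<xi>. a < \<xi> \<and> \<xi> < \<delta> \<longrightarrow> rho \<xi> (\<beta> i \<delta>) = y i @ rho \<xi> \<delta>))"
    using ladder[OF \<nu> \<Gamma>, of \<psi> j] by (elim exE conjE)
  define f where "f \<delta> = map (\<lambda>i. level_node (\<beta> i \<delta>) a) [0..<Suc j]" for \<delta>
  have "\<exists>v. Pos \<nu> {\<delta> \<in> Q. f \<delta> = v}"
  proof (rule Pos_normal[OF L(1), of "\<lambda>_. a"])
    fix \<delta> assume "\<delta> \<in> Q" then show "a < \<delta>" using L(4) by blast
  next
    fix e :: 'k
    have "small (lists (range (\<lambda>\<alpha>. level_node \<alpha> a)))" by (intro small_lists small_level)
    then show "small {v \<in> f ` Q. a \<le> e}" by (rule small_subset) (auto simp: f_def simp del: upt_Suc)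
  qed
  then obtain v where v: "Pos \<nu> {\<delta> \<in> Q. f \<delta> = v}" by blast
  have eq: "rho \<xi> (\<beta> i \<delta>) = rho \<xi> (\<beta> i \<delta>')" if "f \<delta> = v" "f \<delta>' = v" "i \<le> j" "\<xi> \<le> a" for \<delta> \<delta>' i \<xi>
  proof -
    have "f \<delta> ! i = f \<delta>' ! i" using that by simp
    then have "level_node (\<beta> i \<delta>) a = level_node (\<beta> i \<delta>') a" using that(3) by (simp add: f_def less_Suc_eq_le del: upt_Suc)
    then have "level_node (\<beta> i \<delta>) a \<xi> = level_node (\<beta> i \<delta>') a \<xi>" by simp
    then show ?thesis using that(4) by (simp add: level_node_def)
  qed
  show ?thesis
    by (rule exI[of _ "{\<delta> \<in> Q. f \<delta> = v}"], rule exI[of _ a], rule exI[of _ y], rule exI[of _ \<beta>])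
      (use v L eq in simp)
qed

lemma ladder_strict_prefix:
  assumes "\<forall>i<j. \<exists>e. e \<noteq> [] \<and> y (Suc i) = y i @ e" "k \<le> j" "i < k"
  shows "strict_prefix (y i) (y k)"
  using assms(2,3)
proof (induction k)
  case (Suc k)
  obtain e where e: "e \<noteq> []" "y (Suc k) = y k @ e" using assms(1)[rule_format, of k] Suc.prems by auto
  then have "strict_prefix (y k) (y (Suc k))" by (simp add: strict_prefix_def)
  then show ?case using Suc by (cases "i = k") auto
qed simp

text \<open>Along a branch, two members \<open>\<delta> < \<delta>'\<close> of a positive set would
  give the words \<open>e @ rho \<xi> \<delta>\<close> and \<open>e @ rho \<xi> \<delta>'\<close> at
  the same \<open>\<xi>\<close>; but the walk from \<open>\<delta>'\<close> passes through
  \<open>\<delta>\<close>, so the second is longer.\<close>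

lemma no_cofinal_branch: "\<not> (\<forall>b. \<exists>\<alpha>>b. \<forall>\<xi>\<le>b. f \<xi> = rho \<xi> \<alpha>)"
proof
  assume br: "\<forall>b. \<exists>\<alpha>>b. \<forall>\<xi>\<le>b. f \<xi> = rho \<xi> \<alpha>"
  have "\<exists>\<nu>. \<nu> < m" using infinite_m by (metis finite.emptyI lessThan_iff equals0I)
  then obtain \<nu> where \<nu>: "\<nu> < m" by blast
  obtain t where t: "\<And>b. b < t b" "\<And>b \<xi>. \<xi> \<le> b \<Longrightarrow> f \<xi> = rho \<xi> (t b)" using br by metis
  obtain x0 :: 'k where True by simp
  have gt: "\<forall>\<delta>\<in>{\<delta> \<in> Aset C. x0 < \<delta>}. x0 < \<delta>" by simp
  obtain Q a e where Q: "Pos \<nu> Q" "Q \<subseteq> {\<delta> \<in> Aset C. x0 < \<delta>}"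
    "\<forall>\<delta>\<in>Q. a < \<delta> \<and> (\<forall>\<xi>. a < \<xi> \<and> \<xi> < \<delta> \<longrightarrow> rho \<xi> (t \<delta>) = e @ rho \<xi> \<delta>)"
    using uniform_walk[OF Pos_tail[OF Pos_Aset[OF \<nu>], of x0] gt t(1)] by (elim exE conjE)
  obtain \<delta> where d: "\<delta> \<in> Q" "a < \<delta>" using Pos_unbounded[OF Q(1), of a] by blast
  obtain \<delta>' where d': "\<delta>' \<in> Q" "\<delta> < \<delta>'" using Pos_unbounded[OF Q(1), of \<delta>] by blast
  have dA: "\<delta> \<in> Aset C" using d(1) Q(2) by blast
  obtain ep where ep: "ep < \<delta>" "\<forall>\<xi>. ep < \<xi> \<and> \<xi> < \<delta> \<longrightarrow> rho \<xi> \<delta>' = rho \<delta> \<delta>' @ rho \<xi> \<delta>"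
    using Aset_walk[OF dA less_imp_le[OF d'(2)]] by blast
  have "max a ep < \<delta>" using d(2) ep(1) by simp
  then obtain \<xi> where xi: "max a ep < \<xi>" "\<xi> < \<delta>" using dA unfolding Aset_def is_lim_def by blast
  have "f \<xi> = e @ rho \<xi> \<delta>" using Q(3) d(1) xi t(2)[of \<xi> \<delta>] by simp
  moreover have "f \<xi> = e @ rho \<xi> \<delta>'" using Q(3) d' xi t(2)[of \<xi> \<delta>'] by simp
  moreover have "rho \<xi> \<delta>' = rho \<delta> \<delta>' @ rho \<xi> \<delta>" using ep(2) xi by simp
  moreover have "rho \<delta> \<delta>' \<noteq> []" using rho_step[OF d(2) d'(2)] by simp
  ultimately show False by simp
qed

section \<open>Nodes with extensions of unbounded height\<close>

definition big :: "'k node set \<Rightarrow> 'k \<Rightarrow> 'k node \<Rightarrow> bool" where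
  "big P a v \<longleftrightarrow> (\<forall>b. \<exists>t\<in>P. b < ht t \<and> t |` {..a} = v)"

lemma big_above: assumes "big P a v" shows "\<exists>t\<in>P. a < ht t \<and> b < ht t \<and> t |` {..a} = v"
proof -
  obtain t where "t \<in> P" "max a b < ht t" "t |` {..a} = v" using assms unfolding big_def by blast
  then show ?thesis by auto
qed

lemma ex_big:
  assumes P: "P \<subseteq> tree_rho0 C" "\<And>b. \<exists>t\<in>P. b < ht t"
  shows "\<exists>v. big P a v"
proof (rule ccontr)
  assume "\<not> ?thesis"
  then have "\<forall>v. \<exists>b. \<forall>t\<in>P. b < ht t \<longrightarrow> t |` {..a} \<noteq> v" unfolding big_def by meson
  then obtain b where b: "\<And>v t. t \<in> P \<Longrightarrow> b v < ht t \<Longrightarrow> t |` {..a} \<noteq> v" by metis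
  have "small (b ` range (\<lambda>\<alpha>. level_node \<alpha> a))" by (intro small_image small_level)
  from small_bounded[OF this] obtain c where c: "\<forall>x\<in>b ` range (\<lambda>\<alpha>. level_node \<alpha> a). x < c" by (rule exE)
  obtain t where t: "t \<in> P" "max a c < ht t" using P(2) by blast
  have "t |` {..a} \<in> range (\<lambda>\<alpha>. level_node \<alpha> a)" using t P(1) by (intro restrict_tree_node) auto
  then have "b (t |` {..a}) < c" using c by blast
  then have "b (t |` {..a}) < ht t" using t(2) by auto
  from b[OF t(1) this] show False by simp
qed

lemma big_restrict:
  assumes "big P b v" "a \<le> b" shows "big P a (v |` {..a})"
  unfolding big_def
proof
  fix c
  obtain t where t: "t \<in> P" "c < ht t" "t |` {..b} = v" using assms(1) unfolding big_def by blast
  have "t |` {..a} = v |` {..a}" unfolding t(3)[symmetric] by (rule restrict_restrict_atMost[OF assms(2), symmetric])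
  then show "\<exists>t\<in>P. c < ht t \<and> t |` {..a} = v |` {..a}" using t by blast
qed

lemma big_extend:
  assumes P: "P \<subseteq> tree_rho0 C" and v: "big P a v" and ab: "a \<le> b"
  shows "\<exists>w. big P b w \<and> w |` {..a} = v"
proof -
  define R where "R = {t \<in> P. t |` {..a} = v}"
  have "\<exists>t\<in>R. c < ht t" for c using v unfolding big_def R_def by blast
  moreover have "R \<subseteq> tree_rho0 C" using P by (auto simp: R_def)
  ultimately obtain w where w: "big R b w" using ex_big[of R b] by blast
  have "big P b w" using w unfolding big_def R_def by blast
  moreover have "w |` {..a} = v"
  proof -
    obtain t where t: "t \<in> R" "t |` {..b} = w" using w unfolding big_def by blast
    have "w |` {..a} = t |` {..a}" unfolding t(2)[symmetric] by (rule restrict_restrict_atMost[OF ab])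
    then show ?thesis using t(1) by (simp add: R_def)
  qed
  ultimately show ?thesis by blast
qed

text \<open>Without a split, the big extensions of \<open>v\<close> would be unique at every level,
  hence coherent, and would form a cofinal branch.\<close>

lemma big_split:
  assumes P: "P \<subseteq> tree_rho0 C" and v: "big P a v"
  shows "\<exists>b\<ge>a. \<exists>w w'. w \<noteq> w' \<and> big P b w \<and> big P b w' \<and> w |` {..a} = v \<and> w' |` {..a} = v"
proof (rule ccontr)
  assume no: "\<not> ?thesis"
  have uniq: "w = w'" if "a \<le> b" "big P b w" "big P b w'" "w |` {..a} = v" "w' |` {..a} = v" for b w w'
    using no that by blast
  obtain e where e: "\<And>b. a \<le> b \<Longrightarrow> big P b (e b) \<and> e b |` {..a} = v"
    using big_extend[OF P v] by metis
  have coh: "e c |` {..b} = e b" if "a \<le> b" "b \<le> c" for b c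
  proof (rule uniq[OF that(1)])
    have ac: "a \<le> c" using that by order
    show "big P b (e c |` {..b})" using big_restrict[OF _ that(2)] e[OF ac] by blast
    have "(e c |` {..b}) |` {..a} = e c |` {..a}" by (rule restrict_restrict_atMost[OF that(1)])
    then show "(e c |` {..b}) |` {..a} = v" using e[OF ac] by simp
  qed (use e[OF that(1)] in auto)
  define f where "f \<xi> = the (e (max a \<xi>) \<xi>)" for \<xi>
  have "\<exists>\<alpha>>b. \<forall>\<xi>\<le>b. f \<xi> = rho \<xi> \<alpha>" for b
  proof -
    define c where "c = max a b"
    have "big P c (e c)" using e[of c] by (simp add: c_def)
    from big_above[OF this, of c] obtain t where t: "t \<in> P" "c < ht t" "t |` {..c} = e c" by blast
    have tT: "t \<in> tree_rho0 C" using t(1) P by blast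
    have "f \<xi> = rho \<xi> (top_of t)" if "\<xi> \<le> b" for \<xi>
    proof -
      have le: "\<xi> \<le> c" "max a \<xi> \<le> c" using that by (auto simp: c_def le_max_iff_disj)
      have "e (max a \<xi>) \<xi> = (e c |` {..max a \<xi>}) \<xi>" using coh[of "max a \<xi>" c] le(2) by simp
      also have "\<dots> = (t |` {..c}) \<xi>" using t(3) by simp
      also have "\<dots> = t \<xi>" using le(1) by simp
      also have "\<dots> = Some (rho \<xi> (top_of t))" by (rule top_of(2)[OF tT]) (use le(1) t(2) in order)
      finally show ?thesis by (simp add: f_def)
    qed
    moreover have "b < top_of t" using top_of(1)[OF tT] t(2) unfolding c_def by auto
    ultimately show ?thesis by blast
  qed
  then show False using no_cofinal_branch[of f] by blast
qed

text \<open>Splitting one big node and extending the others to the same level raises their number by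
  one.\<close>

lemma many_big:
  assumes P: "P \<subseteq> tree_rho0 C" "\<And>b. \<exists>t\<in>P. b < ht t"
  shows "\<exists>a V. finite V \<and> card V = Suc N \<and> (\<forall>v\<in>V. big P a v)"
proof (induction N)
  case 0
  obtain x0 :: 'k where True by simp
  obtain v where "big P x0 v" using ex_big[OF P, of x0] by blast
  then show ?case by (intro exI[of _ x0] exI[of _ "{v}"]) simp
next
  case (Suc N)
  then obtain a V where V: "finite V" "card V = Suc N" "\<forall>v\<in>V. big P a v" by blast
  then obtain v0 where v0: "v0 \<in> V" by fastforce
  obtain b w w' where w: "a \<le> b" "w \<noteq> w'" "big P b w" "big P b w'" "w |` {..a} = v0" "w' |` {..a} = v0"
    using big_split[OF P(1)] V(3) v0 by blast
  have "\<forall>v\<in>V. \<exists>z. big P b z \<and> z |` {..a} = v" using big_extend[OF P(1) _ w(1)] V(3) by blast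
  then obtain x where x: "\<And>v. v \<in> V \<Longrightarrow> big P b (x v) \<and> x v |` {..a} = v" by metis
  define W where "W = x ` (V - {v0})"
  have inj: "inj_on x (V - {v0})" by (rule inj_onI) (metis DiffD1 x)
  have fin: "finite W" using V(1) by (simp add: W_def)
  have card: "card W = N" unfolding W_def using card_image[OF inj] V(1,2) v0 by simp
  have r: "z |` {..a} \<noteq> v0" if "z \<in> W" for z using that x by (auto simp: W_def)
  have "w \<notin> W" "w' \<notin> W" using r w(5,6) by blast+
  then have "card (insert w (insert w' W)) = Suc (Suc N)" using fin card w(2) by simp
  moreover have "big P b z" if "z \<in> insert w (insert w' W)" for z using that w x by (auto simp: W_def)
  ultimately show ?case using fin by (intro exI[of _ b] exI[of _ "insert w (insert w' W)"]) auto
qed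

text \<open>The coordinates pass through \<open>n\<close> different big nodes at level
  \<open>a\<close>, so their restrictions to any higher level stay different and can be given
  independent colours. Indexing the members by closure points of a bound for their heights makes the
  family rapid.\<close>

lemma separated_rapid:
  assumes n: "0 < n" and P: "P \<subseteq> tree_rho0 C" "P \<approx> (UNIV :: 'k set)"
  shows "\<exists>S a. S \<subseteq> {s. length s = n \<and> set s \<subseteq> P} \<and> rapid n S \<and> S \<approx> (UNIV :: 'k set) \<and>
    (\<forall>x\<in>S. \<forall>k<n. \<forall>l<n. k \<noteq> l \<longrightarrow> (\<exists>\<xi>\<le>a. (x ! k) \<xi> \<noteq> (x ! l) \<xi>))"
proof -
  have unb: "\<exists>t\<in>P. b < ht t" for b
  proof (rule ccontr)
    assume "\<not> ?thesis"
    then have "P \<subseteq> {t \<in> tree_rho0 C. ht t \<le> b}" using P(1) by (auto simp: not_less)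
    then have "small P" by (rule small_subset[OF small_nodes_below])
    then have "small (UNIV :: 'k set)" using P(2) unfolding small_def by (meson eqpoll_imp_lepoll eqpoll_sym lepoll_trans)
    then show False using not_small_UNIV by (rule notE[rotated])
  qed
  obtain N where N: "n = Suc N" using n by (cases n) auto
  obtain a V where V: "finite V" "card V = n" "\<forall>v\<in>V. big P a v" using many_big[OF P(1) unb, of N] N by blast
  obtain vs where vs: "set vs = V" "distinct vs" using finite_distinct_list[OF V(1)] by blast
  have len: "length vs = n" using distinct_card[OF vs(2)] vs(1) V(2) by simp
  have ext: "\<exists>t. t \<in> P \<and> b < ht t \<and> t |` {..a} = vs ! k" if "k < n" for b k
  proof -
    have "vs ! k \<in> V" using that len vs(1) nth_mem by blast
    then have "big P a (vs ! k)" using V(3) by simp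
    then have "\<exists>t\<in>P. b < ht t \<and> t |` {..a} = vs ! k" unfolding big_def by (rule spec)
    then show ?thesis by (simp only: Bex_def)
  qed
  define y where "y b k = (SOME t. t \<in> P \<and> b < ht t \<and> t |` {..a} = vs ! k)" for b k
  have y: "y b k \<in> P \<and> b < ht (y b k) \<and> y b k |` {..a} = vs ! k" if "k < n" for b k
    unfolding y_def by (rule someI_ex[OF ext[OF that]])
  define X where "X b = map (y b) [0..<n]" for b
  have X: "X b ! k = y b k" if "k < n" for b k using that by (simp add: X_def)
  have "\<exists>c. \<forall>k<n. ht (y b k) < c" for b
  proof -
    have "small ((\<lambda>k. ht (y b k)) ` {..<n})" by (rule small_finite) simp
    from small_bounded[OF this] obtain c where "\<forall>x\<in>(\<lambda>k. ht (y b k)) ` {..<n}. x < c" by (rule exE)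
    then show ?thesis by (intro exI[of _ c]) simp
  qed
  then have "\<forall>b. \<exists>c. \<forall>k<n. ht (y b k) < c" by (rule allI)
  then obtain F where "\<forall>b. \<forall>k<n. ht (y b k) < F b" by (rule choice[THEN exE])
  then have F: "\<And>b k. k < n \<Longrightarrow> ht (y b k) < F b" by simp
  define E where "E = {d. \<forall>x<d. F x < d}"
  have clubE: "club E" unfolding E_def by (rule club_closure_points)
  have inc: "ht (X d ! i) < ht (X d' ! j)" if "d' \<in> E" "d < d'" "i < n" "j < n" for d d' i j
  proof -
    have "ht (y d i) < F d" by (rule F[OF that(3)])
    also have "F d < d'" using that(1,2) by (simp add: E_def)
    also have "d' < ht (y d' j)" using y[OF that(4)] by blast
    finally show ?thesis using X that(3,4) by simp
  qed
  have inj: "inj_on X E"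
  proof (rule inj_onI)
    fix d d' assume d: "d \<in> E" "d' \<in> E" "X d = X d'"
    show "d = d'" using inc[of d' d 0 0] inc[of d d' 0 0] d n by (cases d d' rule: linorder_cases) auto
  qed
  have "E \<approx> (UNIV :: 'k set)" 
    by (rule unbounded_eqpoll) (simp only: Bex_def club_unbounded[OF clubE])
  moreover have "E \<approx> X ` E" unfolding eqpoll_def using inj by (auto simp: bij_betw_def)
  ultimately have eqp: "X ` E \<approx> (UNIV :: 'k set)" by (meson eqpoll_sym eqpoll_trans)
  have rap: "rapid n (X ` E)" unfolding rapid_def
  proof (intro ballI impI)
    fix s t assume "s \<in> X ` E" "t \<in> X ` E" and ne: "s \<noteq> t"
    then obtain d d' where d: "s = X d" "t = X d'" "d \<in> E" "d' \<in> E" by blast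
    then have "d < d' \<or> d' < d" using ne by (metis linorder_neqE)
    then show "(\<forall>i<n. \<forall>j<n. ht (s ! i) < ht (t ! j)) \<or> (\<forall>i<n. \<forall>j<n. ht (t ! i) < ht (s ! j))"
      using inc[OF d(4)] inc[OF d(3)] d(1,2) by blast
  qed
  have sub: "X ` E \<subseteq> {s. length s = n \<and> set s \<subseteq> P}" using y by (auto simp: X_def)
  have diff: "\<exists>\<xi>\<le>a. (x ! k) \<xi> \<noteq> (x ! l) \<xi>" if x: "x \<in> X ` E" and kl: "k < n" "l < n" "k \<noteq> l" for x k l
  proof (rule ccontr)
    assume "\<not> ?thesis"
    then have eq: "\<And>\<xi>. \<xi> \<le> a \<Longrightarrow> (x ! k) \<xi> = (x ! l) \<xi>" by blast
    obtain d where d: "x = X d" using x by blast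
    have "y d k |` {..a} = y d l |` {..a}" using eq X kl by (auto simp: d restrict_map_def fun_eq_iff)
    then have "vs ! k = vs ! l" using y[OF kl(1), of d] y[OF kl(2), of d] by simp
    then show False using vs(2) len kl by (simp add: nth_eq_iff_index_eq)
  qed
  show ?thesis
    by (rule exI[of _ "X ` E"], rule exI[of _ a], intro conjI sub rap eqp ballI allI impI, rule diff)
qed

end

section \<open>The colouring\<close>

locale colouring = guessing m C D0 g H for m :: "'k::wellorder" and C D0 g H +
  fixes n :: nat and sel :: "nat list \<Rightarrow> nat" and mark :: "nat \<Rightarrow> nat"
  assumes n: "0 < n"
    and selector: "\<And>x N. (\<forall>k<n. \<forall>j'\<le>n*n. \<forall>j<j'. strict_prefix (x j k) (x j' k)) \<Longrightarrow>
      (\<exists>a. mark a = N \<and> (\<forall>r. \<exists>j\<le>n*n. \<forall>k<n. sel (x j k @ a # r) = length (x j k)))"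
begin

section \<open>Reading a colour off a node\<close>

definition enum_at :: "'k \<Rightarrow> 'k \<Rightarrow> ('k node \<times> 'k) list" where
  "enum_at \<psi> = (SOME f. lists (range (\<lambda>\<alpha>. level_node \<alpha> \<psi>) \<times> {..\<psi>}) \<subseteq> f ` {..<m})"

text \<open>Bounding the colours by \<open>\<psi>\<close> keeps the number of association lists at
  most \<mu>; any given finite set of colours is covered once \<open>\<psi>\<close> is
  large.\<close>

lemma enum_at_onto:
  assumes "l \<in> lists (range (\<lambda>\<alpha>. level_node \<alpha> \<psi>) \<times> {..\<psi>})" shows "\<exists>\<nu><m. enum_at \<psi> \<nu> = l"
proof -
  have "small (lists (range (\<lambda>\<alpha>. level_node \<alpha> \<psi>) \<times> {..\<psi>}))"
    by (intro small_lists small_Times small_level small_atMost)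
  then have "\<exists>f. lists (range (\<lambda>\<alpha>. level_node \<alpha> \<psi>) \<times> {..\<psi>}) \<subseteq> f ` {..<m}"
    unfolding small_def lepoll_iff .
  then have "lists (range (\<lambda>\<alpha>. level_node \<alpha> \<psi>) \<times> {..\<psi>}) \<subseteq> enum_at \<psi> ` {..<m}"
    unfolding enum_at_def by (rule someI_ex)
  then have "l \<in> enum_at \<psi> ` {..<m}" using assms by (rule subsetD)
  then show ?thesis by auto
qed

definition pivot :: "'k \<Rightarrow> 'k" where
  "pivot b = (SOME z. z \<in> D0 \<and> z < b \<and> (\<forall>x\<in>D0. x < b \<longrightarrow> x \<le> z))"

text \<open>Here \<open>q\<close> is meant to locate \<open>i\<close>, \<open>q1\<close> to locate
  \<open>i1\<close>, and \<open>\<psi>\<close> is the last level below \<open>\<zeta>\<close> at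
  which the word does not yet begin with the stem and \<open>i1\<close>. On nodes of another shape
  the value is arbitrary, which is harmless because all of \<open>'k\<close> are colours.\<close>

definition colour :: "'k node \<Rightarrow> 'k" where
  "colour t = (let \<zeta> = pivot (ht t); w = the (t \<zeta>); q = sel (map H w);
     q1 = (LEAST l. H (w ! l) = mark (H (w ! q)));
     \<psi> = (LEAST \<psi>. \<forall>\<xi>. \<psi> < \<xi> \<and> \<xi> \<le> \<zeta> \<longrightarrow> take (Suc q1) (the (t \<xi>)) = take (Suc q1) w)
     in the (map_of (enum_at \<psi> (g (w ! q))) (t |` {..\<psi>})))"

lemma colour_eq:
  assumes z: "\<zeta> \<in> D0" "\<zeta> < ht t" "\<forall>x\<in>D0. x < ht t \<longrightarrow> x \<le> \<zeta>"
    and w: "t \<zeta> = Some w" "w = (s @ i1 # y) @ i # r"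
    and q: "sel (map H w) = length (s @ i1 # y)" "mark (H i) = H i1" "H i1 \<notin> H ` set s"
    and p: "\<psi> < \<zeta>" "t \<psi> = Some (s @ [i0])" "i0 \<noteq> i1"
    and p': "\<And>\<xi>. \<psi> < \<xi> \<Longrightarrow> \<xi> \<le> \<zeta> \<Longrightarrow> \<exists>r'. t \<xi> = Some (s @ i1 # r')"
    and c: "map_of (enum_at \<psi> (g i)) (t |` {..\<psi>}) = Some c"
  shows "colour t = c"
proof -
  have "\<exists>z. z \<in> D0 \<and> z < ht t \<and> (\<forall>x\<in>D0. x < ht t \<longrightarrow> x \<le> z)" using z by blast
  from someI_ex[OF this] have pv: "pivot (ht t) \<in> D0" "pivot (ht t) < ht t"
      "\<forall>x\<in>D0. x < ht t \<longrightarrow> x \<le> pivot (ht t)"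
    unfolding pivot_def by blast+
  have pz: "pivot (ht t) = \<zeta>" using pv z by (meson order.antisym)
  have wq: "w ! length (s @ i1 # y) = i" unfolding w(2) by (rule nth_append_length)
  have q1: "(LEAST l. H (w ! l) = H i1) = length s"
  proof (rule Least_equality)
    show "H (w ! length s) = H i1" by (simp add: w(2))
    fix l assume l: "H (w ! l) = H i1"
    show "length s \<le> l"
    proof (rule ccontr)
      assume "\<not> length s \<le> l"
      then have "l < length s" by simp
      then have "w ! l = s ! l" "s ! l \<in> set s" by (simp_all add: w(2) nth_append)
      then show False using l q(3) by (metis image_eqI)
    qed
  qed
  have tw: "take (Suc (length s)) w = s @ [i1]" by (simp add: w(2))
  have ps: "(LEAST \<psi>. \<forall>\<xi>. \<psi> < \<xi> \<and> \<xi> \<le> \<zeta> \<longrightarrow> take (Suc (length s)) (the (t \<xi>)) = s @ [i1]) = \<psi>"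
  proof (rule Least_equality)
    show "\<forall>\<xi>. \<psi> < \<xi> \<and> \<xi> \<le> \<zeta> \<longrightarrow> take (Suc (length s)) (the (t \<xi>)) = s @ [i1]"
    proof (intro allI impI)
      fix \<xi> assume "\<psi> < \<xi> \<and> \<xi> \<le> \<zeta>"
      then obtain r' where "t \<xi> = Some (s @ i1 # r')" using p' by blast
      then show "take (Suc (length s)) (the (t \<xi>)) = s @ [i1]" by simp
    qed
    fix \<phi> assume a: "\<forall>\<xi>. \<phi> < \<xi> \<and> \<xi> \<le> \<zeta> \<longrightarrow> take (Suc (length s)) (the (t \<xi>)) = s @ [i1]"
    show "\<psi> \<le> \<phi>"
    proof (rule ccontr)
      assume "\<not> \<psi> \<le> \<phi>"
      then have "take (Suc (length s)) (the (t \<psi>)) = s @ [i1]" using a[rule_format, of \<psi>] p(1) by (simp add: not_le less_imp_le)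
      then show False using p(2,3) by simp
    qed
  qed
  have "colour t = the (map_of (enum_at \<psi> (g i)) (t |` {..\<psi>}))"
    unfolding colour_def Let_def pz w(1) option.sel q(1) wq q(2) q1 tw ps ..
  then show ?thesis using c by simp
qed

lemma map_of_consistent:
  assumes "\<And>k l. k < n \<Longrightarrow> l < n \<Longrightarrow> u ! k = u ! l \<Longrightarrow> \<tau> k = \<tau> l" "k < n"
  shows "map_of (map (\<lambda>k. (u ! k, \<tau> k)) [0..<n]) (u ! k) = Some (\<tau> k)"
proof -
  have "(u ! k, \<tau> k) \<in> set (map (\<lambda>k. (u ! k, \<tau> k)) [0..<n])" using assms(2) by auto
  then obtain v where v: "map_of (map (\<lambda>k. (u ! k, \<tau> k)) [0..<n]) (u ! k) = Some v"
    by (metis weak_map_of_SomeI)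
  from map_of_SomeD[OF v] obtain l where "l < n" "u ! k = u ! l" "v = \<tau> l" by auto
  then show ?thesis using v assms(1)[OF assms(2)] by simp
qed

text \<open>A closure point of \<open>F\<close> has room below it for a point of \<open>D0\<close>
  and for a competitor \<open>\<delta>'\<close> that agrees with \<open>\<delta>\<close> up to
  \<open>x\<close>. The bound is uniform in \<open>\<delta>\<close> because level \<open>x\<close>
  has at most \<mu> nodes.\<close>

lemma closure_function:
  "\<exists>F. \<forall>x::'k. (\<exists>z\<in>D0. x < z \<and> z \<le> F x) \<and>
    (\<forall>\<delta>\<in>Q. x < \<delta> \<longrightarrow> (\<exists>\<delta>'\<in>Q. x < \<delta>' \<and> \<delta>' \<le> F x \<and> level_node \<delta>' x = level_node \<delta> x))"
proof -
  define P where "P x b \<longleftrightarrow> (\<exists>z\<in>D0. x < z \<and> z \<le> b) \<and>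
    (\<forall>\<delta>\<in>Q. x < \<delta> \<longrightarrow> (\<exists>\<delta>'\<in>Q. x < \<delta>' \<and> \<delta>' \<le> b \<and> level_node \<delta>' x = level_node \<delta> x))" for x b
  have "\<exists>b. P x b" for x
  proof -
    obtain z where z: "z \<in> D0" "x < z" using club_unbounded[OF D0(1)] by blast
    define r where "r v = (SOME \<delta>'. \<delta>' \<in> Q \<and> x < \<delta>' \<and> level_node \<delta>' x = v)" for v
    have r: "r (level_node \<delta> x) \<in> Q \<and> x < r (level_node \<delta> x) \<and> level_node (r (level_node \<delta> x)) x = level_node \<delta> x" if "\<delta> \<in> Q" "x < \<delta>" for \<delta>
      unfolding r_def by (rule someI[of _ \<delta>]) (simp add: that)
    have "small ({z} \<union> r ` range (\<lambda>\<alpha>. level_node \<alpha> x))"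
      by (rule small_Un[OF small_finite small_image[OF small_level]]) simp
    from small_bounded[OF this] obtain b where b: "\<forall>y\<in>{z} \<union> r ` range (\<lambda>\<alpha>. level_node \<alpha> x). y < b" by (rule exE)
    have zb: "z \<le> b" using b by (simp add: less_imp_le)
    have rb: "r (level_node \<delta> x) \<le> b" for \<delta> using b by (simp add: less_imp_le)
    have "P x b" unfolding P_def
    proof (intro conjI ballI impI)
      show "\<exists>z\<in>D0. x < z \<and> z \<le> b" using z zb by blast
      fix \<delta> assume "\<delta> \<in> Q" "x < \<delta>"
      from r[OF this] rb[of \<delta>] show "\<exists>\<delta>'\<in>Q. x < \<delta>' \<and> \<delta>' \<le> b \<and> level_node \<delta>' x = level_node \<delta> x"
        by (intro bexI[of _ "r (level_node \<delta> x)"]) simp_all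
    qed
    then show ?thesis by (rule exI)
  qed
  then obtain F where "\<forall>x. P x (F x)" by metis
  then show ?thesis unfolding P_def by (rule exI[of _ F])
qed

text \<open>By rapidity all heights of one member lie below all heights of the other. Listing the
  lower member first makes the lexicographic condition true whatever the lexicographic order is, and
  the meets do not change under the swap.\<close>

lemma good_pair_if_meets:
  assumes S: "S \<subseteq> {s. length s = n \<and> set s \<subseteq> tree_rho0 C}" "rapid n S" and xy: "x \<in> S" "y \<in> S"
    and e: "\<And>k. k < n \<Longrightarrow> \<epsilon> < ht (x ! k) \<and> \<epsilon> < ht (y ! k) \<and> (x ! k) \<epsilon> \<noteq> (y ! k) \<epsilon>"
    and eq: "\<And>k \<xi>. k < n \<Longrightarrow> \<xi> < \<epsilon> \<Longrightarrow> (x ! k) \<xi> = (y ! k) \<xi>"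
    and c: "\<And>k. k < n \<Longrightarrow> colour ((x ! k) |` {..<\<epsilon>}) = \<tau> k"
  shows "\<exists>x\<in>S. \<exists>y\<in>S. good_pair colour n 1 x y \<tau>"
proof -
  have T: "z ! k \<in> tree_rho0 C" if "k < n" "z \<in> S" for z k
    by (rule tuple_nth_mem[OF S(1) that(2,1)])
  have res: "(x ! k) |` {..<\<epsilon>} = (y ! k) |` {..<\<epsilon>}" if "k < n" for k
    using eq[OF that] by (auto simp: restrict_map_def)
  have ne: "x \<noteq> y" using e[OF n] by auto
  have m1: "meet (x ! k) (y ! k) = (x ! k) |` {..<\<epsilon>}" "ht (meet (x ! k) (y ! k)) = \<epsilon>" if k: "k < n" for k
    using Delta_meet[OF T[OF k xy(1)] T[OF k xy(2)]] e[OF k] eq[OF k] by blast+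
  have m2: "meet (y ! k) (x ! k) = (x ! k) |` {..<\<epsilon>}" "ht (meet (y ! k) (x ! k)) = \<epsilon>" if k: "k < n" for k
  proof -
    have "(y ! k) \<epsilon> \<noteq> (x ! k) \<epsilon>" using e[OF k] by (metis (no_types))
    note ne1 = this
    have "\<And>\<xi>. \<xi> < \<epsilon> \<Longrightarrow> (y ! k) \<xi> = (x ! k) \<xi>" using eq[OF k] by simp
    note m = Delta_meet[OF T[OF k xy(2)] T[OF k xy(1)] _ _ ne1 this]
    show "meet (y ! k) (x ! k) = (x ! k) |` {..<\<epsilon>}" using m(1) e[OF k] res[OF k] by simp
    show "ht (meet (y ! k) (x ! k)) = \<epsilon>" using m(2) e[OF k] by simp
  qed
  have card: "card {f k | k. k < n} \<le> 1" if "\<And>k. k < n \<Longrightarrow> f k = \<epsilon>" for f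
  proof -
    have "{f k | k. k < n} \<subseteq> {\<epsilon>}" using that by auto
    from card_mono[OF _ this] show ?thesis by simp
  qed
  consider "\<And>i j. i < n \<Longrightarrow> j < n \<Longrightarrow> ht (x ! i) < ht (y ! j)" | "\<And>i j. i < n \<Longrightarrow> j < n \<Longrightarrow> ht (y ! i) < ht (x ! j)"
    using S(2) xy ne unfolding rapid_def by meson
  then show ?thesis
  proof cases
    case 1
    have "good_pair colour n 1 x y \<tau>"
      unfolding good_pair_def using ne m1 c 1 card[of "\<lambda>k. ht (meet (x ! k) (y ! k))"] by simp
    then show ?thesis using xy by blast
  next
    case 2
    have "good_pair colour n 1 y x \<tau>"
      unfolding good_pair_def using ne m2 c 2 card[of "\<lambda>k. ht (meet (y ! k) (x ! k))"] by simp
    then show ?thesis using xy by blast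
  qed
qed

text \<open>Serves both clauses of the relation: for constant \<open>\<tau>\<close> the separation
  hypothesis is vacuous, and in general it makes the finite function from restrictions to colours
  well defined.\<close>

lemma separated_good_pair:
  assumes S: "S \<subseteq> {s. length s = n \<and> set s \<subseteq> tree_rho0 C}" "rapid n S" "S \<approx> (UNIV :: 'k set)"
    and sep: "\<And>x k l. x \<in> S \<Longrightarrow> k < n \<Longrightarrow> l < n \<Longrightarrow> \<tau> k \<noteq> \<tau> l \<Longrightarrow> \<exists>\<xi>\<le>a0. (x ! k) \<xi> \<noteq> (x ! l) \<xi>"
  shows "\<exists>x\<in>S. \<exists>y\<in>S. good_pair colour n 1 x y \<tau>"
proof -
  have T: "z ! k \<in> tree_rho0 C" if "k < n" "z \<in> S" for z k
    by (rule tuple_nth_mem[OF S(1) that(2,1)])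
  \<comment> \<open>The stem is placed above \<open>b0\<close>, so that coordinates with different
    colours already differ up to \<open>\<psi>\<close> and every colour is at most
    \<open>\<psi>\<close>.\<close>
  have "small (insert a0 (\<tau> ` {..<n}))" by (rule small_finite) simp
  from small_bounded[OF this] obtain b0 where b0: "\<forall>x\<in>insert a0 (\<tau> ` {..<n}). x < b0" by (rule exE)
  obtain \<Gamma> \<psi> s i1 u X where cs: "b0 < \<psi>" "\<forall>b. \<exists>\<gamma>\<in>\<Gamma>. b < \<gamma>"
    "\<forall>k<n. H i1 \<notin> H ` set (s ! k) \<and> (\<exists>i0. i0 \<noteq> i1 \<and> (u ! k) \<psi> = Some (s ! k @ [i0]))"
    "\<forall>\<gamma>\<in>\<Gamma>. X \<gamma> \<in> S \<and> (\<forall>k<n. \<gamma> < ht (X \<gamma> ! k) \<and> (X \<gamma> ! k) |` {..\<psi>} = u ! k \<and>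
      (\<forall>\<xi>. \<psi> < \<xi> \<and> \<xi> < \<gamma> \<longrightarrow> (X \<gamma> ! k) \<xi> = Some (s ! k @ i1 # rho \<xi> \<gamma>)))"
    using common_stem[OF n S, of b0] by (elim exE conjE)
  have fresh: "H i1 \<notin> H ` set (s ! k)" "\<exists>i0. i0 \<noteq> i1 \<and> (u ! k) \<psi> = Some (s ! k @ [i0])" if "k < n" for k
    using cs(3) that by simp_all
  have X: "X \<gamma> \<in> S" if "\<gamma> \<in> \<Gamma>" for \<gamma> using cs(4) that by simp
  have X': "\<gamma> < ht (X \<gamma> ! k)" "(X \<gamma> ! k) |` {..\<psi>} = u ! k"
    "\<And>\<xi>. \<psi> < \<xi> \<Longrightarrow> \<xi> < \<gamma> \<Longrightarrow> (X \<gamma> ! k) \<xi> = Some (s ! k @ i1 # rho \<xi> \<gamma>)" if "\<gamma> \<in> \<Gamma>" "k < n" for \<gamma> k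
    using cs(4) that by simp_all
  have X_stem: "(X \<gamma> ! k) \<xi> = (u ! k) \<xi>" if "\<gamma> \<in> \<Gamma>" "k < n" "\<xi> \<le> \<psi>" for \<gamma> k \<xi>
    using X'(2)[OF that(1,2), symmetric] that(3) by simp
  obtain \<gamma>0 where g0: "\<gamma>0 \<in> \<Gamma>" "\<psi> < \<gamma>0" using cs(2) by blast
  have u_lev: "u ! k \<in> range (\<lambda>\<alpha>. level_node \<alpha> \<psi>)" if k: "k < n" for k
  proof -
    have "\<psi> < ht (X \<gamma>0 ! k)" using X'(1)[OF g0(1) k] g0(2) by order
    from restrict_tree_node[OF T[OF k X[OF g0(1)]] this] show ?thesis unfolding X'(2)[OF g0(1) k] .
  qed
  have consistent: "\<tau> k = \<tau> l" if kl: "k < n" "l < n" "u ! k = u ! l" for k l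
  proof (rule ccontr)
    assume "\<tau> k \<noteq> \<tau> l"
    from sep[OF X[OF g0(1)] kl(1,2) this] obtain \<xi> where xi: "\<xi> \<le> a0" "(X \<gamma>0 ! k) \<xi> \<noteq> (X \<gamma>0 ! l) \<xi>" by blast
    have "a0 < b0" using b0 by simp
    then have "\<xi> \<le> \<psi>" using xi(1) cs(1) by order
    then show False using xi(2) X_stem[OF g0(1) kl(1)] X_stem[OF g0(1) kl(2)] kl(3) by simp
  qed
  have tau: "\<tau> k \<le> \<psi>" if "k < n" for k
  proof -
    have "\<tau> k < b0" using b0 that by simp
    then show ?thesis using cs(1) by order
  qed
  have "map (\<lambda>k. (u ! k, \<tau> k)) [0..<n] \<in> lists (range (\<lambda>\<alpha>. level_node \<alpha> \<psi>) \<times> {..\<psi>})"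
    unfolding in_lists_conv_set using u_lev tau by simp
  from enum_at_onto[OF this] obtain \<nu> where nu: "\<nu> < m" "enum_at \<psi> \<nu> = map (\<lambda>k. (u ! k, \<tau> k)) [0..<n]" by blast
  \<comment> \<open>Only now, with \<open>\<psi>\<close> and \<open>u\<close> fixed, is
    \<open>\<nu>\<close> determined; the positive sets are rebuilt for this
    \<open>\<nu>\<close>.\<close>
  obtain Q a y \<beta> where L: "Pos \<nu> Q" "\<psi> \<le> a" "\<forall>i<n*n. \<exists>e. e \<noteq> [] \<and> y (Suc i) = y i @ e"
    "\<forall>\<delta>\<in>Q. a < \<delta> \<and> (\<forall>i\<le>n*n. \<delta> < \<beta> i \<delta> \<and> \<beta> i \<delta> \<in> \<Gamma> \<and>
      (\<forall>\<xi>. a < \<xi> \<and> \<xi> < \<delta> \<longrightarrow> rho \<xi> (\<beta> i \<delta>) = y i @ rho \<xi> \<delta>))"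
    "\<forall>\<delta>\<in>Q. \<forall>\<delta>'\<in>Q. \<forall>i\<le>n*n. \<forall>\<xi>\<le>a. rho \<xi> (\<beta> i \<delta>) = rho \<xi> (\<beta> i \<delta>')"
    using ladder_uniform[OF nu(1) cs(2)[rule_format], of \<psi> "n*n"] by (elim exE conjE)
  have Qa: "a < \<delta>" if "\<delta> \<in> Q" for \<delta> using L(4) that by simp
  have Qb: "\<delta> < \<beta> i \<delta>" "\<beta> i \<delta> \<in> \<Gamma>"
    "\<And>\<xi>. a < \<xi> \<Longrightarrow> \<xi> < \<delta> \<Longrightarrow> rho \<xi> (\<beta> i \<delta>) = y i @ rho \<xi> \<delta>" if "\<delta> \<in> Q" "i \<le> n*n" for \<delta> i
    using L(4) that by simp_all
  have QA: "\<delta> \<in> Aset C" if "\<delta> \<in> Q" for \<delta> using L(1) that by (auto simp: Pos_def)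
  \<comment> \<open>The label \<open>l\<close> depends only on the stems, \<open>i1\<close> and the
    words of the ladder. The row \<open>j\<close> is fixed later, when the tail
    \<open>rho \<zeta> \<gamma>\<close> is known.\<close>
  have "\<exists>l. mark l = H i1 \<and> (\<forall>r. \<exists>j\<le>n*n. \<forall>k<n.
      sel (map H (s ! k @ i1 # y j) @ l # r) = length (map H (s ! k @ i1 # y j)))"
  proof (rule selector[of "\<lambda>j k. map H (s ! k @ i1 # y j)"], intro allI impI)
    fix k j' j :: nat assume "k < n" "j' \<le> n*n" "j < j'"
    then have "strict_prefix (y j) (y j')" using ladder_strict_prefix[OF L(3)] by simp
    then obtain e where "y j' = y j @ e" "e \<noteq> []" by (auto simp: strict_prefix_def prefix_def)
    then show "strict_prefix (map H (s ! k @ i1 # y j)) (map H (s ! k @ i1 # y j'))"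
      by (simp add: strict_prefix_def)
  qed
  then obtain l where l: "mark l = H i1" "\<forall>r. \<exists>j\<le>n*n. \<forall>k<n.
      sel (map H (s ! k @ i1 # y j) @ l # r) = length (map H (s ! k @ i1 # y j))" by (elim exE conjE)
  obtain F where F: "\<forall>x::'k. (\<exists>z\<in>D0. x < z \<and> z \<le> F x) \<and>
    (\<forall>\<delta>\<in>Q. x < \<delta> \<longrightarrow> (\<exists>\<delta>'\<in>Q. x < \<delta>' \<and> \<delta>' \<le> F x \<and> level_node \<delta>' x = level_node \<delta> x))"
    using closure_function[of Q] by (rule exE)
  have "\<exists>\<delta>\<in>Q. guesses \<nu> \<delta> {\<gamma>. \<forall>x<\<gamma>. F x < \<gamma>}"
    using L(1) club_closure_points[of F] unfolding Pos_def by simp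
  then obtain \<delta> where d: "\<delta> \<in> Q" "guesses \<nu> \<delta> {\<gamma>. \<forall>x<\<gamma>. F x < \<gamma>}" by (rule bexE)
  have "is_lim \<delta>" using QA[OF d(1)] by (simp add: Aset_def)
  from reachesD[OF reaches_C_limit[OF this] Qa[OF d(1)]] obtain c where c: "c \<in> C \<delta>" "a < c" "c < \<delta>" by blast
  obtain \<gamma> where g: "\<gamma> \<in> nacc (C \<delta>)" "\<gamma> \<in> {\<gamma>. \<forall>x<\<gamma>. F x < \<gamma>}" "g (rank_in (C \<delta>) \<gamma>) = \<nu>"
    "H (rank_in (C \<delta>) \<gamma>) = l" "c < \<gamma>" "\<gamma> < \<delta>"
    by (rule guessesD[OF d(2) c(3)])
  have gF: "F x < \<gamma>" if "x < \<gamma>" for x using g(2) that by simp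
  have gC: "\<gamma> \<in> C \<delta>" using g(1) by (simp add: nacc_def)
  obtain \<phi> where p: "c \<le> \<phi>" "\<phi> < \<gamma>" "\<forall>x\<in>C \<delta>. x < \<gamma> \<longrightarrow> x \<le> \<phi>" using nacc_pred[OF g(1) c(1) g(5)] by blast
  define i where "i = rank_in (C \<delta>) \<gamma>"
  have walk: "rho \<xi> \<delta> = i # rho \<xi> \<gamma>" if "\<phi> < \<xi>" "\<xi> \<le> \<gamma>" for \<xi>
    unfolding i_def by (rule rho_gap[OF gC that p(3)])
  \<comment> \<open>From \<open>\<phi>\<close> up to \<open>\<gamma>\<close> the walk from
    \<open>\<delta>\<close> begins with \<open>i\<close>, so agreement of \<open>\<delta>'\<close>
    with \<open>\<delta>\<close> is demanded beyond a point of \<open>D0\<close> in this interval.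
    As \<open>\<gamma>\<close> is closed under \<open>F\<close>, both choices stay below
    \<open>\<gamma>\<close>.\<close>
  obtain \<xi>0 where x0: "\<xi>0 \<in> D0" "\<phi> < \<xi>0" "\<xi>0 \<le> F \<phi>" using F by blast
  have x0g: "\<xi>0 < \<gamma>" using x0(3) gF[OF p(2)] by order
  have x0d: "\<xi>0 < \<delta>" using x0g g(6) by order
  obtain \<delta>' where d': "\<delta>' \<in> Q" "\<xi>0 < \<delta>'" "\<delta>' \<le> F \<xi>0" "level_node \<delta>' \<xi>0 = level_node \<delta> \<xi>0" using F d(1) x0d by blast
  have dg: "\<delta>' < \<gamma>" using d'(3) gF[OF x0g] by order
  have dd: "\<delta>' < \<delta>" using dg g(6) by order
  have same: "rho \<xi> \<delta> = rho \<xi> \<delta>'" if "\<xi> \<le> \<xi>0" for \<xi>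
  proof -
    have "level_node \<delta>' \<xi>0 \<xi> = level_node \<delta> \<xi>0 \<xi>" using d'(4) by simp
    then show ?thesis using that by (simp add: level_node_def)
  qed
  \<comment> \<open>The walk from \<open>\<delta>\<close> to points close below
    \<open>\<delta>'\<close> passes through \<open>\<delta>'\<close>, so its word is strictly longer
    there.\<close>
  have "\<exists>\<xi><\<delta>'. rho \<xi> \<delta> \<noteq> rho \<xi> \<delta>'"
  proof -
    obtain e where e: "e < \<delta>'" "\<forall>\<xi>. e < \<xi> \<and> \<xi> < \<delta>' \<longrightarrow> rho \<xi> \<delta> = rho \<delta>' \<delta> @ rho \<xi> \<delta>'"
      using Aset_walk[OF QA[OF d'(1)] less_imp_le[OF dd]] by blast
    have "is_lim \<delta>'" using QA[OF d'(1)] by (simp add: Aset_def)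
    then obtain \<xi> where xi: "e < \<xi>" "\<xi> < \<delta>'" using e(1) by (auto simp: is_lim_def)
    have "rho \<delta>' \<delta> \<noteq> []" using rho_step[OF d'(2) dd] by simp
    then have "rho \<xi> \<delta> \<noteq> rho \<xi> \<delta>'" using e(2) xi by simp
    then show ?thesis using xi(2) by blast
  qed
  then obtain \<xi>1 where x1: "\<xi>1 < \<delta>'" "rho \<xi>1 \<delta> \<noteq> rho \<xi>1 \<delta>'" by blast
  define \<epsilon> where "\<epsilon> = (LEAST \<xi>. rho \<xi> \<delta> \<noteq> rho \<xi> \<delta>')"
  have e_diff: "rho \<epsilon> \<delta> \<noteq> rho \<epsilon> \<delta>'" unfolding \<epsilon>_def using x1(2) by (rule LeastI)
  have "\<epsilon> \<le> \<xi>1" unfolding \<epsilon>_def using x1(2) by (rule Least_le)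
  then have ed: "\<epsilon> < \<delta>'" using x1(1) by order
  have e_eq: "rho \<xi> \<delta> = rho \<xi> \<delta>'" if "\<xi> < \<epsilon>" for \<xi>
    using not_less_Least[of \<xi> "\<lambda>\<xi>. rho \<xi> \<delta> \<noteq> rho \<xi> \<delta>'"] that by (simp add: \<epsilon>_def)
  have xe: "\<xi>0 < \<epsilon>" using same e_diff by (metis not_le)
  \<comment> \<open>Since the words agree below \<open>\<epsilon>\<close>, they would also agree at
    \<open>\<epsilon>\<close> if \<open>\<epsilon>\<close> were in \<open>Vset C\<close>.\<close>
  have e0: "\<epsilon> \<notin> D0"
  proof
    assume "\<epsilon> \<in> D0"
    then have V: "\<epsilon> \<in> Vset C" using D0(2) by blast
    have "rho \<epsilon> \<delta> = rho \<epsilon> \<delta>'"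
      by (rule Vset_walk[OF V _ _ xe]) (use ed dd e_eq in auto)
    then show False using e_diff by simp
  qed
  \<comment> \<open>The last point \<open>\<zeta>\<close> of \<open>D0\<close> below
    \<open>\<epsilon>\<close> is at least \<open>\<xi>0\<close>, hence inside the interval where the
    walk from \<open>\<delta>\<close> begins with \<open>i\<close>.\<close>
  have "\<not> reaches D0 \<epsilon>" using club_closed[OF D0(1)] e0 by blast
  from ex_Max_below[OF club_closed[OF D0(1)] this x0(1) xe] obtain \<zeta> where
    z: "\<zeta> \<in> D0" "\<xi>0 \<le> \<zeta>" "\<zeta> < \<epsilon>" "\<forall>x\<in>D0. x < \<epsilon> \<longrightarrow> x \<le> \<zeta>" by blast
  have fz: "\<phi> < \<zeta>" using x0(2) z(2) by order
  have zg: "\<zeta> \<le> \<gamma>" using z(3) ed dg by order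
  have az: "a < \<zeta>" using fz p(1) c(2) by order
  obtain j where j: "j \<le> n*n" "\<And>k. k < n \<Longrightarrow>
      sel (map H (s ! k @ i1 # y j) @ l # map H (rho \<zeta> \<gamma>)) = length (map H (s ! k @ i1 # y j))"
    using l(2) by blast
  note bd = Qb[OF d(1) j(1)] and bd' = Qb[OF d'(1) j(1)]
  define x x' where "x = X (\<beta> j \<delta>)" and "x' = X (\<beta> j \<delta>')"
  have low: "rho \<xi> (\<beta> j \<delta>) = rho \<xi> (\<beta> j \<delta>')" if "\<xi> \<le> a" for \<xi> using L(5) d(1) d'(1) j(1) that by blast
  have hi: "(x ! k) \<xi> = Some (s ! k @ i1 # y j @ rho \<xi> \<delta>)" if "k < n" "a < \<xi>" "\<xi> < \<delta>" for k \<xi>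
  proof -
    have "\<psi> < \<xi>" "\<xi> < \<beta> j \<delta>" using L(2) that bd(1) by order+
    from X'(3)[OF bd(2) that(1) this] show ?thesis using bd(3)[OF that(2,3)] by (simp add: x_def)
  qed
  have hi': "(x' ! k) \<xi> = Some (s ! k @ i1 # y j @ rho \<xi> \<delta>')" if "k < n" "a < \<xi>" "\<xi> < \<delta>'" for k \<xi>
  proof -
    have "\<psi> < \<xi>" "\<xi> < \<beta> j \<delta>'" using L(2) that bd'(1) by order+
    from X'(3)[OF bd'(2) that(1) this] show ?thesis using bd'(3)[OF that(2,3)] by (simp add: x'_def)
  qed
  have ae: "a < \<epsilon>" using az z(3) by order
  have ed2: "\<epsilon> < \<delta>" using ed dd by order
  show ?thesis
  proof (rule good_pair_if_meets[OF S(1,2), of x x' \<epsilon>])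
    show "x \<in> S" unfolding x_def by (rule X[OF bd(2)])
    show "x' \<in> S" unfolding x'_def by (rule X[OF bd'(2)])
  next
    fix k assume k: "k < n"
    have "(x ! k) \<epsilon> \<noteq> (x' ! k) \<epsilon>" using hi[OF k ae ed2] hi'[OF k ae ed] e_diff by simp
    moreover have "\<epsilon> < ht (x ! k)" using X'(1)[OF bd(2) k] bd(1) ed2 unfolding x_def by order
    moreover have "\<epsilon> < ht (x' ! k)" using X'(1)[OF bd'(2) k] bd'(1) ed unfolding x'_def by order
    ultimately show "\<epsilon> < ht (x ! k) \<and> \<epsilon> < ht (x' ! k) \<and> (x ! k) \<epsilon> \<noteq> (x' ! k) \<epsilon>" by simp
  next
    fix k \<xi> assume k: "k < n" and xi: "\<xi> < \<epsilon>"
    \<comment> \<open>Agreement below \<open>\<epsilon>\<close> has three sources: the common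
      restriction \<open>u\<close>, the uniformity of the ladder up to \<open>a\<close>, and the
      minimality of \<open>\<epsilon>\<close>.\<close>
    consider "\<xi> \<le> \<psi>" | "\<psi> < \<xi>" "\<xi> \<le> a" | "a < \<xi>" by fastforce
    then show "(x ! k) \<xi> = (x' ! k) \<xi>"
    proof cases
      case 1
      then show ?thesis using X_stem[OF bd(2) k] X_stem[OF bd'(2) k] by (simp add: x_def x'_def)
    next
      case 2
      have "\<xi> < \<beta> j \<delta>" "\<xi> < \<beta> j \<delta>'" using xi ed ed2 bd(1) bd'(1) by order+
      then show ?thesis
        using X'(3)[OF bd(2) k 2(1)] X'(3)[OF bd'(2) k 2(1)] low[OF 2(2)] by (simp add: x_def x'_def)
    next
      case 3
      have "\<xi> < \<delta>" "\<xi> < \<delta>'" using xi ed ed2 by order+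
      then show ?thesis using hi[OF k 3] hi'[OF k 3] e_eq[OF xi] by simp
    qed
  next
    fix k assume k: "k < n"
    define t where "t = (x ! k) |` {..<\<epsilon>}"
    have t_nth: "t \<xi> = (x ! k) \<xi>" if "\<xi> < \<epsilon>" for \<xi> using that by (simp add: t_def)
    have xT: "x ! k \<in> tree_rho0 C" unfolding x_def by (rule T[OF k X[OF bd(2)]])
    have eh: "\<epsilon> < ht (x ! k)" using X'(1)[OF bd(2) k] bd(1) ed2 unfolding x_def by order
    have "dom t = {..<\<epsilon>}" unfolding t_def dom_restrict dom_tree_node[OF xT] using eh by auto
    then have ht_t: "ht t = \<epsilon>" by (rule ht_eq)
    have pe: "\<psi> < \<epsilon>" using L(2) ae by order
    have pz: "\<psi> < \<zeta>" using L(2) az by order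
    obtain i0 where i0: "i0 \<noteq> i1" "(u ! k) \<psi> = Some (s ! k @ [i0])" using fresh(2)[OF k] by blast
    define w where "w = (s ! k @ i1 # y j) @ i # rho \<zeta> \<gamma>"
    have zd: "\<zeta> < \<delta>" using z(3) ed2 by order
    have t_stem: "t |` {..\<psi>} = u ! k"
    proof -
      have "t |` {..\<psi>} = (x ! k) |` {..\<psi>}" 
        using pe by (auto simp: t_def restrict_map_def fun_eq_iff)
      then show ?thesis using X'(2)[OF bd(2) k] by (simp add: x_def)
    qed
    have "colour t = \<tau> k"
    proof (rule colour_eq)
      show "\<zeta> \<in> D0" by (rule z(1))
      show "\<zeta> < ht t" "\<forall>x\<in>D0. x < ht t \<longrightarrow> x \<le> \<zeta>" using z(3,4) by (simp_all add: ht_t)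
      show "t \<zeta> = Some w" using t_nth[OF z(3)] hi[OF k az zd] walk[OF fz zg] by (simp add: w_def)
      show "w = (s ! k @ i1 # y j) @ i # rho \<zeta> \<gamma>" by (rule w_def)
      show "sel (map H w) = length (s ! k @ i1 # y j)" using j(2)[OF k] g(4) by (simp add: w_def i_def)
      show "mark (H i) = H i1" using l(1) g(4) by (simp add: i_def)
      show "H i1 \<notin> H ` set (s ! k)" by (rule fresh(1)[OF k])
      show "\<psi> < \<zeta>" by (rule pz)
      show "t \<psi> = Some (s ! k @ [i0])" using t_nth[OF pe] X_stem[OF bd(2) k order_refl] i0(2) by (simp add: x_def)
      show "i0 \<noteq> i1" by (rule i0(1))
      show "map_of (enum_at \<psi> (g i)) (t |` {..\<psi>}) = Some (\<tau> k)"
        unfolding t_stem i_def g(3) nu(2) by (rule map_of_consistent[OF consistent k])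
      fix \<xi> assume xi: "\<psi> < \<xi>" "\<xi> \<le> \<zeta>"
      have "\<xi> < \<beta> j \<delta>" "\<xi> < \<epsilon>" using xi(2) zd z(3) bd(1) by order+
      then show "\<exists>r'. t \<xi> = Some (s ! k @ i1 # r')"
        using X'(3)[OF bd(2) k xi(1)] t_nth by (simp add: x_def)
    qed
    then show "colour ((x ! k) |` {..<\<epsilon>}) = \<tau> k" by (simp add: t_def)
  qed
qed

lemma neg_arrow: "tree_neg_arrow (tree_rho0 C) n 1 UNIV"
  unfolding tree_neg_arrow_def
proof (intro exI[of _ colour] conjI ballI allI impI)
  fix S :: "'k node list set" and \<tau> :: 'k
  assume S: "S \<subseteq> {s. length s = n \<and> set s \<subseteq> tree_rho0 C} \<and> rapid n S \<and> S \<approx> (UNIV::'k set)"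
  obtain a0 :: 'k where True by simp
  show "\<exists>x\<in>S. \<exists>y\<in>S. good_pair colour n 1 x y (\<lambda>_. \<tau>)"
    by (rule separated_good_pair[OF conjunct1[OF S] conjunct1[OF conjunct2[OF S]] conjunct2[OF conjunct2[OF S]], of _ a0]) simp
next
  fix T' :: "'k node set"
  assume T': "T' \<subseteq> tree_rho0 C \<and> T' \<approx> (UNIV::'k set)"
  obtain S' a where S': "S' \<subseteq> {s. length s = n \<and> set s \<subseteq> T'}" "rapid n S'" "S' \<approx> (UNIV::'k set)"
    "\<forall>x\<in>S'. \<forall>k<n. \<forall>l<n. k \<noteq> l \<longrightarrow> (\<exists>\<xi>\<le>a. (x ! k) \<xi> \<noteq> (x ! l) \<xi>)"
    using separated_rapid[OF n conjunct1[OF T'] conjunct2[OF T']] by (elim exE conjE)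
  have gp: "\<exists>x\<in>S. \<exists>y\<in>S. good_pair colour n 1 x y \<tau>" if S: "S \<subseteq> S'" "S \<approx> (UNIV::'k set)" for S \<tau>
  proof (rule separated_good_pair[of S _ a])
    show "S \<subseteq> {s. length s = n \<and> set s \<subseteq> tree_rho0 C}" 
    proof
      fix s assume "s \<in> S"
      then have "s \<in> {s. length s = n \<and> set s \<subseteq> T'}" by (rule subsetD[OF subset_trans[OF S(1) S'(1)]])
      then show "s \<in> {s. length s = n \<and> set s \<subseteq> tree_rho0 C}" using conjunct1[OF T'] by auto
    qed
    show "rapid n S" using S'(2) S(1) unfolding rapid_def by blast
    show "S \<approx> (UNIV::'k set)" by (rule S(2))
    fix x k l assume x: "x \<in> S" "k < n" "l < n" "\<tau> k \<noteq> \<tau> l"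
    then have "k \<noteq> l" by auto
    with S'(4)[rule_format, OF subsetD[OF S(1) x(1)] x(2,3)] show "\<exists>\<xi>\<le>a. (x ! k) \<xi> \<noteq> (x ! l) \<xi>" .
  qed
  show "\<exists>S'. S' \<subseteq> {s. length s = n \<and> set s \<subseteq> T'} \<and> rapid n S' \<and> S' \<approx> (UNIV::'k set) \<and>
           (\<forall>S. S \<subseteq> S' \<and> S \<approx> (UNIV::'k set) \<longrightarrow>
              (\<forall>\<tau>. (\<forall>k<n. \<tau> k \<in> UNIV) \<longrightarrow> (\<exists>x\<in>S. \<exists>y\<in>S. good_pair colour n 1 x y \<tau>)))"
    by (rule exI[of _ S'], intro conjI S'(1-3) allI impI, elim conjE, rule gp)
qed simp

end

section \<open>From guessing with values below \<open>omega\<close> to labels in the natural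
  numbers\<close>

lemma infinite_lessThan_omega:
  fixes m :: "'k::wellorder"
  assumes "infinite {..<m}" shows "infinite {..<(omega::'k)}"
proof -
  define x where "x = (LEAST x::'k. infinite {..<x})"
  have x: "infinite {..<x}" unfolding x_def using assms by (rule LeastI)
  have fin: "finite {..<y}" if "y < x" for y using not_less_Least[of y "\<lambda>x. infinite {..<x}"] that by (auto simp: x_def)
  \<comment> \<open>The least ordinal with infinitely many predecessors is a limit, so the
    \<open>LEAST\<close> that defines \<open>omega\<close> is attained.\<close>
  have "is_lim x" unfolding is_lim_def
  proof (intro conjI allI impI)
    show "\<exists>\<beta>. \<beta> < x" using x by (metis finite.emptyI lessThan_iff equals0I)
    fix \<beta> assume b: "\<beta> < x"
    show "\<exists>\<gamma>. \<beta> < \<gamma> \<and> \<gamma> < x"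
    proof (rule ccontr)
      assume "\<not> ?thesis"
      then have "{..<x} \<subseteq> insert \<beta> {..<\<beta>}" by force
      then show False using x fin[OF b] by (meson finite_insert finite_subset)
    qed
  qed
  then have "is_lim (omega::'k)" unfolding omega_def by (rule LeastI)
  then have lim: "\<exists>\<beta>::'k. \<beta> < omega" "\<And>\<beta>::'k. \<beta> < omega \<Longrightarrow> \<exists>\<gamma>. \<beta> < \<gamma> \<and> \<gamma> < omega"
    by (auto simp: is_lim_def)
  show ?thesis
  proof
    assume f: "finite {..<(omega::'k)}"
    have "Max {..<(omega::'k)} \<in> {..<omega}" using f lim(1) by (intro Max_in) auto
    then obtain \<gamma> :: 'k where "Max {..<(omega::'k)} < \<gamma>" "\<gamma> < omega" using lim(2) by auto
    then show False using Max_ge[OF f, of \<gamma>] by simp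
  qed
qed

theorem theorem9p3:
  fixes m :: "'k::wellorder" and C :: "'k \<Rightarrow> 'k set"
  assumes "infinite_cardinal m"
    and "is_succ_of m"
    and "square_star m C"
    and "\<exists>D. club D \<and> D \<subseteq> Vset C"
    and "omega \<in> Theta1 m (Aset C) C UNIV"
  shows "\<forall>n\<ge>1. tree_neg_arrow (tree_rho0 C) n 1 UNIV"
proof (intro allI impI)
  fix n :: nat assume n: "n \<ge> 1"
  have inf: "infinite {..<m}" using assms(1) by (simp add: infinite_cardinal_def)
  obtain D0 where D0: "club D0" "D0 \<subseteq> Vset C" using assms(4) by blast
  obtain g h :: "'k \<Rightarrow> 'k" where h: "\<forall>D. club D \<longrightarrow> (\<forall>\<nu><m. \<exists>\<delta>\<in>Aset C. \<forall>\<tau><omega.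
          reaches {\<gamma> \<in> nacc (C \<delta>) \<inter> D \<inter> UNIV.
                    g (otp (C \<delta> \<inter> {..<\<gamma>})) = \<nu> \<and> h (otp (C \<delta> \<inter> {..<\<gamma>})) = \<tau>} \<delta>)"
    using assms(5) unfolding Theta1_def mem_Collect_eq by (elim exE conjE)
  have "(UNIV :: nat set) \<lesssim> {..<(omega::'k)}"
    using infinite_lessThan_omega[OF inf] infinite_le_lepoll by blast
  \<comment> \<open>Being onto, \<open>code\<close> makes every natural number the label of some
    value below \<open>omega\<close>, so guessing every value below \<open>omega\<close> yields
    guessing every label.\<close>
  then obtain code :: "'k \<Rightarrow> nat" where code: "UNIV \<subseteq> code ` {..<omega}" unfolding lepoll_iff by blast
  obtain sel mark where sel: "\<forall>(x :: nat \<Rightarrow> nat \<Rightarrow> nat list) (N :: nat).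
    (\<forall>k<n. \<forall>j'\<le>n*n. \<forall>j<j'. strict_prefix (x j k) (x j' k)) \<longrightarrow>
    (\<exists>a. mark a = N \<and> (\<forall>r. \<exists>j\<le>n*n. \<forall>k<n. sel (x j k @ a # r) = length (x j k)))"
    using coded_selector[of n] n by auto
  have "colouring m C D0 g (code \<circ> h) n sel mark"
  proof unfold_locales
    fix D :: "'k set" and \<nu> assume "club D" "\<nu> < m"
    then obtain \<delta> where d: "\<delta> \<in> Aset C" "\<forall>\<tau><omega. reaches {\<gamma> \<in> nacc (C \<delta>) \<inter> D \<inter> UNIV.
        g (otp (C \<delta> \<inter> {..<\<gamma>})) = \<nu> \<and> h (otp (C \<delta> \<inter> {..<\<gamma>})) = \<tau>} \<delta>" using h by blast
    have "reaches {\<gamma> \<in> nacc (C \<delta>) \<inter> D. g (rank_in (C \<delta>) \<gamma>) = \<nu> \<and> (code \<circ> h) (rank_in (C \<delta>) \<gamma>) = N} \<delta>" for N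
    proof -
      obtain \<tau> where t: "\<tau> < omega" "code \<tau> = N" using code by (metis UNIV_I imageE lessThan_iff subsetD)
      have "reaches {\<gamma> \<in> nacc (C \<delta>) \<inter> D \<inter> UNIV. g (rank_in (C \<delta>) \<gamma>) = \<nu> \<and> h (rank_in (C \<delta>) \<gamma>) = \<tau>} \<delta>"
        using d(2) t(1) by (simp add: otp_eq_rank_in)
      then show ?thesis using t(2) unfolding reaches_def by fastforce
    qed
    then show "\<exists>\<delta>\<in>Aset C. \<forall>N. reaches {\<gamma> \<in> nacc (C \<delta>) \<inter> D.
        g (rank_in (C \<delta>) \<gamma>) = \<nu> \<and> (code \<circ> h) (rank_in (C \<delta>) \<gamma>) = N} \<delta>" using d(1) by blast
  qed (use inf assms(2,3) D0 n sel in auto)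
  then show "tree_neg_arrow (tree_rho0 C) n 1 UNIV" by (rule colouring.neg_arrow)
qed

end
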